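(* Let $n\ge1$ and $r\ge 1$ be integers, and let $K$ be a Noetherian commutative ring containing an invertible element $\varepsilon$. Then the ring $Z=K[X_1^{\pm1},\dots,X_r^{\pm1}]^{\mathfrak S_r}$ is Noetherian. Moreover, the affine quantum Schur algebra $S=\mathcal S_{\vartriangle}(n,r)_K=\operatorname{End}_{H}\bigl(\bigoplus_{\lambda\in\Lambda_{\vartriangle}(n,r)}x_\lambda H\bigr)$ is both left and right Noetherian, where $H=\mathcal H_{\vartriangle}(r)_K$ is the extended affine Hecke algebra of type $A$ with Hecke parameter $\varepsilon$.
   Context: Put $q=\varepsilon^2$. $H=\mathcal H_{\vartriangle}(r)_K$ is the $K$-algebra given by the Bernstein presentation: generators $T_1,\dots,T_{r-1}$, $X_1^{\pm1},\dots,X_r^{\pm1}$ and relations $(T_i+1)(T_i-q)=0$; $T_iT_j=T_jT_i$ for $|i-j|>1$; $T_iT_{i+1}T_i=T_{i+1}T_iT_{i+1}$; $X_iX_i^{-1}=1=X_i^{-1}X_i$; $X_iX_j=X_jX_i$; $T_iX_iT_i=qX_{i+1}$; $X_jT_i=T_iX_j$ for $j\ne i,i+1$. For $w\in\mathfrak S_r$ with reduced expression $w=s_{i_1}\cdots s_{i_m}$ put $T_w=T_{i_1}\cdots T_{i_m}$. The center of $H$ is the ring $Z$ of symmetric Laurent polynomials. $\Lambda_{\vartriangle}(n,r)$ is identified with the set of tuples $(\lambda_1,\dots,\lambda_n)$ of nonnegative integers with sum $r$; $\mathfrak S_\lambda\subseteq\mathfrak S_r$ is the standard Young subgroup and $x_\lambda=\sum_{w\in\mathfrak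 S_\lambda}T_w$. (In the paper $S$ is defined as $\mathcal S_{\vartriangle}(n,r)_{\mathbb Z[v,v^{-1}]}\otimes K$ with $v\mapsto\varepsilon$, which is canonically identified with $\operatorname{End}_{H}\bigl(\bigoplus_{\lambda\in\Lambda_{\vartriangle}(n,r)}x_\lambda H\bigr)$.) *)

theory Defs
  imports "HOL-Algebra.Algebra" "HOL-Algebra.Free_Abelian_Groups"
    "HOL-Combinatorics.Permutations"
begin

section \<open>One-sided Noetherian rings\<close>

text \<open>
  The library locale \<^locale>\<open>noetherian_ring\<close> speaks about two-sided ideals, so it is the right
  notion for commutative rings only.
\<close>

definition left_ideal :: "'a set \<Rightarrow> ('a, 'b) ring_scheme \<Rightarrow> bool" where
  "left_ideal I R \<longleftrightarrow>
    additive_subgroup I R \<and> (\<forall>a\<in>I. \<forall>x\<in>carrier R. x \<otimes>\<^bsub>R\<^esub> a \<in> I)"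

definition right_ideal :: "'a set \<Rightarrow> ('a, 'b) ring_scheme \<Rightarrow> bool" where
  "right_ideal I R \<longleftrightarrow>
    additive_subgroup I R \<and> (\<forall>a\<in>I. \<forall>x\<in>carrier R. a \<otimes>\<^bsub>R\<^esub> x \<in> I)"

locale left_noetherian_ring = ring +
  assumes left_finitely_gen:
    "left_ideal I R \<Longrightarrow>
      \<exists>A \<subseteq> carrier R. finite A \<and> I = \<Inter>{J. left_ideal J R \<and> A \<subseteq> J}"

locale right_noetherian_ring = ring +
  assumes right_finitely_gen:
    "right_ideal I R \<Longrightarrow>
      \<exists>A \<subseteq> carrier R. finite A \<and> I = \<Inter>{J. right_ideal J R \<and> A \<subseteq> J}"


section \<open>Monoid algebras, free algebras and Laurent polynomials\<close>

definition monoid_algebra ::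
  "('a, 'c) ring_scheme \<Rightarrow> ('m, 'd) monoid_scheme \<Rightarrow> ('m \<Rightarrow> 'a) ring" where
  "monoid_algebra K M =
    \<lparr>carrier = {f. (\<forall>m. f m \<in> carrier K) \<and> (\<forall>m. m \<notin> carrier M \<longrightarrow> f m = \<zero>\<^bsub>K\<^esub>) \<and>
                   finite {m. f m \<noteq> \<zero>\<^bsub>K\<^esub>}},
     monoid.mult = (\<lambda>f g m. finsum K (\<lambda>(u, v). f u \<otimes>\<^bsub>K\<^esub> g v)
        {(u, v). f u \<noteq> \<zero>\<^bsub>K\<^esub> \<and> g v \<noteq> \<zero>\<^bsub>K\<^esub> \<and> u \<otimes>\<^bsub>M\<^esub> v = m}),
     one = (\<lambda>m. if m = \<one>\<^bsub>M\<^esub> then \<one>\<^bsub>K\<^esub> else \<zero>\<^bsub>K\<^esub>),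
     ring.zero = (\<lambda>m. \<zero>\<^bsub>K\<^esub>),
     add = (\<lambda>f g m. f m \<oplus>\<^bsub>K\<^esub> g m)\<rparr>"

text \<open>The element \<open>a \<cdot> m\<close> of the monoid algebra.\<close>

definition monoid_algebra_term :: "('a, 'c) ring_scheme \<Rightarrow> 'a \<Rightarrow> 'm \<Rightarrow> 'm \<Rightarrow> 'a" where
  "monoid_algebra_term K a m = (\<lambda>m'. if m' = m then a else \<zero>\<^bsub>K\<^esub>)"

definition free_monoid :: "'g set \<Rightarrow> 'g list monoid" where
  "free_monoid G = \<lparr>carrier = lists G, monoid.mult = (@), one = []\<rparr>"

definition free_algebra :: "('a, 'c) ring_scheme \<Rightarrow> 'g set \<Rightarrow> ('g list \<Rightarrow> 'a) ring" where
  "free_algebra K G = monoid_algebra K (free_monoid G)"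

text \<open>
  Laurent polynomials in \<open>X\<^sub>1, \<dots>, X\<^sub>r\<close>: an exponent vector is an element of the free abelian
  group on \<open>{1..r}\<close>, whose monoid operation is \<open>(+)\<close>.
\<close>

definition laurent_poly_ring ::
  "('a, 'c) ring_scheme \<Rightarrow> nat \<Rightarrow> ((nat \<Rightarrow>\<^sub>0 int) \<Rightarrow> 'a) ring" where
  "laurent_poly_ring K r = monoid_algebra K (free_Abelian_group {1..r})"

text \<open>
  The action of a permutation \<open>w\<close> by \<open>X\<^sub>i \<mapsto> X\<^bsub>w i\<^esub>\<close>; the exponent vector
  \<open>Poly_Mapping.map_key w c\<close> is \<open>c \<circ> w\<close>.
\<close>

definition laurent_perm ::
  "(nat \<Rightarrow> nat) \<Rightarrow> ((nat \<Rightarrow>\<^sub>0 int) \<Rightarrow> 'a) \<Rightarrow> (nat \<Rightarrow>\<^sub>0 int) \<Rightarrow> 'a" where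
  "laurent_perm w f = (\<lambda>c. f (Poly_Mapping.map_key w c))"

definition symmetric_laurent_ring ::
  "('a, 'c) ring_scheme \<Rightarrow> nat \<Rightarrow> ((nat \<Rightarrow>\<^sub>0 int) \<Rightarrow> 'a) ring" where
  "symmetric_laurent_ring K r = (laurent_poly_ring K r)
    \<lparr>carrier := {f \<in> carrier (laurent_poly_ring K r).
                  \<forall>w. w permutes {1..r} \<longrightarrow> laurent_perm w f = f}\<rparr>"


section \<open>The extended affine Hecke algebra\<close>

datatype hecke_gen = GenT nat | GenX nat | GenXinv nat

definition hecke_gens :: "nat \<Rightarrow> hecke_gen set" where
  "hecke_gens r = GenT ` {1..<r} \<union> GenX ` {1..r} \<union> GenXinv ` {1..r}"

type_synonym 'a hecke_word_poly = "hecke_gen list \<Rightarrow> 'a"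

definition hecke_free :: "('a, 'c) ring_scheme \<Rightarrow> nat \<Rightarrow> 'a hecke_word_poly ring" where
  "hecke_free K r = free_algebra K (hecke_gens r)"

text \<open>
  The Bernstein relations for the parameter \<open>q = \<epsilon>\<^sup>2\<close>; a relation \<open>a = b\<close> is represented by
  \<open>a \<ominus> b\<close>.
\<close>

definition hecke_relations ::
  "('a, 'c) ring_scheme \<Rightarrow> nat \<Rightarrow> 'a \<Rightarrow> 'a hecke_word_poly set" where
  "hecke_relations K r \<epsilon> =
    (let F = hecke_free K r;
         q = monoid_algebra_term K (\<epsilon> [^]\<^bsub>K\<^esub> (2::nat)) [];
         t = (\<lambda>i. monoid_algebra_term K \<one>\<^bsub>K\<^esub> [GenT i]);
         x = (\<lambda>i. monoid_algebra_term K \<one>\<^bsub>K\<^esub> [GenX i]);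
         y = (\<lambda>i. monoid_algebra_term K \<one>\<^bsub>K\<^esub> [GenXinv i])
     in {(t i \<oplus>\<^bsub>F\<^esub> \<one>\<^bsub>F\<^esub>) \<otimes>\<^bsub>F\<^esub> (t i \<ominus>\<^bsub>F\<^esub> q) | i. i \<in> {1..<r}}
      \<union> {t i \<otimes>\<^bsub>F\<^esub> t j \<ominus>\<^bsub>F\<^esub> t j \<otimes>\<^bsub>F\<^esub> t i
          | i j. i \<in> {1..<r} \<and> j \<in> {1..<r} \<and> (i + 1 < j \<or> j + 1 < i)}
      \<union> {t i \<otimes>\<^bsub>F\<^esub> t (i + 1) \<otimes>\<^bsub>F\<^esub> t i \<ominus>\<^bsub>F\<^esub> t (i + 1) \<otimes>\<^bsub>F\<^esub> t i \<otimes>\<^bsub>F\<^esub> t (i + 1)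
          | i. i \<in> {1..<r} \<and> i + 1 \<in> {1..<r}}
      \<union> {x i \<otimes>\<^bsub>F\<^esub> y i \<ominus>\<^bsub>F\<^esub> \<one>\<^bsub>F\<^esub> | i. i \<in> {1..r}}
      \<union> {y i \<otimes>\<^bsub>F\<^esub> x i \<ominus>\<^bsub>F\<^esub> \<one>\<^bsub>F\<^esub> | i. i \<in> {1..r}}
      \<union> {x i \<otimes>\<^bsub>F\<^esub> x j \<ominus>\<^bsub>F\<^esub> x j \<otimes>\<^bsub>F\<^esub> x i | i j. i \<in> {1..r} \<and> j \<in> {1..r}}
      \<union> {t i \<otimes>\<^bsub>F\<^esub> x i \<otimes>\<^bsub>F\<^esub> t i \<ominus>\<^bsub>F\<^esub> q \<otimes>\<^bsub>F\<^esub> x (i + 1) | i. i \<in> {1..<r}}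
      \<union> {x j \<otimes>\<^bsub>F\<^esub> t i \<ominus>\<^bsub>F\<^esub> t i \<otimes>\<^bsub>F\<^esub> x j
          | i j. i \<in> {1..<r} \<and> j \<in> {1..r} \<and> j \<noteq> i \<and> j \<noteq> i + 1})"

definition hecke_ideal ::
  "('a, 'c) ring_scheme \<Rightarrow> nat \<Rightarrow> 'a \<Rightarrow> 'a hecke_word_poly set" where
  "hecke_ideal K r \<epsilon> = Idl\<^bsub>hecke_free K r\<^esub> (hecke_relations K r \<epsilon>)"

definition affine_hecke ::
  "('a, 'c) ring_scheme \<Rightarrow> nat \<Rightarrow> 'a \<Rightarrow> 'a hecke_word_poly set ring" where
  "affine_hecke K r \<epsilon> = hecke_free K r Quot hecke_ideal K r \<epsilon>"

definition hecke_T ::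
  "('a, 'c) ring_scheme \<Rightarrow> nat \<Rightarrow> 'a \<Rightarrow> nat \<Rightarrow> 'a hecke_word_poly set" where
  "hecke_T K r \<epsilon> i =
    hecke_ideal K r \<epsilon> +>\<^bsub>hecke_free K r\<^esub> monoid_algebra_term K \<one>\<^bsub>K\<^esub> [GenT i]"

text \<open>The word \<open>[i\<^sub>1, \<dots>, i\<^sub>m]\<close> stands for \<open>s\<^bsub>i\<^sub>1\<^esub> \<circ> \<dots> \<circ> s\<^bsub>i\<^sub>m\<^esub>\<close>.\<close>

definition word_perm :: "nat list \<Rightarrow> nat \<Rightarrow> nat" where
  "word_perm ks = foldr (\<lambda>i w. transpose i (i + 1) \<circ> w) ks id"

definition reduced_expression :: "nat \<Rightarrow> (nat \<Rightarrow> nat) \<Rightarrow> nat list \<Rightarrow> bool" where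
  "reduced_expression r w ks \<longleftrightarrow>
    set ks \<subseteq> {1..<r} \<and> word_perm ks = w \<and>
    (\<forall>ls. set ls \<subseteq> {1..<r} \<and> word_perm ls = w \<longrightarrow> length ks \<le> length ls)"

text \<open>
  By the braid relations (Matsumoto's theorem) the product does not depend on the chosen reduced
  expression.
\<close>

definition hecke_Tw ::
  "('a, 'c) ring_scheme \<Rightarrow> nat \<Rightarrow> 'a \<Rightarrow> (nat \<Rightarrow> nat) \<Rightarrow> 'a hecke_word_poly set" where
  "hecke_Tw K r \<epsilon> w =
    (let H = affine_hecke K r \<epsilon>
     in foldr (\<lambda>i h. hecke_T K r \<epsilon> i \<otimes>\<^bsub>H\<^esub> h) (SOME ks. reduced_expression r w ks) \<one>\<^bsub>H\<^esub>)"


section \<open>The affine quantum Schur algebra\<close>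

definition compositions :: "nat \<Rightarrow> nat \<Rightarrow> nat list set" where
  "compositions n r = {\<mu>. length \<mu> = n \<and> sum_list \<mu> = r}"

definition young_subgroup :: "nat list \<Rightarrow> (nat \<Rightarrow> nat) set" where
  "young_subgroup \<mu> =
    {w. w permutes {1..sum_list \<mu>} \<and>
        (\<forall>k<length \<mu>. let B = {sum_list (take k \<mu>)<..sum_list (take (k + 1) \<mu>)} in w ` B = B)}"

definition hecke_x ::
  "('a, 'c) ring_scheme \<Rightarrow> nat \<Rightarrow> 'a \<Rightarrow> nat list \<Rightarrow> 'a hecke_word_poly set" where
  "hecke_x K r \<epsilon> \<mu> = (\<Oplus>\<^bsub>affine_hecke K r \<epsilon>\<^esub>w \<in> young_subgroup \<mu>. hecke_Tw K r \<epsilon> w)"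

text \<open>
  Right modules over \<open>H\<close> are represented by the library's \<open>module\<close> record, where
  \<open>h \<odot>\<^bsub>M\<^esub> m\<close> is to be read as \<open>m \<cdot> h\<close>; the ring multiplication fields of that record
  are meaningless.  The following is the (finite) direct sum of the right ideals \<open>x i H\<close>.
\<close>

definition right_ideal_sum ::
  "('h, 'c) ring_scheme \<Rightarrow> 'i set \<Rightarrow> ('i \<Rightarrow> 'h) \<Rightarrow> ('h, 'i \<Rightarrow> 'h) module" where
  "right_ideal_sum H I x =
    \<lparr>carrier = (\<Pi>\<^sub>E i\<in>I. x i <#\<^bsub>H\<^esub> carrier H),
     monoid.mult = undefined, one = undefined,
     ring.zero = (\<lambda>i\<in>I. \<zero>\<^bsub>H\<^esub>),
     add = (\<lambda>m m'. \<lambda>i\<in>I. m i \<oplus>\<^bsub>H\<^esub> m' i),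
     smult = (\<lambda>h m. \<lambda>i\<in>I. m i \<otimes>\<^bsub>H\<^esub> h)\<rparr>"

definition right_module_End ::
  "('h, 'c) ring_scheme \<Rightarrow> ('h, 'm, 'd) module_scheme \<Rightarrow> ('m \<Rightarrow> 'm) ring" where
  "right_module_End H M =
    \<lparr>carrier = {\<phi> \<in> carrier M \<rightarrow>\<^sub>E carrier M.
        (\<forall>m\<in>carrier M. \<forall>m'\<in>carrier M. \<phi> (m \<oplus>\<^bsub>M\<^esub> m') = \<phi> m \<oplus>\<^bsub>M\<^esub> \<phi> m') \<and>
        (\<forall>h\<in>carrier H. \<forall>m\<in>carrier M. \<phi> (h \<odot>\<^bsub>M\<^esub> m) = h \<odot>\<^bsub>M\<^esub> \<phi> m)},
     monoid.mult = (\<lambda>\<phi> \<psi>. compose (carrier M) \<phi> \<psi>),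
     one = (\<lambda>m\<in>carrier M. m),
     ring.zero = (\<lambda>m\<in>carrier M. \<zero>\<^bsub>M\<^esub>),
     add = (\<lambda>\<phi> \<psi>. \<lambda>m\<in>carrier M. \<phi> m \<oplus>\<^bsub>M\<^esub> \<psi> m)\<rparr>"

definition affine_schur ::
  "('a, 'c) ring_scheme \<Rightarrow> nat \<Rightarrow> nat \<Rightarrow> 'a
    \<Rightarrow> ((nat list \<Rightarrow> 'a hecke_word_poly set) \<Rightarrow> nat list \<Rightarrow> 'a hecke_word_poly set) ring" where
  "affine_schur K n r \<epsilon> =
    (let H = affine_hecke K r \<epsilon>
     in right_module_End H (right_ideal_sum H (compositions n r) (hecke_x K r \<epsilon>)))"

end

theory Submission
  imports Defs
begin

text \<open>
  Both assertions follow from finite generation over a commutative ring of operators. A module is represented by an additive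
  subgroup \<open>N\<close> of a ring that is closed under left multiplication by a set \<open>W\<close> of elements; if the
  elements of \<open>W\<close> commute, this is a submodule over the commutative subring that \<open>W\<close> generates.

  Hilbert's basis theorem holds in the following form (\<open>hilbert_basis_step\<close>): if \<open>M\<close> is Noetherian
  for the operators \<open>W\<close> and \<open>y\<close> commutes with \<open>W\<close>, then \<open>M\<close> lies in a module that is Noetherian for
  \<open>W\<close> and \<open>y\<close> together. Starting from a finitely generated \<open>K\<close>-module and adding finitely many commuting
  operators, one sees that everything spanned by a finite set over \<open>K\<close> and these operators is
  Noetherian.

  This is applied to the Laurent polynomial ring and to the Hecke algebra \<open>H\<close>, with the
  coefficients of \<open>\<Prod>(Z - X\<^sub>j)\<close> and \<open>\<Prod>(Z - X\<^sub>j\<inverse>)\<close> as operators. Every \<open>X\<^sub>i\<close> and every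
  \<open>X\<^sub>i\<inverse>\<close> is a root of one of these monic polynomials, so powers beyond a fixed bound can be
  eliminated (\<open>noetherian_over_symmetric_functions\<close>) and a finite spanning set remains, provided that
  there was one over \<open>K\<close>, all \<open>X\<^sub>i\<close> and all \<open>X\<^sub>i\<inverse>\<close>. For Laurent polynomials \<open>{1}\<close> is such a set. For
  \<open>H\<close> the finitely many normal forms of words in the \<open>T\<^sub>i\<close> are one: the Bernstein relations
  push every \<open>T\<^sub>i\<close> to the right of every \<open>X\<^sub>j\<close>.

  Ideals of the ring \<open>Z\<close> of symmetric Laurent polynomials are submodules of the Laurent polynomial
  ring for these operators, because the coefficients are symmetric; so \<open>Z\<close> is Noetherian. In \<open>H\<close> the
  coefficients are central. An endomorphism of the sum of the \<open>x\<^sub>\<lambda> H\<close> is determined by its values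
  on the generators \<open>x\<^sub>\<lambda>\<close>, that is, by a finite matrix over \<open>H\<close>. This embeds the endomorphism ring in a
  finite power of \<open>H\<close> as a module over the central operators, and left ideals as well as right ideals
  are submodules for this action (\<open>End_noetherian\<close>).
\<close>

section \<open>Ascending chain conditions\<close>

definition satisfies_acc :: "'s set set \<Rightarrow> bool" where
  "satisfies_acc F \<longleftrightarrow>
    (\<forall>f::nat \<Rightarrow> 's set. (\<forall>k. f k \<in> F) \<and> mono f \<longrightarrow> (\<exists>p. \<forall>k\<ge>p. f k = f p))"

lemma satisfies_accD:
  assumes "satisfies_acc F" "\<And>k. f k \<in> F" "\<And>j k. j \<le> k \<Longrightarrow> f j \<subseteq> f k"
  shows "\<exists>p::nat. \<forall>k\<ge>p. f k = f p"
  using assms unfolding satisfies_acc_def mono_def by meson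

lemma satisfies_acc_subset:
  "satisfies_acc G \<Longrightarrow> F \<subseteq> G \<Longrightarrow> satisfies_acc F"
  unfolding satisfies_acc_def by (meson subsetD)

text \<open>
  The maps \<open>\<Psi> j\<close> separate comparable members of \<open>F\<close> only, as restriction to a submodule and passage to
  a quotient module jointly do. Along a chain this is enough: once all the finitely many image chains
  are constant, so is the chain itself.
\<close>

lemma satisfies_acc_jointly:
  fixes \<Psi> :: "'j \<Rightarrow> 's set \<Rightarrow> 't set"
  assumes "finite J" and acc: "\<And>j. j \<in> J \<Longrightarrow> satisfies_acc (G j)"
    and maps: "\<And>j N. j \<in> J \<Longrightarrow> N \<in> F \<Longrightarrow> \<Psi> j N \<in> G j"
    and mono: "\<And>j N N'. j \<in> J \<Longrightarrow> N \<in> F \<Longrightarrow> N' \<in> F \<Longrightarrow> N \<subseteq> N' \<Longrightarrow> \<Psi> j N \<subseteq> \<Psi> j N'"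
    and reflect: "\<And>N N'. N \<in> F \<Longrightarrow> N' \<in> F \<Longrightarrow> N \<subseteq> N' \<Longrightarrow>
      (\<And>j. j \<in> J \<Longrightarrow> \<Psi> j N = \<Psi> j N') \<Longrightarrow> N = N'"
  shows "satisfies_acc F"
  unfolding satisfies_acc_def
proof (intro allI impI, elim conjE)
  fix f :: "nat \<Rightarrow> 's set" assume f: "\<forall>k. f k \<in> F" and "mono f"
  have le: "f j \<subseteq> f k" if "j \<le> k" for j k using \<open>mono f\<close> that by (rule monoD)
  have "\<exists>p. \<forall>k\<ge>p. \<Psi> j (f k) = \<Psi> j (f p)" if j: "j \<in> J" for j
  proof -
    have "\<Psi> j (f k) \<in> G j" for k using maps j f by blast
    moreover have "\<Psi> j (f k) \<subseteq> \<Psi> j (f l)" if "k \<le> l" for k l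
      using mono[OF j _ _ le[OF that]] f by blast
    ultimately show ?thesis by (rule satisfies_accD[OF acc[OF j]])
  qed
  then obtain p where p: "\<And>j k. j \<in> J \<Longrightarrow> k \<ge> p j \<Longrightarrow> \<Psi> j (f k) = \<Psi> j (f (p j))"
    by metis
  define q where "q = (\<Sum>j\<in>J. p j)"
  have pq: "p j \<le> q" if "j \<in> J" for j
    unfolding q_def using that \<open>finite J\<close> by (intro member_le_sum) auto
  have "f k = f q" if "k \<ge> q" for k
  proof (rule reflect[symmetric])
    show "\<Psi> j (f q) = \<Psi> j (f k)" if "j \<in> J" for j
      using p[OF that, of q] p[OF that, of k] pq[OF that] \<open>k \<ge> q\<close> by simp
  qed (use f le[OF that] in simp_all)
  then show "\<exists>p. \<forall>k\<ge>p. f k = f p" by blast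
qed

text \<open>
  The combinatorial core of Hilbert's basis theorem, where \<open>L i N\<close> consists of the leading
  coefficients in degree \<open>i\<close>. The array \<open>L i (f k)\<close> increases in both indices, so its diagonal
  determines the entries for all large \<open>i\<close> and \<open>k\<close>.
\<close>

lemma satisfies_acc_graded:
  fixes L :: "nat \<Rightarrow> 's set \<Rightarrow> 't set"
  assumes acc: "satisfies_acc G"
    and maps: "\<And>i N. N \<in> F \<Longrightarrow> L i N \<in> G"
    and mono: "\<And>i N N'. N \<in> F \<Longrightarrow> N' \<in> F \<Longrightarrow> N \<subseteq> N' \<Longrightarrow> L i N \<subseteq> L i N'"
    and grow: "\<And>i N. N \<in> F \<Longrightarrow> L i N \<subseteq> L (Suc i) N"
    and reflect: "\<And>N N'. N \<in> F \<Longrightarrow> N' \<in> F \<Longrightarrow> N \<subseteq> N' \<Longrightarrow>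
      (\<And>i. L i N = L i N') \<Longrightarrow> N = N'"
  shows "satisfies_acc F"
  unfolding satisfies_acc_def
proof (intro allI impI, elim conjE)
  fix f :: "nat \<Rightarrow> 's set" assume f: "\<forall>k. f k \<in> F" and "mono f"
  have le: "f j \<subseteq> f k" if "j \<le> k" for j k using \<open>mono f\<close> that by (rule monoD)
  have both: "L i (f k) \<subseteq> L j (f l)" if "i \<le> j" "k \<le> l" for i j k l
  proof -
    have "L i (f k) \<subseteq> L j (f k)"
      by (rule lift_Suc_mono_le[of "\<lambda>i. L i (f k)", OF _ \<open>i \<le> j\<close>]) (use grow f in blast)
    also have "\<dots> \<subseteq> L j (f l)" using mono f le[OF \<open>k \<le> l\<close>] by blast
    finally show ?thesis .
  qed
  have "L k (f k) \<in> G" for k using maps f by blast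
  then have "\<exists>p. \<forall>k\<ge>p. L k (f k) = L p (f p)"
    using both by (rule satisfies_accD[OF acc])
  then obtain p where p: "\<And>k. k \<ge> p \<Longrightarrow> L k (f k) = L p (f p)" by blast
  \<comment> \<open>Past the stable diagonal entry every \<open>L i\<close> with \<open>i \<ge> p\<close> is constant; only finitely many
    indices are left, and \<open>satisfies_acc_jointly\<close> takes care of them.\<close>
  have tail: "L i (f k) = L p (f p)" if "i \<ge> p" "k \<ge> p" for i k
    using both[of p i p k] both[of i "max i k" k "max i k"] p[of "max i k"] that by auto
  have "satisfies_acc {f k |k. k \<ge> p}"
  proof (rule satisfies_acc_jointly[where J = "{..<p}" and G = "\<lambda>_. G" and \<Psi> = L])
    fix N N' assume N: "N \<in> {f k |k. k \<ge> p}" "N' \<in> {f k |k. k \<ge> p}" "N \<subseteq> N'"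
      and eq: "\<And>j. j \<in> {..<p} \<Longrightarrow> L j N = L j N'"
    have "L i N = L i N'" for i
      using eq[of i] N tail[of i] by (cases "i < p") auto
    moreover have "N \<in> F" "N' \<in> F" using N f by auto
    ultimately show "N = N'" using reflect \<open>N \<subseteq> N'\<close> by blast
  next
    show "L j N \<in> G" if "N \<in> {f k |k. k \<ge> p}" for j N using that maps f by blast
    show "L j N \<subseteq> L j N'" if "N \<in> {f k |k. k \<ge> p}" "N' \<in> {f k |k. k \<ge> p}" "N \<subseteq> N'" for j N N'
      using that mono f by blast
  qed (use acc in simp_all)
  then have "\<exists>q. \<forall>k\<ge>q. f (p + k) = f (p + q)"
    by (rule satisfies_accD) (auto simp: le)
  then obtain q where q: "\<And>k. k \<ge> q \<Longrightarrow> f (p + k) = f (p + q)" by blast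
  have "f k = f (p + q)" if "k \<ge> p + q" for k
    using q[of "k - p"] that by simp
  then show "\<exists>p. \<forall>k\<ge>p. f k = f p" by blast
qed

text \<open>
  Adjoining elements of \<open>I\<close> one at a time, each outside what its predecessors generate, would
  otherwise never stop. The predicate \<open>P\<close> stands for two-sided, left and right ideals below.
\<close>

lemma satisfies_acc_imp_finitely_generated:
  assumes acc: "satisfies_acc {I. P I}"
    and Inter: "\<And>C. C \<noteq> {} \<Longrightarrow> (\<And>I. I \<in> C \<Longrightarrow> P I) \<Longrightarrow> P (\<Inter>C)"
    and "P I"
  shows "\<exists>A\<subseteq>I. finite A \<and> I = \<Inter>{J. P J \<and> A \<subseteq> J}"
proof (rule ccontr)
  define h where "h A = \<Inter>{J. P J \<and> A \<subseteq> J}" for A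
  assume "\<not> ?thesis"
  then have "\<exists>x. x \<in> I - h A" if "A \<subseteq> I" "finite A" for A
    using that \<open>P I\<close> unfolding h_def by blast
  then obtain x where x: "\<And>A. A \<subseteq> I \<Longrightarrow> finite A \<Longrightarrow> x A \<in> I - h A" by metis
  define A where "A = rec_nat {} (\<lambda>_ A. insert (x A) A)"
  have A_Suc: "A (Suc k) = insert (x (A k)) (A k)" for k by (simp add: A_def)
  have A: "A k \<subseteq> I \<and> finite (A k)" for k
  proof (induction k)
    case 0 show ?case by (simp add: A_def)
  next
    case (Suc k) then show ?case using x[of "A k"] by (auto simp: A_Suc)
  qed
  have A_mono: "A j \<subseteq> A k" if "j \<le> k" for j k
    using that by (rule lift_Suc_mono_le[rotated]) (auto simp: A_Suc)
  have "\<exists>p. \<forall>k\<ge>p. h (A k) = h (A p)"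
  proof (rule satisfies_accD[OF acc])
    show "h (A k) \<in> {I. P I}" for k
      unfolding h_def using A[of k] \<open>P I\<close> by (blast intro: Inter)
    show "h (A j) \<subseteq> h (A k)" if "j \<le> k" for j k
      using A_mono[OF that] unfolding h_def by blast
  qed
  then obtain p where p: "\<And>k. k \<ge> p \<Longrightarrow> h (A k) = h (A p)" by blast
  have "x (A p) \<in> h (A (Suc p))" unfolding h_def A_Suc by blast
  then show False using p[of "Suc p"] x[of "A p"] A[of p] by auto
qed

section \<open>Modules as subgroups stable under operators\<close>

text \<open>
  A submodule of \<open>R\<close> over the subring generated by \<open>W\<close>. Listing only generators of the subring
  makes it possible to enlarge the ring of scalars by one element, without constructing that ring.
\<close>

definition stable_subgroup :: "('a, 'b) ring_scheme \<Rightarrow> 'a set \<Rightarrow> 'a set \<Rightarrow> bool" where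
  "stable_subgroup R W N \<longleftrightarrow> additive_subgroup N R \<and> (\<forall>w\<in>W. \<forall>a\<in>N. w \<otimes>\<^bsub>R\<^esub> a \<in> N)"

abbreviation submodules :: "('a, 'b) ring_scheme \<Rightarrow> 'a set \<Rightarrow> 'a set \<Rightarrow> 'a set set" where
  "submodules R W M \<equiv> {N. stable_subgroup R W N \<and> N \<subseteq> M}"

definition noetherian_submodule :: "('a, 'b) ring_scheme \<Rightarrow> 'a set \<Rightarrow> 'a set \<Rightarrow> bool" where
  "noetherian_submodule R W M \<longleftrightarrow>
    stable_subgroup R W M \<and> satisfies_acc (submodules R W M)"

definition submodule_hull :: "('a, 'b) ring_scheme \<Rightarrow> 'a set \<Rightarrow> 'a set \<Rightarrow> 'a set" where
  "submodule_hull R W B = \<Inter>{N. stable_subgroup R W N \<and> B \<subseteq> N}"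

text \<open>
  The set \<open>B\<close> generates the module \<open>R\<close>; the formulation by stable subgroups replaces linear
  combinations by closure properties.
\<close>

definition spans :: "('a, 'b) ring_scheme \<Rightarrow> 'a set \<Rightarrow> 'a set \<Rightarrow> bool" where
  "spans R W B \<longleftrightarrow> (\<forall>N. stable_subgroup R W N \<and> B \<subseteq> N \<longrightarrow> N = carrier R)"

lemma (in ring) additive_subgroupI':
  assumes "N \<subseteq> carrier R" "\<zero> \<in> N" "\<And>a b. a \<in> N \<Longrightarrow> b \<in> N \<Longrightarrow> a \<oplus> b \<in> N"
    "\<And>a. a \<in> N \<Longrightarrow> \<ominus> a \<in> N"
  shows "additive_subgroup N R"
  by (rule additive_subgroupI, rule add.subgroupI) (use assms in \<open>auto simp: a_inv_def\<close>)

lemma (in ring) additive_subgroupD: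
  assumes "additive_subgroup N R"
  shows "N \<subseteq> carrier R" "\<zero> \<in> N" "\<And>a b. a \<in> N \<Longrightarrow> b \<in> N \<Longrightarrow> a \<oplus> b \<in> N"
    "\<And>a. a \<in> N \<Longrightarrow> \<ominus> a \<in> N" "\<And>a b. a \<in> N \<Longrightarrow> b \<in> N \<Longrightarrow> a \<ominus> b \<in> N"
proof -
  interpret additive_subgroup N R by fact
  show "N \<subseteq> carrier R" "\<zero> \<in> N" by (auto simp: a_subset)
  show add: "\<And>a b. a \<in> N \<Longrightarrow> b \<in> N \<Longrightarrow> a \<oplus> b \<in> N" by simp
  show neg: "\<And>a. a \<in> N \<Longrightarrow> \<ominus> a \<in> N"
    by (rule a_inv_closed) (auto intro: is_abelian_group abelian_group_axioms)
  show "\<And>a b. a \<in> N \<Longrightarrow> b \<in> N \<Longrightarrow> a \<ominus> b \<in> N"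
    by (simp add: a_minus_def add neg)
qed

lemma (in ring) stableI:
  assumes "N \<subseteq> carrier R" "\<zero> \<in> N" "\<And>a b. a \<in> N \<Longrightarrow> b \<in> N \<Longrightarrow> a \<oplus> b \<in> N"
    "\<And>a. a \<in> N \<Longrightarrow> \<ominus> a \<in> N" "\<And>w a. w \<in> W \<Longrightarrow> a \<in> N \<Longrightarrow> w \<otimes> a \<in> N"
  shows "stable_subgroup R W N"
  unfolding stable_subgroup_def
  by (intro conjI ballI additive_subgroupI') (use assms in \<open>simp_all add: subset_iff\<close>)

lemma (in ring) stableD:
  assumes "stable_subgroup R W N"
  shows "N \<subseteq> carrier R" "\<zero> \<in> N" "\<And>a b. a \<in> N \<Longrightarrow> b \<in> N \<Longrightarrow> a \<oplus> b \<in> N"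
    "\<And>a. a \<in> N \<Longrightarrow> \<ominus> a \<in> N" "\<And>a b. a \<in> N \<Longrightarrow> b \<in> N \<Longrightarrow> a \<ominus> b \<in> N"
    "\<And>w a. w \<in> W \<Longrightarrow> a \<in> N \<Longrightarrow> w \<otimes> a \<in> N"
  using assms unfolding stable_subgroup_def
  by (simp_all add: additive_subgroupD)

lemma (in ring) stable_carrier: "W \<subseteq> carrier R \<Longrightarrow> stable_subgroup R W (carrier R)"
  by (rule stableI) auto

lemma stable_antimono: "stable_subgroup R W N \<Longrightarrow> V \<subseteq> W \<Longrightarrow> stable_subgroup R V N"
  unfolding stable_subgroup_def by blast

lemma (in ring) stable_Inter:
  assumes "C \<noteq> {}" "\<And>N. N \<in> C \<Longrightarrow> stable_subgroup R W N"
  shows "stable_subgroup R W (\<Inter>C)"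
proof (rule stableI)
  obtain N where "N \<in> C" using assms(1) by blast
  then show "\<Inter>C \<subseteq> carrier R" using stableD(1)[OF assms(2)] by blast
qed (auto intro: stableD(2-6)[OF assms(2)])

lemma (in ring) stable_submodule_hull:
  assumes "W \<subseteq> carrier R" "B \<subseteq> carrier R"
  shows "stable_subgroup R W (submodule_hull R W B)"
  unfolding submodule_hull_def using stable_carrier[OF assms(1)] assms(2) by (intro stable_Inter) auto

lemma subset_submodule_hull: "B \<subseteq> submodule_hull R W B"
  unfolding submodule_hull_def by blast

lemma submodule_hull_minimal: "stable_subgroup R W N \<Longrightarrow> B \<subseteq> N \<Longrightarrow> submodule_hull R W B \<subseteq> N"
  unfolding submodule_hull_def by blast

lemma (in ring) submodule_hull_mono:
  assumes "W \<subseteq> W'" "W' \<subseteq> carrier R" "B \<subseteq> B'" "B' \<subseteq> carrier R"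
  shows "submodule_hull R W B \<subseteq> submodule_hull R W' B'"
  using assms stable_submodule_hull[of W' B'] subset_submodule_hull[of B' R W']
  by (intro submodule_hull_minimal) (auto intro: stable_antimono)

definition additive_map :: "('a, 'c) ring_scheme \<Rightarrow> ('b, 'd) ring_scheme \<Rightarrow> ('a \<Rightarrow> 'b) \<Rightarrow> bool" where
  "additive_map E R \<pi> \<longleftrightarrow> \<pi> \<in> carrier E \<rightarrow> carrier R \<and>
    (\<forall>a\<in>carrier E. \<forall>b\<in>carrier E. \<pi> (a \<oplus>\<^bsub>E\<^esub> b) = \<pi> a \<oplus>\<^bsub>R\<^esub> \<pi> b)"

lemma additive_mapD:
  assumes "additive_map E R \<pi>" "ring E" "ring R"
  shows "a \<in> carrier E \<Longrightarrow> \<pi> a \<in> carrier R"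
    "a \<in> carrier E \<Longrightarrow> b \<in> carrier E \<Longrightarrow> \<pi> (a \<oplus>\<^bsub>E\<^esub> b) = \<pi> a \<oplus>\<^bsub>R\<^esub> \<pi> b"
    "\<pi> \<zero>\<^bsub>E\<^esub> = \<zero>\<^bsub>R\<^esub>"
    "a \<in> carrier E \<Longrightarrow> \<pi> (\<ominus>\<^bsub>E\<^esub> a) = \<ominus>\<^bsub>R\<^esub> \<pi> a"
    "a \<in> carrier E \<Longrightarrow> b \<in> carrier E \<Longrightarrow> \<pi> (a \<ominus>\<^bsub>E\<^esub> b) = \<pi> a \<ominus>\<^bsub>R\<^esub> \<pi> b"
proof -
  interpret E: ring E by fact
  interpret R: ring R by fact
  show c: "a \<in> carrier E \<Longrightarrow> \<pi> a \<in> carrier R" for a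
    using assms(1) unfolding additive_map_def by blast
  show add: "a \<in> carrier E \<Longrightarrow> b \<in> carrier E \<Longrightarrow> \<pi> (a \<oplus>\<^bsub>E\<^esub> b) = \<pi> a \<oplus>\<^bsub>R\<^esub> \<pi> b" for a b
    using assms(1) unfolding additive_map_def by blast
  show zero: "\<pi> \<zero>\<^bsub>E\<^esub> = \<zero>\<^bsub>R\<^esub>"
    using add[of "\<zero>\<^bsub>E\<^esub>" "\<zero>\<^bsub>E\<^esub>"] c[of "\<zero>\<^bsub>E\<^esub>"] by (simp add: R.add.r_cancel_one')
  show neg: "a \<in> carrier E \<Longrightarrow> \<pi> (\<ominus>\<^bsub>E\<^esub> a) = \<ominus>\<^bsub>R\<^esub> \<pi> a" for a
    using add[of "\<ominus>\<^bsub>E\<^esub> a" a] c zero by (intro R.minus_equality[symmetric]) (simp_all add: E.l_neg)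
  show "a \<in> carrier E \<Longrightarrow> b \<in> carrier E \<Longrightarrow> \<pi> (a \<ominus>\<^bsub>E\<^esub> b) = \<pi> a \<ominus>\<^bsub>R\<^esub> \<pi> b"
    by (simp add: a_minus_def add neg)
qed

lemma stable_image:
  assumes "additive_map E R \<pi>" "ring E" "ring R" and N: "stable_subgroup E V N"
    and linear: "\<And>w a. w \<in> W \<Longrightarrow> a \<in> N \<Longrightarrow> \<exists>v\<in>V. \<pi> (v \<otimes>\<^bsub>E\<^esub> a) = w \<otimes>\<^bsub>R\<^esub> \<pi> a"
  shows "stable_subgroup R W (\<pi> ` N)"
proof (rule ring.stableI[OF \<open>ring R\<close>])
  note D = ring.stableD[OF \<open>ring E\<close> N] and A = additive_mapD[OF assms(1-3)]
  show "\<pi> ` N \<subseteq> carrier R" using D(1) A(1) by blast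
  show "\<zero>\<^bsub>R\<^esub> \<in> \<pi> ` N" using D(2) by (rule image_eqI[where f = \<pi>, OF A(3)[symmetric]])
  show "x \<oplus>\<^bsub>R\<^esub> y \<in> \<pi> ` N" if xy: "x \<in> \<pi> ` N" "y \<in> \<pi> ` N" for x y
  proof -
    obtain a b where ab: "a \<in> N" "b \<in> N" "x = \<pi> a" "y = \<pi> b" using xy by blast
    then have "x \<oplus>\<^bsub>R\<^esub> y = \<pi> (a \<oplus>\<^bsub>E\<^esub> b)" using A(2)[of a b] D(1) by (simp add: subset_iff)
    then show ?thesis using D(3)[OF ab(1,2)] by (rule image_eqI)
  qed
  show "\<ominus>\<^bsub>R\<^esub> x \<in> \<pi> ` N" if x: "x \<in> \<pi> ` N" for x
  proof -
    obtain a where a: "a \<in> N" "x = \<pi> a" using x by blast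
    then have "\<ominus>\<^bsub>R\<^esub> x = \<pi> (\<ominus>\<^bsub>E\<^esub> a)" using A(4)[of a] D(1) by (simp add: subset_iff)
    then show ?thesis using D(4)[OF a(1)] by (rule image_eqI)
  qed
  show "w \<otimes>\<^bsub>R\<^esub> x \<in> \<pi> ` N" if w: "w \<in> W" and x: "x \<in> \<pi> ` N" for w x
  proof -
    obtain a where a: "a \<in> N" "x = \<pi> a" using x by blast
    obtain v where v: "v \<in> V" "\<pi> (v \<otimes>\<^bsub>E\<^esub> a) = w \<otimes>\<^bsub>R\<^esub> \<pi> a" using linear[OF w a(1)] by blast
    then have "w \<otimes>\<^bsub>R\<^esub> x = \<pi> (v \<otimes>\<^bsub>E\<^esub> a)" using a by simp
    then show ?thesis using D(6)[OF v(1) a(1)] by (rule image_eqI)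
  qed
qed

lemma stable_preimage:
  assumes "additive_map E R \<pi>" "ring E" "ring R" and N: "stable_subgroup R W N"
    and V: "V \<subseteq> carrier E"
    and linear: "\<And>v a. v \<in> V \<Longrightarrow> a \<in> carrier E \<Longrightarrow> \<exists>w\<in>W. \<pi> (v \<otimes>\<^bsub>E\<^esub> a) = w \<otimes>\<^bsub>R\<^esub> \<pi> a"
  shows "stable_subgroup E V {a \<in> carrier E. \<pi> a \<in> N}"
proof -
  interpret E: ring E by fact
  note D = ring.stableD[OF \<open>ring R\<close> N] and A = additive_mapD[OF assms(1-3)]
  show ?thesis
  proof (rule E.stableI)
    fix v a assume v: "v \<in> V" and a: "a \<in> {a \<in> carrier E. \<pi> a \<in> N}"
    then obtain w where w: "w \<in> W" "\<pi> (v \<otimes>\<^bsub>E\<^esub> a) = w \<otimes>\<^bsub>R\<^esub> \<pi> a" using linear by blast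
    have "\<pi> a \<in> N" using a by blast
    then have "\<pi> (v \<otimes>\<^bsub>E\<^esub> a) \<in> N" using D(6)[OF w(1)] w(2) by simp
    moreover have "v \<in> carrier E" using v V by blast
    ultimately show "v \<otimes>\<^bsub>E\<^esub> a \<in> {a \<in> carrier E. \<pi> a \<in> N}" using a by simp
  qed (use A D in auto)
qed

lemma (in ring) additive_map_left_mult: "t \<in> carrier R \<Longrightarrow> additive_map R R (\<lambda>a. t \<otimes> a)"
  by (auto simp: additive_map_def r_distr)

lemma (in ring) stable_left_preimage:
  assumes "stable_subgroup R W N" "W \<subseteq> carrier R" "t \<in> carrier R" "\<And>w. w \<in> W \<Longrightarrow> t \<otimes> w = w \<otimes> t"
  shows "stable_subgroup R W {a \<in> carrier R. t \<otimes> a \<in> N}"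
proof (rule stable_preimage[OF additive_map_left_mult ring_axioms ring_axioms assms(1,2)])
  show "\<exists>w'\<in>W. t \<otimes> (w \<otimes> a) = w' \<otimes> (t \<otimes> a)" if "w \<in> W" "a \<in> carrier R" for w a
    using that assms by (intro bexI[of _ w]) (simp_all add: m_assoc[symmetric] subset_iff)
qed (rule assms(3))

text \<open>
  Left multiplication by \<open>t\<close> is a module homomorphism if \<open>t\<close> commutes with the operators, so its effect
  on generators suffices.
\<close>

lemma (in ring) left_mult_submodule_hull:
  assumes "W \<subseteq> carrier R" "B' \<subseteq> carrier R" "B \<subseteq> carrier R" "t \<in> carrier R"
    and "\<And>w. w \<in> W \<Longrightarrow> t \<otimes> w = w \<otimes> t"
    and "\<And>b. b \<in> B \<Longrightarrow> t \<otimes> b \<in> submodule_hull R W B'" and "a \<in> submodule_hull R W B"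
  shows "t \<otimes> a \<in> submodule_hull R W B'"
proof -
  have "stable_subgroup R W {a \<in> carrier R. t \<otimes> a \<in> submodule_hull R W B'}"
    using assms by (intro stable_left_preimage stable_submodule_hull)
  then have "submodule_hull R W B \<subseteq> {a \<in> carrier R. t \<otimes> a \<in> submodule_hull R W B'}"
    by (rule submodule_hull_minimal) (use assms(3,6) in auto)
  then show ?thesis using assms(7) by blast
qed

section \<open>Hilbert's basis theorem for modules\<close>

lemma (in ring) noetherian_submodule_zero:
  assumes "W \<subseteq> carrier R"
  shows "noetherian_submodule R W {\<zero>}"
proof -
  have "submodules R W {\<zero>} \<subseteq> {{\<zero>}}" by (auto dest: stableD)
  moreover have "satisfies_acc {{\<zero>}}" unfolding satisfies_acc_def by auto
  moreover have "stable_subgroup R W {\<zero>}" using assms by (intro stableI) auto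
  ultimately show ?thesis
    unfolding noetherian_submodule_def by (blast intro: satisfies_acc_subset)
qed

lemma (in ring) set_addI:
  "x \<in> M \<Longrightarrow> y \<in> M' \<Longrightarrow> a = x \<oplus> y \<Longrightarrow> a \<in> M <+>\<^bsub>R\<^esub> M'"
  unfolding set_add_def' by blast

lemma (in ring) stable_set_add:
  assumes M: "stable_subgroup R W M" and M': "stable_subgroup R W M'" and W: "W \<subseteq> carrier R"
  shows "stable_subgroup R W (M <+>\<^bsub>R\<^esub> M')"
proof (rule stableI)
  note D = stableD[OF M] and D' = stableD[OF M']
  have sub: "M \<subseteq> carrier R" "M' \<subseteq> carrier R" by (rule D D')+
  show "M <+>\<^bsub>R\<^esub> M' \<subseteq> carrier R" using sub by (auto simp: set_add_def')
  show "\<zero> \<in> M <+>\<^bsub>R\<^esub> M'" by (rule set_addI[OF D(2) D'(2)]) simp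
  show "a \<oplus> b \<in> M <+>\<^bsub>R\<^esub> M'" if ab: "a \<in> M <+>\<^bsub>R\<^esub> M'" "b \<in> M <+>\<^bsub>R\<^esub> M'" for a b
  proof -
    obtain x y x' y' where eq: "a = x \<oplus> y" "b = x' \<oplus> y'"
      and m: "x \<in> M" "y \<in> M'" "x' \<in> M" "y' \<in> M'"
      using ab by (auto simp: set_add_def')
    have "a \<oplus> b = (x \<oplus> x') \<oplus> (y \<oplus> y')"
      using m sub by (simp add: eq a_ac subset_iff)
    then show ?thesis by (rule set_addI[OF D(3)[OF m(1,3)] D'(3)[OF m(2,4)]])
  qed
  show "\<ominus> a \<in> M <+>\<^bsub>R\<^esub> M'" if a: "a \<in> M <+>\<^bsub>R\<^esub> M'" for a
  proof -
    obtain x y where eq: "a = x \<oplus> y" and m: "x \<in> M" "y \<in> M'"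
      using a by (auto simp: set_add_def')
    have "\<ominus> a = \<ominus> x \<oplus> \<ominus> y" using m sub by (auto simp: eq minus_add subset_iff)
    then show ?thesis by (rule set_addI[OF D(4)[OF m(1)] D'(4)[OF m(2)]])
  qed
  show "w \<otimes> a \<in> M <+>\<^bsub>R\<^esub> M'" if a: "w \<in> W" "a \<in> M <+>\<^bsub>R\<^esub> M'" for w a
  proof -
    obtain x y where eq: "a = x \<oplus> y" and m: "x \<in> M" "y \<in> M'"
      using a by (auto simp: set_add_def')
    have "w \<otimes> a = w \<otimes> x \<oplus> w \<otimes> y" using m sub W a by (auto simp: eq r_distr subset_iff)
    then show ?thesis by (rule set_addI[OF D(6)[OF a(1) m(1)] D'(6)[OF a(1) m(2)]])
  qed
qed

lemma (in ring) stable_Int: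
  "stable_subgroup R W M \<Longrightarrow> stable_subgroup R W N \<Longrightarrow> stable_subgroup R W (M \<inter> N)"
  using stable_Inter[of "{M, N}" W] by (metis (full_types) Inf_insert Inf_empty inf_top_right insertE insert_not_empty empty_iff)

text \<open>
  If \<open>N \<subseteq> N'\<close> agree inside \<open>D\<close>, an element of \<open>N'\<close> lies in \<open>N\<close> as soon as its class modulo \<open>D\<close> is the
  class of an element of \<open>N\<close>: subtract that element. Extensions of modules and the
  induction on the degree in Hilbert's theorem both rest on this step.
\<close>

lemma (in ring) mem_submodule_if_same_residues:
  assumes D: "stable_subgroup R W D" and N: "stable_subgroup R W N" and N': "stable_subgroup R W N'"
    and "N \<subseteq> N'" "N' \<inter> D \<subseteq> N" and d: "d \<in> D" "x \<in> D <+>\<^bsub>R\<^esub> N" "d \<oplus> x \<in> N'"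
  shows "d \<oplus> x \<in> N"
proof -
  obtain d' n where x: "x = d' \<oplus> n" "d' \<in> D" "n \<in> N" using d(2) by (auto simp: set_add_def')
  have c: "d \<in> carrier R" "d' \<in> carrier R" "n \<in> carrier R"
    using d(1) x(2,3) stableD(1)[OF D] stableD(1)[OF N] by auto
  have "d \<oplus> d' = (d \<oplus> x) \<ominus> n"
    using c by (simp add: x(1) a_minus_def a_assoc r_neg)
  then have "d \<oplus> d' \<in> N' \<inter> D"
    using stableD(5)[OF N' d(3), of n] stableD(3)[OF D d(1) x(2)] x(3) \<open>N \<subseteq> N'\<close> by auto
  then have "(d \<oplus> d') \<oplus> n \<in> N" using assms(5) stableD(3)[OF N] x(3) by blast
  then show ?thesis using c by (simp add: x(1) a_assoc)
qed

lemma (in ring) mem_residues: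
  assumes "stable_subgroup R W D" "stable_subgroup R W N" "d \<in> D" "x \<in> carrier R" "d \<oplus> x \<in> N"
  shows "x \<in> D <+>\<^bsub>R\<^esub> N"
proof (rule set_addI)
  show "\<ominus> d \<in> D" "d \<oplus> x \<in> N" using stableD(4)[OF assms(1)] assms by auto
  show "x = \<ominus> d \<oplus> (d \<oplus> x)"
    using assms stableD(1)[OF assms(1)] by (auto simp: r_neg1)
qed

text \<open>
  The two invariants of \<open>N\<close> are its intersection with \<open>M\<close> and its image modulo \<open>M\<close>, the latter
  represented inside \<open>M'\<close> by \<open>M' \<inter> (M + N)\<close>.
\<close>

lemma (in ring) noetherian_submodule_set_add:
  assumes M: "noetherian_submodule R W M" and M': "noetherian_submodule R W M'"
    and W: "W \<subseteq> carrier R"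
  shows "noetherian_submodule R W (M <+>\<^bsub>R\<^esub> M')"
proof -
  have st: "stable_subgroup R W M" "stable_subgroup R W M'"
    and acc: "satisfies_acc (submodules R W M)"
      "satisfies_acc (submodules R W M')"
    using M M' unfolding noetherian_submodule_def by auto
  let ?F = "{N. stable_subgroup R W N \<and> N \<subseteq> M <+>\<^bsub>R\<^esub> M'}"
  define \<Psi> where "\<Psi> b N = (if b then N \<inter> M else M' \<inter> (M <+>\<^bsub>R\<^esub> N))" for b N
  have "satisfies_acc ?F"
  proof (rule satisfies_acc_jointly
      [where J = UNIV and \<Psi> = \<Psi> and
        G = "\<lambda>b. {N. stable_subgroup R W N \<and> N \<subseteq> (if b then M else M')}"])
    show "satisfies_acc {N. stable_subgroup R W N \<and> N \<subseteq> (if b then M else M')}" for b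
      using acc by (cases b) auto
    show "\<Psi> b N \<subseteq> \<Psi> b N'" if "N \<subseteq> N'" for b N N'
      using that unfolding \<Psi>_def set_add_def' by auto
    show "\<Psi> b N \<in> {N. stable_subgroup R W N \<and> N \<subseteq> (if b then M else M')}" if "N \<in> ?F" for b N
      using that st W by (auto simp: \<Psi>_def intro!: stable_Int stable_set_add)
    show "N = N'" if N: "N \<in> ?F" "N' \<in> ?F" "N \<subseteq> N'"
        and eq: "\<And>b. b \<in> UNIV \<Longrightarrow> \<Psi> b N = \<Psi> b N'" for N N'
    proof
      have stN: "stable_subgroup R W N" "stable_subgroup R W N'" using N by simp_all
      show "N' \<subseteq> N"
      proof
        fix n assume n: "n \<in> N'"
        then obtain a b where ab: "n = a \<oplus> b" "a \<in> M" "b \<in> M'"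
          using N by (auto simp: set_add_def')
        then have "b \<in> \<Psi> False N'"
          using n mem_residues[OF st(1) stN(2), of a b] stableD(1)[OF st(2)] by (auto simp: \<Psi>_def)
        then have "b \<in> \<Psi> False N" using eq by simp
        then have "b \<in> M <+>\<^bsub>R\<^esub> N" by (simp add: \<Psi>_def)
        moreover have "N' \<inter> M \<subseteq> N" using eq[of True] by (auto simp: \<Psi>_def)
        ultimately show "n \<in> N"
          using mem_submodule_if_same_residues[OF st(1) stN N(3), of a b] ab n by simp
      qed
    qed (use N in auto)
  qed auto
  then show ?thesis
    unfolding noetherian_submodule_def using stable_set_add st W by blast
qed

lemma (in noetherian_ring) satisfies_acc_ideals: "satisfies_acc {I. ideal I R}"
  unfolding satisfies_acc_def
proof (intro allI impI, elim conjE)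
  fix f :: "nat \<Rightarrow> 'a set" assume f: "\<forall>k. f k \<in> {I. ideal I R}" and "mono f"
  have "f j \<subseteq> f k \<or> f k \<subseteq> f j" for j k
    using monoD[OF \<open>mono f\<close>] by (metis nle_le)
  then have "subset.chain {I. ideal I R} (range f)"
    using f unfolding subset_chain_def by blast
  then have "\<Union>(range f) \<in> range f" by (intro ideal_chain_is_trivial) auto
  then obtain p where p: "\<Union>(range f) = f p" by auto
  have "f k = f p" if "k \<ge> p" for k
    using p monoD[OF \<open>mono f\<close> that] by auto
  then show "\<exists>p. \<forall>k\<ge>p. f k = f p" by blast
qed

text \<open>
  A cyclic module is a quotient of \<open>K\<close>: its submodules correspond to ideals by
  \<open>N \<mapsto> {k. k b \<in> N}\<close>.
\<close>

lemma (in ring) noetherian_submodule_cyclic: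
  assumes "noetherian_ring K" "cring K" and h: "h \<in> ring_hom K R" and b: "b \<in> carrier R"
  shows "noetherian_submodule R (h ` carrier K) ((\<lambda>k. h k \<otimes> b) ` carrier K)"
proof -
  interpret K: noetherian_ring K by fact
  interpret K: cring K by fact
  interpret h: ring_hom_ring K R h
    by (rule ring_hom_ringI2) (auto intro: K.ring_axioms ring_axioms h)
  let ?W = "h ` carrier K" and ?M = "(\<lambda>k. h k \<otimes> b) ` carrier K"
  have add: "additive_map K R (\<lambda>k. h k \<otimes> b)"
    using b by (auto simp: additive_map_def l_distr)
  have st: "stable_subgroup R ?W ?M"
    by (rule stable_image[OF add K.ring_axioms ring_axioms K.stable_carrier[OF subset_refl]])
      (use b in \<open>auto simp: m_assoc\<close>)
  have "satisfies_acc {N. stable_subgroup R ?W N \<and> N \<subseteq> ?M}"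
  proof (rule satisfies_acc_jointly[where J = "{()}" and G = "\<lambda>_. {I. ideal I K}" and
        \<Psi> = "\<lambda>_ N. {k \<in> carrier K. h k \<otimes> b \<in> N}"])
    show "satisfies_acc {I. ideal I K}" by (rule K.satisfies_acc_ideals)
    fix N assume "N \<in> {N. stable_subgroup R ?W N \<and> N \<subseteq> ?M}"
    then have N: "stable_subgroup R ?W N" by simp
    let ?I = "{k \<in> carrier K. h k \<otimes> b \<in> N}"
    have I: "stable_subgroup K (carrier K) ?I"
      by (rule stable_preimage[OF add K.ring_axioms ring_axioms N]) (use b in \<open>auto simp: m_assoc\<close>)
    have mult: "l \<otimes>\<^bsub>K\<^esub> k \<in> ?I" if "k \<in> ?I" "l \<in> carrier K" for k l
      using that by (intro K.stableD(6)[OF I])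
    moreover have "k \<otimes>\<^bsub>K\<^esub> l \<in> ?I" if "k \<in> ?I" "l \<in> carrier K" for k l
      using mult[OF that] K.m_comm[of k l] that by simp
    moreover have "additive_subgroup ?I K" using I by (simp add: stable_subgroup_def)
    ultimately have "ideal ?I K"
      by (intro idealI K.ring_axioms additive_subgroup.a_subgroup)
    then show "?I \<in> {I. ideal I K}" by simp
  next
    fix N N' assume N: "N \<in> {N. stable_subgroup R ?W N \<and> N \<subseteq> ?M}"
        "N' \<in> {N. stable_subgroup R ?W N \<and> N \<subseteq> ?M}" "N \<subseteq> N'"
      and eq: "\<And>j. j \<in> {()} \<Longrightarrow> {k \<in> carrier K. h k \<otimes> b \<in> N} = {k \<in> carrier K. h k \<otimes> b \<in> N'}"
    then show "N = N'" using eq[of "()"] by auto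
  qed auto
  with st show ?thesis unfolding noetherian_submodule_def by blast
qed

text \<open>
  The module \<open>M'\<close> is the image of \<open>M[y]\<close>, that is, the sum of the \<open>y\<^sup>i M\<close>. Its elements need not have
  unique coefficients, so degree and leading coefficient are replaced by the filtration \<open>D i\<close> of
  elements of degree less than \<open>i\<close> and by congruence modulo \<open>D i\<close>.
\<close>

lemma (in ring) hilbert_basis_step:
  assumes M: "noetherian_submodule R W M" and W: "W \<subseteq> carrier R" and y: "y \<in> carrier R"
    and comm: "\<And>w. w \<in> W \<Longrightarrow> y \<otimes> w = w \<otimes> y"
  shows "\<exists>M'. M \<subseteq> M' \<and> noetherian_submodule R (insert y W) M'"
proof -
  have stM: "stable_subgroup R W M" and acc: "satisfies_acc (submodules R W M)"
    using M unfolding noetherian_submodule_def by auto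
  have subM: "M \<subseteq> carrier R" by (rule stableD[OF stM])
  have comm_pow: "y [^] i \<otimes> w = w \<otimes> y [^] i" if "w \<in> W" for w and i :: nat
    using that W y by (intro group_commutes_pow comm) auto
  have y_pow: "y \<otimes> (y [^] i \<otimes> a) = y [^] Suc i \<otimes> a" if "a \<in> carrier R" for a and i :: nat
    using that y by (metis m_assoc nat_pow_Suc2 nat_pow_closed)
  have st_pow: "stable_subgroup R W ((\<lambda>m. y [^] i \<otimes> m) ` M)" for i :: nat
  proof (rule stable_image[OF additive_map_left_mult ring_axioms ring_axioms stM])
    show "\<exists>v\<in>W. y [^] i \<otimes> (v \<otimes> m) = w \<otimes> (y [^] i \<otimes> m)" if "w \<in> W" "m \<in> M" for w m
      using that subM y W
      by (intro bexI[of _ w]) (simp_all add: m_assoc[symmetric] comm_pow subset_iff)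
  qed (use y in simp)
  define D where "D = rec_nat {\<zero>} (\<lambda>i D. D <+>\<^bsub>R\<^esub> (\<lambda>m. y [^] i \<otimes> m) ` M)"
  have D_0: "D 0 = {\<zero>}" and D_Suc: "D (Suc i) = D i <+>\<^bsub>R\<^esub> (\<lambda>m. y [^] i \<otimes> m) ` M" for i
    by (simp_all add: D_def)
  have stD: "stable_subgroup R W (D i)" for i
  proof (induction i)
    case 0 show ?case unfolding D_0 using W by (intro stableI) auto
  next
    case (Suc i) show ?case unfolding D_Suc by (intro stable_set_add Suc st_pow W)
  qed
  have subD: "D i \<subseteq> carrier R" for i by (rule stableD[OF stD])
  have D_step: "D i \<subseteq> D (Suc i)" for i
  proof
    fix d assume "d \<in> D i"
    then have "d = d \<oplus> \<zero>" using subD[of i] by (simp add: subset_iff)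
    moreover note \<open>d \<in> D i\<close>
    moreover have "\<zero> \<in> (\<lambda>m. y [^] i \<otimes> m) ` M" by (rule stableD[OF st_pow])
    ultimately show "d \<in> D (Suc i)" unfolding D_Suc by (intro set_addI)
  qed
  have D_mono: "D i \<subseteq> D j" if "i \<le> j" for i j
    using that by (rule lift_Suc_mono_le[of D, rotated]) (rule D_step)
  have D_y: "y \<otimes> d \<in> D (Suc i)" if "d \<in> D i" for i d
    using that
  proof (induction i arbitrary: d)
    case 0
    have "\<zero> \<in> D (Suc 0)" by (rule stableD[OF stD])
    then show ?case using 0 y by (simp add: D_0)
  next
    case (Suc i)
    then obtain e m where d: "d = e \<oplus> y [^] i \<otimes> m" "e \<in> D i" "m \<in> M"
      by (auto simp: D_Suc set_add_def')
    show ?case unfolding D_Suc[of "Suc i"]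
    proof (rule set_addI)
      show "y \<otimes> e \<in> D (Suc i)" by (rule Suc.IH[OF d(2)])
      show "y [^] Suc i \<otimes> m \<in> (\<lambda>m. y [^] Suc i \<otimes> m) ` M" using d by blast
      have "e \<in> carrier R" "m \<in> carrier R" using d subD subM by auto
      then show "y \<otimes> d = y \<otimes> e \<oplus> y [^] Suc i \<otimes> m"
        unfolding d(1) using y by (simp add: r_distr y_pow del: nat_pow_Suc)
    qed
  qed
  define M' where "M' = (\<Union>i. D i)"
  have "M \<subseteq> M'"
  proof
    fix m assume "m \<in> M"
    then have "m = \<zero> \<oplus> m" "m = y [^] (0::nat) \<otimes> m" using subM by auto
    with \<open>m \<in> M\<close> have "m \<in> D (Suc 0)" unfolding D_Suc D_0
      by (intro set_addI[of \<zero> _ m] image_eqI[of m _ m]) auto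
    then show "m \<in> M'" unfolding M'_def by blast
  qed
  have stM': "stable_subgroup R (insert y W) M'"
  proof (rule stableI)
    show "M' \<subseteq> carrier R" using subD by (auto simp: M'_def)
    show "\<zero> \<in> M'" using D_0 by (auto simp: M'_def)
    show "a \<oplus> b \<in> M'" if ab: "a \<in> M'" "b \<in> M'" for a b
    proof -
      obtain i j where "a \<in> D i" "b \<in> D j" using ab by (auto simp: M'_def)
      then have "a \<in> D (max i j)" "b \<in> D (max i j)" using D_mono by (meson max.cobounded1 max.cobounded2 subsetD)+
      then show ?thesis unfolding M'_def using stableD(3)[OF stD] by blast
    qed
    show "\<ominus> a \<in> M'" if "a \<in> M'" for a
      using that stableD(4)[OF stD] unfolding M'_def by blast
    show "w \<otimes> a \<in> M'" if "w \<in> insert y W" "a \<in> M'" for w a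
      using that stableD(6)[OF stD] D_y unfolding M'_def by blast
  qed
  let ?F = "{N. stable_subgroup R (insert y W) N \<and> N \<subseteq> M'}"
  \<comment> \<open>The elements of \<open>M\<close> that occur as leading coefficients, in degree \<open>i\<close>, of elements of \<open>N\<close>.\<close>
  define L where "L i N = {a \<in> M. y [^] i \<otimes> a \<in> D i <+>\<^bsub>R\<^esub> N}" for i :: nat and N
  have stN: "stable_subgroup R W N" if "N \<in> ?F" for N
    using that by (auto intro: stable_antimono)
  have "satisfies_acc ?F"
  proof (rule satisfies_acc_graded[OF acc, where L = L])
    fix i N assume N: "N \<in> ?F"
    have "L i N = M \<inter> {a \<in> carrier R. y [^] i \<otimes> a \<in> D i <+>\<^bsub>R\<^esub> N}"
      using subM by (auto simp: L_def)
    then show "L i N \<in> submodules R W M"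
      using stM stD stN[OF N] W y comm_pow
      by (auto intro!: stable_Int stable_left_preimage stable_set_add)
    show "L i N \<subseteq> L (Suc i) N"
    proof
      fix a assume "a \<in> L i N"
      then obtain d n where a: "a \<in> M" "y [^] i \<otimes> a = d \<oplus> n" "d \<in> D i" "n \<in> N"
        by (auto simp: L_def set_add_def')
      have "y \<otimes> n \<in> N" using N a(4) stableD(6) by blast
      moreover have "y [^] Suc i \<otimes> a = y \<otimes> d \<oplus> y \<otimes> n"
      proof -
        have c: "a \<in> carrier R" "d \<in> carrier R" "n \<in> carrier R"
          using a subM subD stableD(1)[OF stN[OF N]] by auto
        have "y [^] Suc i \<otimes> a = y \<otimes> (y [^] i \<otimes> a)"
          using c by (simp add: y_pow)
        then show ?thesis using c y a(2) by (simp add: r_distr)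
      qed
      ultimately show "a \<in> L (Suc i) N"
        using a(1) D_y[OF a(3)] by (auto simp: L_def intro: set_addI)
    qed
  next
    show "L i N \<subseteq> L i N'" if "N \<subseteq> N'" for i N N'
      using that unfolding L_def set_add_def' by auto
  next
    fix N N' assume N: "N \<in> ?F" "N' \<in> ?F" "N \<subseteq> N'" and eq: "\<And>i. L i N = L i N'"
    have "N' \<inter> D i \<subseteq> N" for i
    proof (induction i)
      case 0 show ?case using stableD(2)[OF stN[OF N(1)]] by (auto simp: D_0)
    next
      case (Suc i)
      show ?case
      proof
        fix n assume n: "n \<in> N' \<inter> D (Suc i)"
        then obtain d m where dm: "n = d \<oplus> y [^] i \<otimes> m" "d \<in> D i" "m \<in> M"
          by (auto simp: D_Suc set_add_def')
        have "m \<in> L i N'"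
          using n dm mem_residues[OF stD stN[OF N(2)], of d i "y [^] i \<otimes> m"] y subM
          by (auto simp: L_def)
        then have "m \<in> L i N" by (simp add: eq)
        then have "y [^] i \<otimes> m \<in> D i <+>\<^bsub>R\<^esub> N" by (simp add: L_def)
        then show "n \<in> N"
          using mem_submodule_if_same_residues[OF stD stN[OF N(1)] stN[OF N(2)] N(3) Suc dm(2)] n
          unfolding dm(1) by blast
      qed
    qed
    moreover have "N' \<subseteq> (\<Union>i. D i)" using N by (simp add: M'_def)
    ultimately show "N = N'" using \<open>N \<subseteq> N'\<close> by blast
  qed
  then have "noetherian_submodule R (insert y W) M'"
    unfolding noetherian_submodule_def using stM' by blast
  with \<open>M \<subseteq> M'\<close> show ?thesis by blast
qed

lemma (in ring) finsum_mem_additive_subgroup: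
  assumes "additive_subgroup N R" "\<And>i. i \<in> A \<Longrightarrow> f i \<in> N"
  shows "(\<Oplus>i\<in>A. f i) \<in> N"
  using assms(2)
proof (induction A rule: infinite_finite_induct)
  case (insert x A)
  then have "f \<in> A \<rightarrow> carrier R" "f x \<in> carrier R"
    using additive_subgroupD(1)[OF assms(1)] by auto
  then show ?case using insert additive_subgroupD(3)[OF assms(1)] by simp
qed (use additive_subgroupD(2)[OF assms(1)] in \<open>auto simp: finsum_infinite\<close>)

lemma (in ring) noetherian_submodule_add_operators:
  assumes "finite Y" and M: "noetherian_submodule R W M" and W: "W \<subseteq> carrier R"
    and Y: "Y \<subseteq> carrier R"
    and comm: "\<And>y w. y \<in> Y \<Longrightarrow> w \<in> W \<union> Y \<Longrightarrow> y \<otimes> w = w \<otimes> y"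
  shows "\<exists>M'. M \<subseteq> M' \<and> noetherian_submodule R (W \<union> Y) M'"
  using \<open>finite Y\<close> Y comm
proof (induction Y rule: finite_induct)
  case empty show ?case using M by auto
next
  case (insert y Y)
  have "\<exists>M'. M \<subseteq> M' \<and> noetherian_submodule R (W \<union> Y) M'"
    using insert.prems by (intro insert.IH) auto
  then obtain M1 where M1: "M \<subseteq> M1" "noetherian_submodule R (W \<union> Y) M1" by blast
  have "\<exists>M2. M1 \<subseteq> M2 \<and> noetherian_submodule R (insert y (W \<union> Y)) M2"
    using insert.prems W by (intro hilbert_basis_step M1) auto
  then show ?case using M1(1) by auto
qed

lemma (in ring) noetherian_submodule_finite_subset:
  assumes K: "noetherian_ring K" "cring K" "h \<in> ring_hom K R" and "finite B" "B \<subseteq> carrier R"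
  shows "\<exists>M. B \<subseteq> M \<and> noetherian_submodule R (h ` carrier K) M"
  using assms(4,5)
proof (induction B rule: finite_induct)
  case empty
  show ?case using noetherian_submodule_zero[of "h ` carrier K"] ring_hom_closed[OF K(3)] by blast
next
  case (insert b B)
  interpret K: cring K by fact
  interpret h: ring_hom_ring K R h
    by (rule ring_hom_ringI2) (auto intro: K.ring_axioms ring_axioms K(3))
  let ?W = "h ` carrier K" and ?C = "(\<lambda>k. h k \<otimes> b) ` carrier K"
  from insert obtain M where M: "B \<subseteq> M" "noetherian_submodule R ?W M" by auto
  have C: "noetherian_submodule R ?W ?C"
    using K insert.prems by (intro noetherian_submodule_cyclic) auto
  have st: "stable_subgroup R ?W M" "stable_subgroup R ?W ?C"
    using M C by (auto simp: noetherian_submodule_def)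
  have "x \<in> ?C <+>\<^bsub>R\<^esub> M" if "x \<in> insert b B" for x
  proof (cases "x = b")
    case True
    have "b \<in> ?C" using insert.prems by (intro image_eqI[of _ _ "\<one>\<^bsub>K\<^esub>"]) auto
    then show ?thesis using stableD(2)[OF st(1)] True insert.prems by (intro set_addI[of b _ \<zero>]) auto
  next
    case False
    then show ?thesis using stableD(2)[OF st(2)] that M insert.prems by (intro set_addI[of \<zero> _ x]) auto
  qed
  moreover have "noetherian_submodule R ?W (?C <+>\<^bsub>R\<^esub> M)"
    by (intro noetherian_submodule_set_add C M) auto
  ultimately show ?case by blast
qed

lemma (in ring) noetherian_submodule_carrier:
  assumes K: "noetherian_ring K" "cring K" "h \<in> ring_hom K R"
    and B: "finite B" "B \<subseteq> carrier R" and Y: "finite Y" "Y \<subseteq> carrier R"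
    and comm: "\<And>y w. y \<in> Y \<Longrightarrow> w \<in> h ` carrier K \<union> Y \<Longrightarrow> y \<otimes> w = w \<otimes> y"
    and "spans R (h ` carrier K \<union> Y) B"
  shows "noetherian_submodule R (h ` carrier K \<union> Y) (carrier R)"
proof -
  obtain M where M: "B \<subseteq> M" "noetherian_submodule R (h ` carrier K) M"
    using noetherian_submodule_finite_subset[OF K B] by blast
  then obtain M' where M': "M \<subseteq> M'" "noetherian_submodule R (h ` carrier K \<union> Y) M'"
    using noetherian_submodule_add_operators[OF Y(1) M(2) _ Y(2) comm] ring_hom_closed[OF K(3)] by blast
  then have "M' = carrier R"
    using \<open>spans R _ B\<close> M(1) unfolding spans_def noetherian_submodule_def by blast
  with M' show ?thesis by simp
qed

section \<open>Elementary symmetric functions of commuting elements\<close>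

definition centralizer :: "('a, 'b) ring_scheme \<Rightarrow> 'a \<Rightarrow> 'a set" where
  "centralizer R z = {a \<in> carrier R. a \<otimes>\<^bsub>R\<^esub> z = z \<otimes>\<^bsub>R\<^esub> a}"

lemma (in ring) subring_centralizer:
  assumes z: "z \<in> carrier R"
  shows "subring (centralizer R z) R"
proof (rule subringI)
  fix a b assume ab: "a \<in> centralizer R z" "b \<in> centralizer R z"
  then have "a \<otimes> b \<otimes> z = z \<otimes> (a \<otimes> b)"
    using z unfolding centralizer_def by simp (metis m_assoc)
  then show "a \<otimes> b \<in> centralizer R z" "a \<oplus> b \<in> centralizer R z"
    using ab z by (auto simp: centralizer_def l_distr r_distr)
qed (use z in \<open>auto simp: centralizer_def l_minus r_minus\<close>)

text \<open>
  The coefficient of \<open>Z\<^sup>k\<close> in \<open>\<Prod>(Z - x)\<close>, where \<open>x\<close> runs through the list: up to sign an elementary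
  symmetric function. A list fixes the order of the factors, so the definition makes sense in a
  noncommutative ring.
\<close>

primrec vieta :: "('a, 'b) ring_scheme \<Rightarrow> 'a list \<Rightarrow> nat \<Rightarrow> 'a" where
  "vieta R [] k = (if k = 0 then \<one>\<^bsub>R\<^esub> else \<zero>\<^bsub>R\<^esub>)"
| "vieta R (x # xs) k =
    (case k of 0 \<Rightarrow> \<zero>\<^bsub>R\<^esub> | Suc l \<Rightarrow> vieta R xs l) \<oplus>\<^bsub>R\<^esub> (\<ominus>\<^bsub>R\<^esub> x) \<otimes>\<^bsub>R\<^esub> vieta R xs k"

lemma (in ring) vieta_mem_subring:
  assumes "subring A R" "set xs \<subseteq> A"
  shows "vieta R xs k \<in> A"
  using assms(2) by (induction xs arbitrary: k) (auto split: nat.split intro!: subringE[OF assms(1)])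

lemma (in ring) vieta_closed [simp, intro]:
  "set xs \<subseteq> carrier R \<Longrightarrow> vieta R xs k \<in> carrier R"
  by (rule vieta_mem_subring[OF carrier_is_subring])

lemma (in ring) vieta_eq_zero:
  "set xs \<subseteq> carrier R \<Longrightarrow> k > length xs \<Longrightarrow> vieta R xs k = \<zero>"
  by (induction xs arbitrary: k) (auto split: nat.split)

lemma (in ring) vieta_monic:
  "set xs \<subseteq> carrier R \<Longrightarrow> vieta R xs (length xs) = \<one>"
  by (induction xs) (auto simp: vieta_eq_zero)

text \<open>
  With \<open>P\<close> the value at \<open>z\<close> of the polynomial of \<open>xs\<close>, the recursion gives the value
  \<open>P z - x P\<close> for \<open>x # xs\<close>. For \<open>x = z\<close> this vanishes because \<open>P\<close> commutes with \<open>z\<close>.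
\<close>

lemma (in ring) vieta_root:
  assumes "set xs \<subseteq> centralizer R z" "z \<in> set xs"
  shows "(\<Oplus>k\<in>{..length xs}. vieta R xs k \<otimes> z [^] k) = \<zero>"
  using assms
proof (induction xs)
  case (Cons x xs)
  have c: "x \<in> carrier R" "set xs \<subseteq> carrier R" "z \<in> carrier R"
    using Cons.prems by (auto simp: centralizer_def)
  define P where "P = (\<Oplus>k\<in>{..length xs}. vieta R xs k \<otimes> z [^] k)"
  have P: "P \<in> carrier R" unfolding P_def using c by auto
  let ?A = "\<lambda>k. (case k of 0 \<Rightarrow> \<zero> | Suc l \<Rightarrow> vieta R xs l) \<otimes> z [^] k"
  let ?B = "\<lambda>k. \<ominus> x \<otimes> (vieta R xs k \<otimes> z [^] k)"
  have "(\<Oplus>k\<in>{..length (x # xs)}. vieta R (x # xs) k \<otimes> z [^] k) = (\<Oplus>k\<in>{..Suc (length xs)}. ?A k \<oplus> ?B k)"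
    using c by (intro finsum_cong) (auto simp: l_distr m_assoc split: nat.split)
  also have "\<dots> = (\<Oplus>k\<in>{..Suc (length xs)}. ?A k) \<oplus> (\<Oplus>k\<in>{..Suc (length xs)}. ?B k)"
    using c by (intro finsum_addf) (auto split: nat.split)
  also have "(\<Oplus>k\<in>{..Suc (length xs)}. ?A k) = (\<Oplus>k\<in>{..length xs}. vieta R xs k \<otimes> z [^] k \<otimes> z)"
    using c by (subst finsum_Suc2) (auto simp: m_assoc split: nat.split)
  also have "\<dots> = P \<otimes> z"
    unfolding P_def using c by (subst finsum_ldistr) auto
  also have "(\<Oplus>k\<in>{..Suc (length xs)}. ?B k) = \<ominus> x \<otimes> (\<Oplus>k\<in>{..Suc (length xs)}. vieta R xs k \<otimes> z [^] k)"
    using c by (subst finsum_rdistr) auto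
  also have "(\<Oplus>k\<in>{..Suc (length xs)}. vieta R xs k \<otimes> z [^] k) = P"
    unfolding P_def using c by (subst finsum_Suc) (auto simp: vieta_eq_zero)
  finally have eq: "(\<Oplus>k\<in>{..length (x # xs)}. vieta R (x # xs) k \<otimes> z [^] k) = P \<otimes> z \<oplus> \<ominus> x \<otimes> P" .
  show ?case
  proof (cases "z \<in> set xs")
    case True
    then have "P = \<zero>" using Cons unfolding P_def by auto
    then show ?thesis unfolding eq using c by simp
  next
    case False
    then have "x = z" using Cons.prems by simp
    have sub: "subring (centralizer R z) R" by (rule subring_centralizer[OF c(3)])
    have zz: "z [^] k \<in> centralizer R z" for k :: nat
    proof (induction k)
      case 0 show ?case using subringE(3)[OF sub] by simp
    next
      case (Suc k)
      moreover have "z \<in> centralizer R z" using c(3) by (simp add: centralizer_def)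
      ultimately show ?case using subringE(6)[OF sub] by simp
    qed
    have "P \<in> centralizer R z"
      unfolding P_def
    proof (rule finsum_mem_additive_subgroup)
      show "additive_subgroup (centralizer R z) R"
        using subringE[OF sub] by (intro additive_subgroupI') auto
      show "vieta R xs k \<otimes> z [^] k \<in> centralizer R z" for k
        using Cons.prems by (intro subringE(6)[OF sub] vieta_mem_subring[OF sub] zz) auto
    qed
    then have "P \<otimes> z = z \<otimes> P" by (simp add: centralizer_def)
    then have "P \<otimes> z \<oplus> \<ominus> x \<otimes> P = \<zero>" using c P by (simp add: \<open>x = z\<close> l_minus r_neg)
    then show ?thesis by (simp only: eq)
  qed
qed simp

section \<open>Elimination of integral operators\<close>

definition integral_over :: "('a, 'b) ring_scheme \<Rightarrow> 'a set \<Rightarrow> 'a \<Rightarrow> bool" where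
  "integral_over R W z \<longleftrightarrow> (\<exists>(n::nat) c. (\<forall>k<n. c k \<in> W) \<and>
    z [^]\<^bsub>R\<^esub> n \<oplus>\<^bsub>R\<^esub> (\<Oplus>\<^bsub>R\<^esub>k\<in>{..<n}. c k \<otimes>\<^bsub>R\<^esub> z [^]\<^bsub>R\<^esub> k) = \<zero>\<^bsub>R\<^esub>)"

lemma (in ring) vieta_integral:
  assumes "set xs \<subseteq> centralizer R z" "z \<in> set xs" "\<And>k. k < length xs \<Longrightarrow> vieta R xs k \<in> W"
  shows "integral_over R W z"
proof -
  have c: "set xs \<subseteq> carrier R" "z \<in> carrier R" using assms by (auto simp: centralizer_def)
  have "{..length xs} = insert (length xs) {..<length xs}" by auto
  then have "z [^] length xs \<oplus> (\<Oplus>k\<in>{..<length xs}. vieta R xs k \<otimes> z [^] k) = \<zero>"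
    using vieta_root[OF assms(1,2)] c by (simp add: vieta_monic Pi_def)
  then show ?thesis unfolding integral_over_def using assms(3) by blast
qed

text \<open>
  If \<open>z\<close> is a root of a monic polynomial of degree \<open>n\<close> over \<open>W\<close>, the elements \<open>z\<^sup>i b\<close> with \<open>i < n\<close> generate
  over \<open>W\<close> what the elements \<open>b\<close> generate over \<open>W\<close> and \<open>z\<close>.
\<close>

lemma (in ring) spans_remove_integral:
  assumes sp: "spans R (insert z W) B" and W: "W \<subseteq> carrier R" and z: "z \<in> carrier R"
    and B: "B \<subseteq> carrier R" "finite B"
    and comm: "\<And>w. w \<in> W \<Longrightarrow> z \<otimes> w = w \<otimes> z"
    and int: "integral_over R W z"
  shows "\<exists>B'. finite B' \<and> B' \<subseteq> carrier R \<and> spans R W B'"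
proof -
  obtain n :: nat and c where c': "\<forall>k<n. c k \<in> W"
    and rel: "z [^] n \<oplus> (\<Oplus>k\<in>{..<n}. c k \<otimes> z [^] k) = \<zero>"
    using int unfolding integral_over_def by blast
  from c' have c: "c k \<in> W" if "k < n" for k using that by blast
  have cW: "c k \<in> carrier R" if "k < n" for k using c[OF that] W by auto
  let ?B = "(\<lambda>(i, b). z [^] i \<otimes> b) ` ({..<n} \<times> B)"
  have "N = carrier R" if N: "stable_subgroup R W N" "?B \<subseteq> N" for N
  proof -
    note D = stableD[OF N(1)]
    \<comment> \<open>The largest \<open>z\<close>-stable subset of \<open>N\<close>.\<close>
    let ?N' = "{a \<in> carrier R. \<forall>i::nat. z [^] i \<otimes> a \<in> N}"
    have "z [^] i \<otimes> b \<in> N" if b: "b \<in> B" for b and i :: nat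
    proof (induction i rule: less_induct)
      case (less i)
      show ?case
      proof (cases "i < n")
        case True then show ?thesis using N(2) b by blast
      next
        case False
        define x where "x = z [^] (i - n) \<otimes> b"
        have x: "x \<in> carrier R" using z b B by (auto simp: x_def)
        have shift: "z [^] k \<otimes> x = z [^] (i - n + k) \<otimes> b" for k
          using z b B by (auto simp: x_def m_assoc[symmetric] nat_pow_mult add.commute)
        have "\<zero> = (z [^] n \<oplus> (\<Oplus>k\<in>{..<n}. c k \<otimes> z [^] k)) \<otimes> x" using x by (simp add: rel)
        also have "\<dots> = z [^] n \<otimes> x \<oplus> (\<Oplus>k\<in>{..<n}. c k \<otimes> z [^] k \<otimes> x)"
          using x z cW by (simp add: l_distr finsum_ldistr Pi_def)
        finally have "z [^] n \<otimes> x = \<ominus> (\<Oplus>k\<in>{..<n}. c k \<otimes> z [^] k \<otimes> x)"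
          using x z cW by (intro minus_equality[symmetric]) (auto simp: Pi_def)
        moreover have "(\<Oplus>k\<in>{..<n}. c k \<otimes> z [^] k \<otimes> x) \<in> N"
        proof (rule finsum_mem_additive_subgroup)
          show "additive_subgroup N R" using N(1) by (simp add: stable_subgroup_def)
          fix k assume k: "k \<in> {..<n}"
          then have "z [^] (i - n + k) \<otimes> b \<in> N" using False by (intro less) auto
          then have "c k \<otimes> (z [^] k \<otimes> x) \<in> N" using D(6) c k by (simp add: shift)
          then show "c k \<otimes> z [^] k \<otimes> x \<in> N" using z x cW k by (simp add: m_assoc)
        qed
        ultimately show ?thesis using D(4) shift[of n] False by simp
      qed
    qed
    then have "B \<subseteq> ?N'" using B by auto
    moreover have "stable_subgroup R (insert z W) ?N'"
    proof (rule stableI)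
      fix w a assume w: "w \<in> insert z W" and a: "a \<in> ?N'"
      have "z [^] i \<otimes> (w \<otimes> a) \<in> N" for i :: nat
      proof (cases "w = z")
        case True
        then have "z [^] i \<otimes> (w \<otimes> a) = z [^] Suc i \<otimes> a" using z a by (simp add: m_assoc)
        moreover have "z [^] Suc i \<otimes> a \<in> N" using a by blast
        ultimately show ?thesis by simp
      next
        case False
        then have "w \<in> W" using w by simp
        moreover have "z [^] i \<otimes> w = w \<otimes> z [^] i"
          using \<open>w \<in> W\<close> W z by (intro group_commutes_pow comm) auto
        then have "z [^] i \<otimes> (w \<otimes> a) = w \<otimes> (z [^] i \<otimes> a)"
          using \<open>w \<in> W\<close> W z a by (auto simp: m_assoc[symmetric])
        ultimately show ?thesis using a D(6) by auto
      qed
      then show "w \<otimes> a \<in> ?N'" using w a W z by auto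
    qed (use D z in \<open>auto simp: r_distr r_minus\<close>)
    ultimately have "?N' = carrier R" using sp unfolding spans_def by blast
    have "a \<in> N" if "a \<in> carrier R" for a
    proof -
      have "a \<in> ?N'" using that \<open>?N' = carrier R\<close> by blast
      then have "z [^] (0::nat) \<otimes> a \<in> N" by blast
      then show ?thesis using that by simp
    qed
    then show ?thesis using D(1) by blast
  qed
  then have "spans R W ?B" unfolding spans_def by blast
  moreover have "finite ?B" "?B \<subseteq> carrier R" using B z by auto
  ultimately show ?thesis by blast
qed

lemma (in ring) spans_remove_integrals:
  assumes "finite Z" and "spans R (W \<union> Z) B" and W: "W \<subseteq> carrier R" and Z: "Z \<subseteq> carrier R"
    and "B \<subseteq> carrier R" "finite B"
    and "\<And>z w. z \<in> Z \<Longrightarrow> w \<in> W \<union> Z \<Longrightarrow> z \<otimes> w = w \<otimes> z"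
    and "\<And>z. z \<in> Z \<Longrightarrow> integral_over R W z"
  shows "\<exists>B'. finite B' \<and> B' \<subseteq> carrier R \<and> spans R W B'"
  using assms(1,2,4-)
proof (induction Z arbitrary: B rule: finite_induct)
  case empty then show ?case by auto
next
  case (insert z Z)
  have "integral_over R (W \<union> Z) z"
    using insert.prems(6)[of z] unfolding integral_over_def by blast
  then obtain B' where "finite B'" "B' \<subseteq> carrier R" "spans R (W \<union> Z) B'"
    using spans_remove_integral[of z "W \<union> Z" B] insert.prems W by auto
  then show ?case using insert.IH[of B'] insert.prems by auto
qed

text \<open>
  The members of the lists in \<open>L\<close> are integral over the coefficients \<open>V\<close> of their polynomials and can
  be eliminated; the finitely many coefficients are then added to \<open>K\<close> by Hilbert's basis theorem.
\<close>

theorem (in ring) noetherian_over_symmetric_functions: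
  assumes K: "noetherian_ring K" "cring K" "h \<in> ring_hom K R"
    and central: "\<And>k a. k \<in> carrier K \<Longrightarrow> a \<in> carrier R \<Longrightarrow> h k \<otimes> a = a \<otimes> h k"
    and "finite L" and X: "\<And>xs. xs \<in> L \<Longrightarrow> set xs \<subseteq> carrier R"
    and comm: "\<And>xs ys x y. xs \<in> L \<Longrightarrow> ys \<in> L \<Longrightarrow> x \<in> set xs \<Longrightarrow> y \<in> set ys \<Longrightarrow> x \<otimes> y = y \<otimes> x"
    and V: "V = (\<Union>xs\<in>L. vieta R xs ` {..length xs})"
    and B: "finite B" "B \<subseteq> carrier R"
    and sp: "spans R (h ` carrier K \<union> V \<union> (\<Union>xs\<in>L. set xs)) B"
  shows "noetherian_submodule R (h ` carrier K \<union> V) (carrier R)"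
proof -
  let ?Z = "\<Union>xs\<in>L. set xs"
  have hK: "h ` carrier K \<subseteq> carrier R" using ring_hom_closed[OF K(3)] by blast
  have Vc: "V \<subseteq> carrier R" using X unfolding V by auto
  have Zc: "?Z \<subseteq> carrier R" using X by auto
  have ZZ: "set xs \<subseteq> centralizer R z" if "xs \<in> L" "z \<in> ?Z" for xs z
    using that comm X[OF that(1)] by (auto simp: centralizer_def)
  have ZV: "z \<otimes> v = v \<otimes> z" if "z \<in> ?Z" "v \<in> V" for z v
  proof -
    have "v \<in> centralizer R z"
      using that ZZ Zc unfolding V by (auto intro!: vieta_mem_subring subring_centralizer)
    then show ?thesis by (simp add: centralizer_def)
  qed
  have VV: "v \<otimes> v' = v' \<otimes> v" if "v \<in> V" "v' \<in> V" for v v'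
  proof -
    have "set xs \<subseteq> centralizer R v" if "xs \<in> L" for xs
      using ZV[OF _ \<open>v \<in> V\<close>] X[OF that] that by (auto simp: centralizer_def)
    moreover have "subring (centralizer R v) R" using that Vc by (intro subring_centralizer) auto
    ultimately have "v' \<in> centralizer R v"
      using that vieta_mem_subring unfolding V by blast
    then show ?thesis by (simp add: centralizer_def)
  qed
  have "\<exists>B'. finite B' \<and> B' \<subseteq> carrier R \<and> spans R (h ` carrier K \<union> V) B'"
  proof (rule spans_remove_integrals[OF _ sp])
    show "finite ?Z" using \<open>finite L\<close> by auto
    show "integral_over R (h ` carrier K \<union> V) z" if z: "z \<in> ?Z" for z
    proof -
      obtain xs where xs: "xs \<in> L" "z \<in> set xs" using z by auto
      show ?thesis
      proof (rule vieta_integral[OF ZZ[OF xs(1) z] xs(2)])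
        fix k assume "k < length xs"
        then have "vieta R xs k \<in> vieta R xs ` {..length xs}" by simp
        then show "vieta R xs k \<in> h ` carrier K \<union> V" using xs(1) V by blast
      qed
    qed
    show "z \<otimes> w = w \<otimes> z" if "z \<in> ?Z" "w \<in> h ` carrier K \<union> V \<union> ?Z" for z w
    proof -
      have "z \<in> carrier R" using that Zc by blast
      from that(2) consider "w \<in> V" | "w \<in> ?Z" | "w \<in> h ` carrier K" by (elim UnE)
      then show ?thesis
      proof cases
        case 1 with that(1) show ?thesis by (rule ZV)
      next
        case 2 with that(1) show ?thesis using comm by blast
      next
        case 3
        then obtain k where "k \<in> carrier K" "w = h k" by (rule imageE)
        then show ?thesis using central[OF _ \<open>z \<in> carrier R\<close>] by simp
      qed
    qed
  qed (use hK Vc Zc B in auto)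
  then obtain B' where B': "finite B'" "B' \<subseteq> carrier R" "spans R (h ` carrier K \<union> V) B'" by blast
  show ?thesis
  proof (rule noetherian_submodule_carrier[OF K B'(1,2) _ Vc _ B'(3)])
    show "finite V" using \<open>finite L\<close> by (auto simp: V)
    show "y \<otimes> w = w \<otimes> y" if "y \<in> V" "w \<in> h ` carrier K \<union> V" for y w
      using that VV[of y w] central[of _ y] Vc by auto
  qed
qed

section \<open>Rings with the Bernstein relations\<close>

text \<open>
  Two adjacent entries \<open>a\<close>, \<open>b\<close> enter the coefficients only through \<open>(Z - a)(Z - b)\<close>, that is,
  through \<open>a + b\<close> and \<open>a b\<close>. Each \<open>T\<^sub>i\<close> commutes with these two for the pair \<open>X\<^sub>i\<close>, \<open>X\<^sub>i\<^sub>+\<^sub>1\<close>,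
  although in general not with the entries.
\<close>

lemma (in ring) vieta_centralized_adjacent:
  assumes t: "t \<in> carrier R" and ab: "a \<in> carrier R" "b \<in> carrier R" "a \<otimes> b = b \<otimes> a"
    and sum: "a \<oplus> b \<in> centralizer R t" and prod: "a \<otimes> b \<in> centralizer R t"
    and us: "set us \<subseteq> centralizer R t" and vs: "set vs \<subseteq> centralizer R t"
  shows "vieta R (us @ a # b # vs) k \<in> centralizer R t"
proof -
  note S = subring_centralizer[OF t]
  show ?thesis
    using us
  proof (induction us arbitrary: k)
    case Nil
    define f where "f = vieta R vs"
    have f: "f k \<in> centralizer R t" for k unfolding f_def by (rule vieta_mem_subring[OF S vs])
    have fc: "f k \<in> carrier R" for k using f by (simp add: centralizer_def)
    have comm: "\<ominus> a \<otimes> (\<ominus> b \<otimes> f k) = (a \<otimes> b) \<otimes> f k" for k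
      using ab(1,2) fc by (simp add: l_minus r_minus m_assoc)
    consider "k = 0" | "k = 1" | l where "k = Suc (Suc l)" by (metis One_nat_def old.nat.exhaust)
    then show ?case
    proof cases
      case 1
      then have "vieta R ([] @ a # b # vs) k = (a \<otimes> b) \<otimes> f 0"
        using ab fc by (simp add: comm f_def[symmetric])
      then show ?thesis using prod f subringE(6)[OF S] by simp
    next
      case 2
      then have "vieta R ([] @ a # b # vs) k = (\<ominus> b \<otimes> f 0) \<oplus> (\<ominus> a \<otimes> (f 0 \<oplus> \<ominus> b \<otimes> f 1))"
        using ab fc by (simp add: f_def[symmetric])
      also have "\<dots> = \<ominus> (a \<oplus> b) \<otimes> f 0 \<oplus> (a \<otimes> b) \<otimes> f 1"
        using ab(1,2) fc by (simp add: r_distr comm minus_add l_distr a_ac)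
      finally show ?thesis using sum prod f subringE(5-7)[OF S] by simp
    next
      case (3 l)
      then have "vieta R ([] @ a # b # vs) k =
          (f l \<oplus> \<ominus> b \<otimes> f (Suc l)) \<oplus> (\<ominus> a \<otimes> (f (Suc l) \<oplus> \<ominus> b \<otimes> f (Suc (Suc l))))"
        using ab fc by (simp add: f_def[symmetric])
      also have "\<dots> = f l \<oplus> \<ominus> (a \<oplus> b) \<otimes> f (Suc l) \<oplus> (a \<otimes> b) \<otimes> f (Suc (Suc l))"
        using ab(1,2) fc by (simp add: r_distr comm minus_add l_distr a_ac)
      finally show ?thesis using sum prod f subringE(5-7)[OF S] by simp
    qed
  next
    case (Cons u us)
    then have "u \<in> centralizer R t" "vieta R (us @ a # b # vs) k \<in> centralizer R t" for k by auto
    then show ?case using subringE(2,5-7)[OF S] by (auto split: nat.split)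
  qed
qed

text \<open>
  The last assumption says that \<open>R\<close> is generated by the image of \<open>K\<close> and the elements \<open>t i\<close>,
  \<open>x i\<close>, \<open>y i\<close>: a subgroup containing \<open>1\<close> and closed under left multiplication by generators contains
  all words in them.
\<close>

locale bernstein_algebra = ring R for R :: "('a, 'b) ring_scheme" (structure) +
  fixes K :: "('k, 'c) ring_scheme" and h :: "'k \<Rightarrow> 'a" and r :: nat and q :: 'k
    and t x y :: "nat \<Rightarrow> 'a"
  assumes K_noetherian: "noetherian_ring K" and K_cring: "cring K"
    and h_hom: "h \<in> ring_hom K R"
    and h_central: "\<And>k a. k \<in> carrier K \<Longrightarrow> a \<in> carrier R \<Longrightarrow> h k \<otimes> a = a \<otimes> h k"
    and q: "q \<in> Units K"
    and t_closed: "\<And>i. i \<in> {1..<r} \<Longrightarrow> t i \<in> carrier R"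
    and x_closed: "\<And>i. i \<in> {1..r} \<Longrightarrow> x i \<in> carrier R"
    and y_closed: "\<And>i. i \<in> {1..r} \<Longrightarrow> y i \<in> carrier R"
    and t_quadratic: "\<And>i. i \<in> {1..<r} \<Longrightarrow> (t i \<oplus> \<one>) \<otimes> (t i \<ominus> h q) = \<zero>"
    and t_far: "\<And>i j. i \<in> {1..<r} \<Longrightarrow> j \<in> {1..<r} \<Longrightarrow> i + 1 < j \<or> j + 1 < i \<Longrightarrow> t i \<otimes> t j = t j \<otimes> t i"
    and t_braid: "\<And>i. i \<in> {1..<r} \<Longrightarrow> i + 1 \<in> {1..<r} \<Longrightarrow>
      t i \<otimes> t (i + 1) \<otimes> t i = t (i + 1) \<otimes> t i \<otimes> t (i + 1)"
    and xy: "\<And>i. i \<in> {1..r} \<Longrightarrow> x i \<otimes> y i = \<one>"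
    and yx: "\<And>i. i \<in> {1..r} \<Longrightarrow> y i \<otimes> x i = \<one>"
    and xx: "\<And>i j. i \<in> {1..r} \<Longrightarrow> j \<in> {1..r} \<Longrightarrow> x i \<otimes> x j = x j \<otimes> x i"
    and t_x_t: "\<And>i. i \<in> {1..<r} \<Longrightarrow> t i \<otimes> x i \<otimes> t i = h q \<otimes> x (i + 1)"
    and xt: "\<And>i j. i \<in> {1..<r} \<Longrightarrow> j \<in> {1..r} \<Longrightarrow> j \<noteq> i \<Longrightarrow> j \<noteq> i + 1 \<Longrightarrow> x j \<otimes> t i = t i \<otimes> x j"
    and generated: "\<And>N. stable_subgroup R (h ` carrier K \<union> t ` {1..<r} \<union> x ` {1..r} \<union> y ` {1..r}) N \<Longrightarrow>
      \<one> \<in> N \<Longrightarrow> N = carrier R"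
begin

lemma K_ring_hom: "ring_hom_ring K R h"
  using K_cring h_hom by (intro ring_hom_ringI2) (auto intro: ring_axioms cring.axioms)

lemma h_closed: "k \<in> carrier K \<Longrightarrow> h k \<in> carrier R"
  using ring_hom_closed[OF h_hom] .

definition \<beta> :: 'a where "\<beta> = h q \<ominus> \<one>"

text \<open>By \<open>t_times_s\<close> below, this is \<open>q\<close> times the inverse of \<open>t i\<close>.\<close>

definition s :: "nat \<Rightarrow> 'a" where "s i = t i \<ominus> \<beta>"

lemma q_closed: "q \<in> carrier K"
  using q unfolding Units_def by blast

lemma \<beta>_in_image: "\<beta> \<in> h ` carrier K"
proof -
  interpret h: ring_hom_ring K R h by (rule K_ring_hom)
  have "h (q \<ominus>\<^bsub>K\<^esub> \<one>\<^bsub>K\<^esub>) = \<beta>" using q_closed by (simp add: \<beta>_def a_minus_def)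
  then show ?thesis using q_closed by (metis h.R.minus_closed h.R.one_closed imageI)
qed

lemma \<beta>_closed: "\<beta> \<in> carrier R"
  using \<beta>_in_image by (auto simp: h_closed)

lemma \<beta>_central: "a \<in> carrier R \<Longrightarrow> \<beta> \<otimes> a = a \<otimes> \<beta>"
  using \<beta>_in_image by (auto simp: h_central)

lemma s_closed: "i \<in> {1..<r} \<Longrightarrow> s i \<in> carrier R"
  by (simp add: s_def t_closed \<beta>_closed)

lemma t_times_s: assumes i: "i \<in> {1..<r}" shows "t i \<otimes> s i = h q" and "s i \<otimes> t i = h q"
proof -
  note c = t_closed[OF i] h_closed[OF q_closed] \<beta>_closed
  have "\<zero> = (t i \<oplus> \<one>) \<otimes> (t i \<ominus> h q)" by (rule t_quadratic[OF i, symmetric])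
  also have "\<dots> = t i \<otimes> s i \<ominus> h q"
    using c unfolding s_def \<beta>_def
    by (simp add: a_minus_def l_distr r_distr minus_add r_minus a_ac)
  finally have "t i \<otimes> s i \<ominus> h q = \<zero>" by simp
  then show eq: "t i \<otimes> s i = h q"
    using c s_closed[OF i] by (metis m_closed r_right_minus_eq)
  have "s i \<otimes> t i = t i \<otimes> t i \<ominus> \<beta> \<otimes> t i" using c unfolding s_def by algebra
  also have "\<dots> = t i \<otimes> s i" using c \<beta>_central[of "t i"] unfolding s_def by algebra
  finally show "s i \<otimes> t i = h q" using eq by simp
qed

lemma h_q_cancel:
  assumes "a \<in> carrier R" "b \<in> carrier R" "h q \<otimes> a = h q \<otimes> b" shows "a = b"
proof -
  interpret h: ring_hom_ring K R h by (rule K_ring_hom)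
  have "h (inv\<^bsub>K\<^esub> q) \<otimes> h q = \<one>" "h (inv\<^bsub>K\<^esub> q) \<in> carrier R"
    using q by (metis h.R.Units_inv_closed h.R.Units_l_inv h.hom_mult h.hom_one q_closed, simp add: h_closed q)
  then have "a = h (inv\<^bsub>K\<^esub> q) \<otimes> (h q \<otimes> a)" "b = h (inv\<^bsub>K\<^esub> q) \<otimes> (h q \<otimes> b)"
    using assms(1,2) h_closed[OF q_closed] by (simp_all add: m_assoc[symmetric])
  then show ?thesis using assms(3) by simp
qed

text \<open>
  Multiplying \<open>t x t = q x'\<close> by \<open>s\<close> on either side and cancelling the unit \<open>q\<close> gives the two rules
  \<open>t x = x' s\<close> and \<open>s x' = x t\<close> for moving \<open>t\<close> past the \<open>x\<close>'s.
\<close>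

lemma t_x: assumes i: "i \<in> {1..<r}" shows "t i \<otimes> x i = x (i + 1) \<otimes> s i"
proof (rule h_q_cancel)
  have c: "t i \<in> carrier R" "x i \<in> carrier R" "x (i + 1) \<in> carrier R" "s i \<in> carrier R" "h q \<in> carrier R"
    using i by (auto simp: t_closed x_closed s_closed h_closed q_closed)
  then show "t i \<otimes> x i \<in> carrier R" "x (i + 1) \<otimes> s i \<in> carrier R" by auto
  have "h q \<otimes> (t i \<otimes> x i) = (t i \<otimes> x i) \<otimes> h q" using c by (intro h_central q_closed) auto
  also have "\<dots> = (t i \<otimes> x i \<otimes> t i) \<otimes> s i" using c by (simp add: t_times_s(1)[OF i, symmetric] m_assoc)
  also have "\<dots> = h q \<otimes> (x (i + 1) \<otimes> s i)" using c by (simp add: t_x_t[OF i] m_assoc)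
  finally show "h q \<otimes> (t i \<otimes> x i) = h q \<otimes> (x (i + 1) \<otimes> s i)" .
qed

lemma s_x: assumes i: "i \<in> {1..<r}" shows "s i \<otimes> x (i + 1) = x i \<otimes> t i"
proof (rule h_q_cancel)
  have c: "t i \<in> carrier R" "x i \<in> carrier R" "x (i + 1) \<in> carrier R" "s i \<in> carrier R" "h q \<in> carrier R"
    using i by (auto simp: t_closed x_closed s_closed h_closed q_closed)
  then show "s i \<otimes> x (i + 1) \<in> carrier R" "x i \<otimes> t i \<in> carrier R" by auto
  have "h q \<otimes> (s i \<otimes> x (i + 1)) = s i \<otimes> (h q \<otimes> x (i + 1))"
    using c h_central[OF q_closed, of "s i"] by (simp add: m_assoc[symmetric])
  also have "h q \<otimes> x (i + 1) = t i \<otimes> (x i \<otimes> t i)" using t_x_t[OF i, symmetric] c by (simp add: m_assoc)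
  also have "s i \<otimes> (t i \<otimes> (x i \<otimes> t i)) = (s i \<otimes> t i) \<otimes> (x i \<otimes> t i)" using c by (simp add: m_assoc)
  finally show "h q \<otimes> (s i \<otimes> x (i + 1)) = h q \<otimes> (x i \<otimes> t i)" by (simp add: t_times_s(2)[OF i])
qed

text \<open>The rules for the \<open>x\<close>'s yield those for their inverses.\<close>

lemma inverse_intertwines:
  assumes "a \<in> carrier R" "b \<in> carrier R" "a' \<in> carrier R" "b' \<in> carrier R" "u \<in> carrier R" "v \<in> carrier R"
    and "a' \<otimes> a = \<one>" "b \<otimes> b' = \<one>" "u \<otimes> b = a \<otimes> v"
  shows "v \<otimes> b' = a' \<otimes> u"
proof -
  have "a' \<otimes> u = a' \<otimes> (u \<otimes> (b \<otimes> b'))" using assms(1-6,8) by simp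
  also have "\<dots> = a' \<otimes> (u \<otimes> b) \<otimes> b'" using assms(1-6) by (simp add: m_assoc)
  also have "\<dots> = a' \<otimes> (a \<otimes> v) \<otimes> b'" using assms(9) by simp
  also have "\<dots> = (a' \<otimes> a) \<otimes> v \<otimes> b'" using assms(1-6) by (simp add: m_assoc)
  finally show ?thesis using assms by simp
qed

lemma t_y: assumes i: "i \<in> {1..<r}" shows "t i \<otimes> y (i + 1) = y i \<otimes> s i"
proof (rule inverse_intertwines)
  show "s i \<otimes> x (i + 1) = x i \<otimes> t i" by (rule s_x[OF i])
qed (use i in \<open>auto simp: t_closed x_closed y_closed s_closed xy yx\<close>)

lemma s_y: assumes i: "i \<in> {1..<r}" shows "s i \<otimes> y i = y (i + 1) \<otimes> t i"
proof (rule inverse_intertwines)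
  show "t i \<otimes> x i = x (i + 1) \<otimes> s i" by (rule t_x[OF i])
qed (use i in \<open>auto simp: t_closed x_closed y_closed s_closed xy yx\<close>)

lemma yx_commute: assumes ij: "i \<in> {1..r}" "j \<in> {1..r}" shows "y i \<otimes> x j = x j \<otimes> y i"
proof (rule inverse_intertwines[symmetric])
  show "x j \<otimes> x i = x i \<otimes> x j" by (rule xx[OF ij(2,1)])
qed (use ij in \<open>auto simp: x_closed y_closed xy yx\<close>)

lemma yy: assumes ij: "i \<in> {1..r}" "j \<in> {1..r}" shows "y i \<otimes> y j = y j \<otimes> y i"
proof (rule inverse_intertwines)
  show "y i \<otimes> x j = x j \<otimes> y i" by (rule yx_commute[OF ij])
qed (use ij in \<open>auto simp: x_closed y_closed xy yx\<close>)

lemma yt: assumes "i \<in> {1..<r}" "j \<in> {1..r}" "j \<noteq> i" "j \<noteq> i + 1" shows "y j \<otimes> t i = t i \<otimes> y j"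
proof (rule inverse_intertwines[symmetric])
  show "t i \<otimes> x j = x j \<otimes> t i" by (rule xt[OF assms, symmetric])
qed (use assms in \<open>auto simp: x_closed y_closed t_closed xy yx\<close>)

text \<open>
  The pairs \<open>(x i, x (i + 1))\<close> and \<open>(y (i + 1), y i)\<close> are both instances of \<open>(a, b)\<close>; note the
  reversed order for the inverses.
\<close>

lemma intertwined_symmetric:
  assumes i: "i \<in> {1..<r}" and a: "a \<in> carrier R" "b \<in> carrier R" "a \<otimes> b = b \<otimes> a"
    and ta: "t i \<otimes> a = b \<otimes> s i" and sb: "s i \<otimes> b = a \<otimes> t i"
  shows "a \<oplus> b \<in> centralizer R (t i)" "a \<otimes> b \<in> centralizer R (t i)"
    "t i \<otimes> a = b \<otimes> t i \<oplus> \<ominus> \<beta> \<otimes> b" "t i \<otimes> b = a \<otimes> t i \<oplus> \<beta> \<otimes> b"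
proof -
  note c = a(1,2) t_closed[OF i] s_closed[OF i] \<beta>_closed
  have t: "t i = s i \<oplus> \<beta>" using c unfolding s_def by algebra
  show 1: "t i \<otimes> a = b \<otimes> t i \<oplus> \<ominus> \<beta> \<otimes> b"
  proof -
    have "t i \<otimes> a = b \<otimes> t i \<oplus> \<ominus> (b \<otimes> \<beta>)" using c unfolding ta s_def by algebra
    then show ?thesis using c \<beta>_central[of b] by (simp add: l_minus)
  qed
  show 2: "t i \<otimes> b = a \<otimes> t i \<oplus> \<beta> \<otimes> b"
  proof -
    have "t i \<otimes> b = s i \<otimes> b \<oplus> \<beta> \<otimes> b" unfolding t using c by (simp add: l_distr)
    then show ?thesis using sb by simp
  qed
  have "t i \<otimes> (a \<oplus> b) = (b \<otimes> t i \<oplus> \<ominus> \<beta> \<otimes> b) \<oplus> (a \<otimes> t i \<oplus> \<beta> \<otimes> b)"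
    using c by (simp add: r_distr 1 2)
  also have "\<dots> = (a \<oplus> b) \<otimes> t i" using c by algebra
  finally show "a \<oplus> b \<in> centralizer R (t i)" using c by (simp add: centralizer_def)
  have "t i \<otimes> (a \<otimes> b) = b \<otimes> (s i \<otimes> b)" using c by (simp add: m_assoc[symmetric] ta)
  also have "\<dots> = (a \<otimes> b) \<otimes> t i" using c by (simp add: sb m_assoc[symmetric] a(3))
  finally show "a \<otimes> b \<in> centralizer R (t i)" using c by (simp add: centralizer_def)
qed

abbreviation xy_set :: "'a set" where "xy_set \<equiv> x ` {1..r} \<union> y ` {1..r}"

text \<open>
  All commutation rules in one shape, which is what moving \<open>t i\<close> to the right in a product needs. If
  \<open>t i\<close> and \<open>z\<close> commute, the correction term is the one with \<open>k = 0\<close>.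
\<close>

lemma t_xy_set:
  assumes i: "i \<in> {1..<r}" and z: "z \<in> xy_set"
  shows "\<exists>z'\<in>xy_set. \<exists>z''\<in>xy_set. \<exists>k\<in>carrier K. t i \<otimes> z = z' \<otimes> t i \<oplus> h k \<otimes> z''"
proof -
  interpret h: ring_hom_ring K R h by (rule K_ring_hom)
  have ii: "i \<in> {1..r}" "i + 1 \<in> {1..r}" using i by auto
  note X = intertwined_symmetric(3,4)[OF i x_closed[OF ii(1)] x_closed[OF ii(2)] xx[OF ii] t_x[OF i] s_x[OF i]]
  note Y = intertwined_symmetric(3,4)[OF i y_closed[OF ii(2)] y_closed[OF ii(1)] yy[OF ii(2,1)] t_y[OF i] s_y[OF i]]
  obtain k where k: "k \<in> carrier K" "h k = \<beta>" using \<beta>_in_image by auto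
  then have k': "\<ominus>\<^bsub>K\<^esub> k \<in> carrier K" "h (\<ominus>\<^bsub>K\<^esub> k) = \<ominus> \<beta>" by auto
  have zc: "z \<in> carrier R" using z x_closed y_closed by auto
  consider "z = x i" | "z = x (i + 1)" | "z = y i" | "z = y (i + 1)" | "z \<otimes> t i = t i \<otimes> z"
    using z xt[OF i] yt[OF i] by auto metis+
  then show ?thesis
  proof cases
    case 1 with X(1) k' ii show ?thesis by (metis UnI1 imageI)
  next
    case 2 with X(2) k ii show ?thesis by (metis UnI1 imageI)
  next
    case 4 with Y(1) k' ii show ?thesis by (metis UnI2 imageI)
  next
    case 3 with Y(2) k ii show ?thesis by (metis UnI2 imageI)
  next
    case 5
    then have "t i \<otimes> z = z \<otimes> t i \<oplus> h \<zero>\<^bsub>K\<^esub> \<otimes> z" using zc t_closed[OF i] by simp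
    then show ?thesis using z by blast
  qed
qed

text \<open>
  The product of \<open>t (j + 1), \<dots>, t (j + m)\<close>. For \<open>j + m = k\<close> fixed, these correspond to the minimal
  representatives of the left cosets of \<open>\<SS>\<^sub>k\<close> in \<open>\<SS>\<^sub>k\<^sub>+\<^sub>1\<close>.
\<close>

primrec t_run :: "nat \<Rightarrow> nat \<Rightarrow> 'a" where
  "t_run j 0 = \<one>"
| "t_run j (Suc m) = t (Suc j) \<otimes> t_run (Suc j) m"

lemma t_run_closed: "j + m < r \<Longrightarrow> t_run j m \<in> carrier R"
  by (induction m arbitrary: j) (auto simp: t_closed)

lemma t_t_run_far: "j + m < r \<Longrightarrow> 1 \<le> i \<Longrightarrow> i < j \<Longrightarrow> t i \<otimes> t_run j m = t_run j m \<otimes> t i"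
proof (induction m arbitrary: j)
  case 0 then show ?case by (simp add: t_closed)
next
  case (Suc m)
  have c: "t i \<in> carrier R" "t (Suc j) \<in> carrier R" "t_run (Suc j) m \<in> carrier R"
    using Suc.prems by (auto simp: t_closed t_run_closed)
  have "t i \<otimes> t_run j (Suc m) = (t i \<otimes> t (Suc j)) \<otimes> t_run (Suc j) m" using c by (simp add: m_assoc)
  also have "t i \<otimes> t (Suc j) = t (Suc j) \<otimes> t i" using Suc.prems by (intro t_far) auto
  also have "t (Suc j) \<otimes> t i \<otimes> t_run (Suc j) m = t (Suc j) \<otimes> (t i \<otimes> t_run (Suc j) m)"
    using c by (simp add: m_assoc)
  also have "t i \<otimes> t_run (Suc j) m = t_run (Suc j) m \<otimes> t i" using Suc.prems by (intro Suc.IH) auto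
  finally show ?case using c by (simp add: m_assoc)
qed

text \<open>The braid relation lowers the index of a generator that passes through a run containing it.\<close>

lemma t_t_run_shift: "j + m < r \<Longrightarrow> Suc j \<le> i \<Longrightarrow> i < j + m \<Longrightarrow> t (Suc i) \<otimes> t_run j m = t_run j m \<otimes> t i"
proof (induction m arbitrary: j)
  case (Suc m)
  have c: "t i \<in> carrier R" "t (Suc i) \<in> carrier R" "t (Suc j) \<in> carrier R" "t_run (Suc j) m \<in> carrier R"
    using Suc.prems by (auto simp: t_closed t_run_closed)
  show ?case
  proof (cases "i = Suc j")
    case False
    have "t (Suc i) \<otimes> t_run j (Suc m) = (t (Suc i) \<otimes> t (Suc j)) \<otimes> t_run (Suc j) m" using c by (simp add: m_assoc)
    also have "t (Suc i) \<otimes> t (Suc j) = t (Suc j) \<otimes> t (Suc i)" using Suc.prems False by (intro t_far) auto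
    also have "t (Suc j) \<otimes> t (Suc i) \<otimes> t_run (Suc j) m = t (Suc j) \<otimes> (t (Suc i) \<otimes> t_run (Suc j) m)"
      using c by (simp add: m_assoc)
    also have "t (Suc i) \<otimes> t_run (Suc j) m = t_run (Suc j) m \<otimes> t i" using Suc.prems False by (intro Suc.IH) auto
    finally show ?thesis using c by (simp add: m_assoc)
  next
    case True
    then obtain n where m: "m = Suc n" using Suc.prems by (cases m) auto
    have d: "t_run (Suc i) n \<in> carrier R" using Suc.prems True m by (auto simp: t_run_closed)
    have "t (Suc i) \<otimes> t_run j (Suc m) = (t (i + 1) \<otimes> t i \<otimes> t (i + 1)) \<otimes> t_run (Suc i) n"
      using c d by (simp add: m True m_assoc)
    also have "t (i + 1) \<otimes> t i \<otimes> t (i + 1) = t i \<otimes> t (i + 1) \<otimes> t i"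
      using Suc.prems True by (intro t_braid[symmetric]) auto
    also have "t i \<otimes> t (i + 1) \<otimes> t i \<otimes> t_run (Suc i) n = t i \<otimes> t (i + 1) \<otimes> (t i \<otimes> t_run (Suc i) n)"
      using c d by (simp add: m_assoc)
    also have "t i \<otimes> t_run (Suc i) n = t_run (Suc i) n \<otimes> t i"
      using Suc.prems True m by (intro t_t_run_far) auto
    also have "t i \<otimes> t (i + 1) \<otimes> (t_run (Suc i) n \<otimes> t i) = t_run j (Suc m) \<otimes> t i"
      using c d by (simp add: m True m_assoc)
    finally show ?thesis .
  qed
qed simp

text \<open>
  The normal forms of words in \<open>t 1, \<dots>, t k\<close>, one coset representative for each step of the chain
  \<open>\<SS>\<^sub>1 \<subset> \<dots> \<subset> \<SS>\<^sub>k\<^sub>+\<^sub>1\<close>.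
\<close>

primrec t_monomials :: "nat \<Rightarrow> 'a set" where
  "t_monomials 0 = {\<one>}"
| "t_monomials (Suc k) = (\<lambda>(j, b). t_run j (Suc k - j) \<otimes> b) ` ({..Suc k} \<times> t_monomials k)"

lemma t_monomials_closed: "k < r \<Longrightarrow> t_monomials k \<subseteq> carrier R"
  by (induction k) (auto intro!: m_closed t_run_closed)

lemma finite_t_monomials: "finite (t_monomials k)"
  by (induction k) auto

lemma one_in_t_monomials: "\<one> \<in> t_monomials k"
proof (induction k)
  case (Suc k)
  then show ?case by (auto intro!: image_eqI[where x = "(Suc k, \<one>)"])
qed simp

abbreviation scalars :: "'a set" where "scalars \<equiv> h ` carrier K"

lemma scalars_closed: "scalars \<subseteq> carrier R"
  by (auto simp: h_closed)

text \<open>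
  A generator \<open>t i\<close> in front of a run that starts with \<open>t (j + 1)\<close> prolongs it (\<open>i = j\<close>), is absorbed
  by the quadratic relation (\<open>i = j + 1\<close>), or passes through it and acts on a shorter normal form.
\<close>

lemma t_t_monomials:
  assumes "k < r" "i \<in> {1..k}" "b \<in> t_monomials k"
  shows "t i \<otimes> b \<in> submodule_hull R scalars (t_monomials k)"
  using assms
proof (induction k arbitrary: i b)
  case (Suc k)
  let ?B = "t_monomials (Suc k)"
  have sub: "t_monomials k \<subseteq> carrier R" "?B \<subseteq> carrier R"
    using Suc.prems(1) by (simp_all only: t_monomials_closed Suc_lessD)
  note D = stableD[OF stable_submodule_hull[OF scalars_closed sub(2)]]
  from Suc.prems obtain j c where j: "j \<le> Suc k" and c: "c \<in> t_monomials k" and b: "b = t_run j (Suc k - j) \<otimes> c"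
    by auto
  have cc: "c \<in> carrier R" using c sub by blast
  have mem: "t_run l (Suc k - l) \<otimes> a \<in> submodule_hull R scalars ?B"
    if "l \<le> Suc k" "a \<in> submodule_hull R scalars (t_monomials k)" for l a
  proof (rule left_mult_submodule_hull[OF scalars_closed sub(2,1) _ _ _ that(2)])
    show "t_run l (Suc k - l) \<in> carrier R" using that Suc.prems by (intro t_run_closed) auto
    then show "t_run l (Suc k - l) \<otimes> w = w \<otimes> t_run l (Suc k - l)" if "w \<in> scalars" for w
      using that h_central by auto
    show "t_run l (Suc k - l) \<otimes> a \<in> submodule_hull R scalars ?B" if "a \<in> t_monomials k" for a
      using that \<open>l \<le> Suc k\<close> by (intro subsetD[OF subset_submodule_hull]) auto
  qed
  have c_hull: "c \<in> submodule_hull R scalars (t_monomials k)"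
    using c by (rule subsetD[OF subset_submodule_hull])
  have tc: "t i \<in> carrier R" using Suc.prems by (auto simp: t_closed)
  have sc: "t_run l (Suc k - l) \<in> carrier R" if "l \<le> Suc k" for l
    using that Suc.prems by (intro t_run_closed) auto
  have shift: "t i \<otimes> b \<in> submodule_hull R scalars ?B"
    if "t i \<otimes> t_run j (Suc k - j) = t_run j (Suc k - j) \<otimes> t i'" "i' \<in> {1..k}" for i'
  proof -
    have "t i' \<in> carrier R" using that Suc.prems by (auto simp: t_closed)
    then have "t i \<otimes> b = t_run j (Suc k - j) \<otimes> (t i' \<otimes> c)"
      unfolding b using tc cc sc[OF j] that(1) by (simp add: m_assoc[symmetric])
    moreover have "t i' \<otimes> c \<in> submodule_hull R scalars (t_monomials k)"
      using Suc.prems that c by (intro Suc.IH) auto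
    ultimately show ?thesis using mem j by simp
  qed
  consider "i = j" | "i = Suc j" | "i < j" | "Suc j < i" by linarith
  then show ?case
  proof cases
    case 1
    then obtain l where l: "j = Suc l" using Suc.prems by (cases j) auto
    then have eq: "Suc k - l = Suc (Suc k - j)" using j by simp
    have "t i \<otimes> b = t_run l (Suc k - l) \<otimes> c"
      unfolding eq b using l 1 tc cc sc[OF j] by (simp add: m_assoc)
    then show ?thesis using mem[OF _ c_hull, of l] l j by simp
  next
    case 2
    define u where "u = t_run i (Suc k - i)"
    have i_le: "i \<le> Suc k" using Suc.prems by simp
    have u: "u \<in> carrier R" unfolding u_def by (rule sc[OF i_le])
    have "Suc k - j = Suc (Suc k - i)" using 2 i_le by simp
    then have t_run: "t_run j (Suc k - j) = t i \<otimes> u" unfolding u_def using 2 by simp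
    have i': "i \<in> {1..<r}" using Suc.prems by auto
    have tt: "t i \<otimes> t i = \<beta> \<otimes> t i \<oplus> h q"
    proof -
      have "t i \<otimes> t i = t i \<otimes> s i \<oplus> t i \<otimes> \<beta>" using tc \<beta>_closed unfolding s_def by algebra
      then show ?thesis using tc \<beta>_closed by (simp add: t_times_s[OF i'] \<beta>_central h_closed q_closed a_comm)
    qed
    have "t i \<otimes> b = (t i \<otimes> t i) \<otimes> (u \<otimes> c)" unfolding b t_run using tc u cc by (simp add: m_assoc)
    also have "\<dots> = \<beta> \<otimes> (t_run j (Suc k - j) \<otimes> c) \<oplus> h q \<otimes> (u \<otimes> c)"
      unfolding tt t_run using tc u cc \<beta>_closed h_closed[OF q_closed] by (simp add: l_distr m_assoc)
    also have "\<dots> \<in> submodule_hull R scalars ?B"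
      unfolding u_def
      by (rule D(3)[OF D(6)[OF \<beta>_in_image mem[OF j c_hull]]
            D(6)[OF imageI[OF q_closed] mem[OF i_le c_hull]]])
    finally show ?thesis .
  next
    case 3
    then show ?thesis using Suc.prems j by (intro shift[of i] t_t_run_far) auto
  next
    case 4
    then obtain i' where "i = Suc i'" by (cases i) auto
    then show ?thesis using Suc.prems j 4 by (intro shift[of i']) (auto intro!: t_t_run_shift)
  qed
qed simp

definition symmetric_functions :: "'a set" where
  "symmetric_functions = (\<Union>zs\<in>{map x [1..<Suc r], map y [1..<Suc r]}. vieta R zs ` {..length zs})"

lemma list_split_adjacent:
  assumes "i \<in> {1..<r}"
  shows "map f [1..<Suc r] = map f [1..<i] @ f i # f (i + 1) # map f [i + 2..<Suc r]"
proof -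
  have "[1..<Suc r] = [1..<i] @ [i..<Suc r]"
    using assms upt_add_eq_append[of 1 i "Suc r - i"] by auto
  also have "[i..<Suc r] = i # (i + 1) # [i + 2..<Suc r]"
    using assms by (simp add: upt_conv_Cons)
  finally show ?thesis by simp
qed

lemma symmetric_functions_commute_t:
  assumes i: "i \<in> {1..<r}" and v: "v \<in> symmetric_functions"
  shows "v \<in> centralizer R (t i)"
proof -
  have ii: "i \<in> {1..r}" "i + 1 \<in> {1..r}" using i by auto
  have "vieta R (map x [1..<Suc r]) k \<in> centralizer R (t i)" for k
    unfolding list_split_adjacent[OF i]
    using i ii by (intro vieta_centralized_adjacent t_closed x_closed xx
        intertwined_symmetric(1,2)[OF i _ _ _ t_x[OF i] s_x[OF i]])
      (auto simp: centralizer_def x_closed t_closed xt)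
  moreover have "vieta R (map y [1..<Suc r]) k \<in> centralizer R (t i)" for k
  proof -
    note Y = intertwined_symmetric(1,2)[OF i y_closed[OF ii(2)] y_closed[OF ii(1)] yy[OF ii(2,1)] t_y[OF i] s_y[OF i]]
    show ?thesis
      unfolding list_split_adjacent[OF i]
      using i ii Y by (intro vieta_centralized_adjacent t_closed y_closed yy)
        (auto simp: centralizer_def y_closed t_closed yt yy a_comm)
  qed
  ultimately show ?thesis using v unfolding symmetric_functions_def by auto
qed

lemma xy_set_closed: "xy_set \<subseteq> carrier R"
  using x_closed y_closed by auto

lemma xy_set_commute: "z \<in> xy_set \<Longrightarrow> z' \<in> xy_set \<Longrightarrow> z \<otimes> z' = z' \<otimes> z"
  by (elim UnE imageE) (simp_all add: xx yy yx_commute)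

lemma symmetric_functions_closed: "symmetric_functions \<subseteq> carrier R"
proof -
  have "set (map x [1..<Suc r]) \<subseteq> carrier R" "set (map y [1..<Suc r]) \<subseteq> carrier R"
    using x_closed y_closed by auto
  from this[THEN vieta_closed] show ?thesis unfolding symmetric_functions_def by blast
qed

lemma symmetric_functions_commute_xy:
  assumes z: "z \<in> xy_set" and v: "v \<in> symmetric_functions"
  shows "v \<in> centralizer R z"
proof -
  have zc: "z \<in> carrier R" using z xy_set_closed by blast
  have "xy_set \<subseteq> centralizer R z"
    using xy_set_commute[OF _ z] xy_set_closed unfolding centralizer_def by blast
  then have "set (map x [1..<Suc r]) \<subseteq> centralizer R z" "set (map y [1..<Suc r]) \<subseteq> centralizer R z"
    by auto
  then show ?thesis
    using v vieta_mem_subring[OF subring_centralizer[OF zc]] unfolding symmetric_functions_def by blast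
qed

lemma symmetric_functions_central:
  assumes v: "v \<in> symmetric_functions" and a: "a \<in> carrier R"
  shows "v \<otimes> a = a \<otimes> v"
proof -
  have vc: "v \<in> carrier R" using v symmetric_functions_closed by blast
  note S = subringE[OF subring_centralizer[OF vc]]
  have "centralizer R v = carrier R"
  proof (rule generated)
    show "stable_subgroup R (scalars \<union> t ` {1..<r} \<union> x ` {1..r} \<union> y ` {1..r}) (centralizer R v)"
    proof (rule stableI)
      fix w b assume w: "w \<in> scalars \<union> t ` {1..<r} \<union> x ` {1..r} \<union> y ` {1..r}" and b: "b \<in> centralizer R v"
      have "w \<in> carrier R" using w scalars_closed xy_set_closed t_closed by auto
      moreover have "w \<otimes> v = v \<otimes> w"
      proof -
        from w consider "w \<in> scalars" | "w \<in> t ` {1..<r}" | "w \<in> xy_set"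
          by (elim UnE) (simp_all only: Un_iff simp_thms)
        then show ?thesis
        proof cases
          case 1 with vc h_central show ?thesis by auto
        next
          case 2
          then obtain i where "i \<in> {1..<r}" "w = t i" by (rule imageE)
          with symmetric_functions_commute_t[OF _ v] show ?thesis by (simp add: centralizer_def)
        next
          case 3 from symmetric_functions_commute_xy[OF this v] show ?thesis by (simp add: centralizer_def)
        qed
      qed
      ultimately have "w \<in> centralizer R v" by (simp add: centralizer_def)
      then show "w \<otimes> b \<in> centralizer R v" using b S by blast
    qed (use S in auto)
    show "\<one> \<in> centralizer R v" by (rule S)
  qed
  then have "a \<in> centralizer R v" using a by simp
  then show ?thesis by (simp add: centralizer_def)
qed

text \<open>
  The subgroup spanned by the normal forms over \<open>K\<close>, the symmetric functions, the \<open>x\<close>'s and the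
  \<open>y\<close>'s is also closed under left multiplication by the \<open>t i\<close>: by \<open>t_xy_set\<close> they move to the right until they
  meet a normal form. Hence it is the whole ring.
\<close>

lemma t_monomials_spans:
  "spans R (scalars \<union> symmetric_functions \<union> xy_set) (t_monomials (r - 1))"
proof (cases "r = 0")
  case True
  then show ?thesis
    using generated stable_antimono[of R _ _ "scalars \<union> t ` {1..<r} \<union> x ` {1..r} \<union> y ` {1..r}"]
    unfolding spans_def by auto
next
  case False
  let ?W = "scalars \<union> symmetric_functions \<union> xy_set" and ?B = "t_monomials (r - 1)"
  let ?N = "submodule_hull R ?W ?B"
  have Wc: "?W \<subseteq> carrier R" using scalars_closed symmetric_functions_closed xy_set_closed by blast
  have Bc: "?B \<subseteq> carrier R" using False by (intro t_monomials_closed) simp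
  have N: "stable_subgroup R ?W ?N" by (rule stable_submodule_hull[OF Wc Bc])
  note D = stableD[OF N]
  have tN: "t i \<otimes> a \<in> ?N" if i: "i \<in> {1..<r}" and a: "a \<in> ?N" for i a
  proof -
    have tc: "t i \<in> carrier R" by (rule t_closed[OF i])
    have "stable_subgroup R ?W {a \<in> ?N. t i \<otimes> a \<in> ?N}"
    proof (rule stableI)
      fix w a assume w: "w \<in> ?W" and "a \<in> {a \<in> ?N. t i \<otimes> a \<in> ?N}"
      then have a: "a \<in> ?N" "t i \<otimes> a \<in> ?N" by auto
      have ac: "a \<in> carrier R" using a D(1) by blast
      have wc: "w \<in> carrier R" using w Wc by blast
      have "t i \<otimes> (w \<otimes> a) \<in> ?N"
      proof (cases "w \<in> xy_set")
        case True
        then obtain z z' k where z: "z \<in> xy_set" "z' \<in> xy_set" "k \<in> carrier K"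
          and eq: "t i \<otimes> w = z \<otimes> t i \<oplus> h k \<otimes> z'"
          using t_xy_set[OF i] by blast
        have zc: "z \<in> carrier R" "z' \<in> carrier R" "h k \<in> carrier R"
          using z xy_set_closed by (auto simp only: h_closed)
        have "t i \<otimes> (w \<otimes> a) = z \<otimes> (t i \<otimes> a) \<oplus> h k \<otimes> (z' \<otimes> a)"
          using ac wc tc zc eq by (simp add: m_assoc[symmetric] l_distr)
        also have "\<dots> \<in> ?N"
        proof (rule D(3)[OF D(6)[OF _ a(2)] D(6)[OF _ D(6)[OF _ a(1)]]])
          show "z \<in> ?W" "z' \<in> ?W" using z(1,2) by simp_all
          show "h k \<in> ?W" using z(3) by simp
        qed
        finally show ?thesis .
      next
        case False
        then have "t i \<otimes> w = w \<otimes> t i"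
          using w h_central[OF _ tc] symmetric_functions_central[OF _ tc] by auto
        then have "t i \<otimes> (w \<otimes> a) = w \<otimes> (t i \<otimes> a)" using ac wc tc by (simp add: m_assoc[symmetric])
        then show ?thesis using D(6)[OF w a(2)] by simp
      qed
      then show "w \<otimes> a \<in> {a \<in> ?N. t i \<otimes> a \<in> ?N}" using D(6)[OF w a(1)] by simp
    next
      show "{a \<in> ?N. t i \<otimes> a \<in> ?N} \<subseteq> carrier R" using D(1) by blast
      show "\<zero> \<in> {a \<in> ?N. t i \<otimes> a \<in> ?N}" using D(2) tc by simp
      fix a assume "a \<in> {a \<in> ?N. t i \<otimes> a \<in> ?N}"
      then have a: "a \<in> ?N" "t i \<otimes> a \<in> ?N" "a \<in> carrier R" using D(1) by auto
      then show "\<ominus> a \<in> {a \<in> ?N. t i \<otimes> a \<in> ?N}" using D(4) tc by (auto simp: r_minus)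
      fix b assume "b \<in> {a \<in> ?N. t i \<otimes> a \<in> ?N}"
      then have b: "b \<in> ?N" "t i \<otimes> b \<in> ?N" "b \<in> carrier R" using D(1) by auto
      show "a \<oplus> b \<in> {a \<in> ?N. t i \<otimes> a \<in> ?N}" using a b D(3) tc by (auto simp: r_distr)
    qed
    moreover have "?B \<subseteq> {a \<in> ?N. t i \<otimes> a \<in> ?N}"
    proof
      fix b assume b: "b \<in> ?B"
      have "t i \<otimes> b \<in> submodule_hull R scalars ?B" using b i by (intro t_t_monomials) auto
      moreover have "submodule_hull R scalars ?B \<subseteq> ?N"
        using Wc Bc by (intro submodule_hull_mono) auto
      ultimately show "b \<in> {a \<in> ?N. t i \<otimes> a \<in> ?N}"
        using subsetD[OF subset_submodule_hull b] by blast
    qed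
    ultimately have "?N \<subseteq> {a \<in> ?N. t i \<otimes> a \<in> ?N}" by (rule submodule_hull_minimal)
    then show ?thesis using a by blast
  qed
  have "?N = carrier R"
  proof (rule generated)
    show "\<one> \<in> ?N" using one_in_t_monomials by (rule subsetD[OF subset_submodule_hull])
    show "stable_subgroup R (scalars \<union> t ` {1..<r} \<union> x ` {1..r} \<union> y ` {1..r}) ?N"
    proof (rule stableI)
      fix w a assume w: "w \<in> scalars \<union> t ` {1..<r} \<union> x ` {1..r} \<union> y ` {1..r}" and a: "a \<in> ?N"
      then consider "w \<in> ?W" | i where "i \<in> {1..<r}" "w = t i" by auto
      then show "w \<otimes> a \<in> ?N" using D(6)[OF _ a] tN[OF _ a] by cases auto
    qed (use D in auto)
  qed
  then show ?thesis
    unfolding spans_def using submodule_hull_minimal stableD(1) by (metis subset_antisym)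
qed

theorem noetherian_over_center:
  "\<exists>W. W \<subseteq> carrier R \<and> (\<forall>w\<in>W. \<forall>a\<in>carrier R. w \<otimes> a = a \<otimes> w) \<and>
    noetherian_submodule R W (carrier R)"
proof (intro exI conjI ballI)
  let ?L = "{map x [1..<Suc r], map y [1..<Suc r]}"
  have Z: "(\<Union>zs\<in>?L. set zs) = xy_set" by (auto simp: atLeastLessThanSuc_atLeastAtMost simp del: upt_Suc)
  show "noetherian_submodule R (scalars \<union> symmetric_functions) (carrier R)"
  proof (rule noetherian_over_symmetric_functions[OF K_noetherian K_cring h_hom h_central, where L = ?L])
    show "symmetric_functions = (\<Union>zs\<in>?L. vieta R zs ` {..length zs})"
      by (simp only: symmetric_functions_def)
    show "finite (t_monomials (r - 1))" by (rule finite_t_monomials)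
    show "spans R (scalars \<union> symmetric_functions \<union> (\<Union>zs\<in>?L. set zs)) (t_monomials (r - 1))"
      unfolding Z by (rule t_monomials_spans)
    show "t_monomials (r - 1) \<subseteq> carrier R"
      using t_monomials_closed[of "r - 1"] by (cases "r = 0") auto
    show "set zs \<subseteq> carrier R" if "zs \<in> ?L" for zs
      using that Z xy_set_closed by blast
    show "a \<otimes> b = b \<otimes> a" if "zs \<in> ?L" "zs' \<in> ?L" "a \<in> set zs" "b \<in> set zs'" for zs zs' a b
      using that Z xy_set_commute by blast
  qed auto
  show "scalars \<union> symmetric_functions \<subseteq> carrier R"
    using scalars_closed symmetric_functions_closed by blast
  show "w \<otimes> a = a \<otimes> w" if "w \<in> scalars \<union> symmetric_functions" "a \<in> carrier R" for w a
    using that h_central symmetric_functions_central by auto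
qed

end

section \<open>Monoid algebras\<close>

locale ring_and_monoid = ring K + M: monoid M
  for K :: "('a, 'c) ring_scheme" (structure) and M :: "('m, 'd) monoid_scheme"
begin

abbreviation A :: "('m \<Rightarrow> 'a) ring" where "A \<equiv> monoid_algebra K M"
abbreviation mon :: "'a \<Rightarrow> 'm \<Rightarrow> 'm \<Rightarrow> 'a" where "mon \<equiv> monoid_algebra_term K"

lemma A_carrier: "f \<in> carrier A \<longleftrightarrow>
    (\<forall>m. f m \<in> carrier K) \<and> (\<forall>m. m \<notin> carrier M \<longrightarrow> f m = \<zero>) \<and> finite {m. f m \<noteq> \<zero>}"
  by (simp add: monoid_algebra_def)

lemma A_add: "f \<oplus>\<^bsub>A\<^esub> g = (\<lambda>m. f m \<oplus> g m)"
  and A_zero: "\<zero>\<^bsub>A\<^esub> = (\<lambda>m. \<zero>)"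
  and A_one: "\<one>\<^bsub>A\<^esub> = mon \<one> \<one>\<^bsub>M\<^esub>"
  by (simp_all add: monoid_algebra_def monoid_algebra_term_def)

lemma A_coeff: "f \<in> carrier A \<Longrightarrow> f m \<in> carrier K"
  by (simp add: A_carrier)

lemma A_support: "f \<in> carrier A \<Longrightarrow> finite {m. f m \<noteq> \<zero>}" "f \<in> carrier A \<Longrightarrow> {m. f m \<noteq> \<zero>} \<subseteq> carrier M"
  by (auto simp: A_carrier)

text \<open>
  Convolution over any finite sets containing the supports, so that sums for different functions can
  be taken over a common index set.
\<close>

lemma A_mult:
  assumes f: "f \<in> carrier A" and g: "g \<in> carrier A"
    and S: "finite S" "{m. f m \<noteq> \<zero>} \<subseteq> S" and T: "finite T" "{m. g m \<noteq> \<zero>} \<subseteq> T"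
  shows "f \<otimes>\<^bsub>A\<^esub> g = (\<lambda>m. \<Oplus>p\<in>S \<times> T. if fst p \<otimes>\<^bsub>M\<^esub> snd p = m then f (fst p) \<otimes> g (snd p) else \<zero>)"
proof
  fix m
  have "(f \<otimes>\<^bsub>A\<^esub> g) m =
      finsum K (\<lambda>(u, v). f u \<otimes> g v) {(u, v). f u \<noteq> \<zero> \<and> g v \<noteq> \<zero> \<and> u \<otimes>\<^bsub>M\<^esub> v = m}"
    by (simp add: monoid_algebra_def)
  also have "\<dots> = (\<Oplus>p\<in>S \<times> T. if fst p \<otimes>\<^bsub>M\<^esub> snd p = m then f (fst p) \<otimes> g (snd p) else \<zero>)"
    using S T A_coeff[OF f] A_coeff[OF g]
    by (intro add.finprod_mono_neutral_cong_left) auto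
  finally show "(f \<otimes>\<^bsub>A\<^esub> g) m = \<dots>" .
qed

lemma A_mult_closed:
  assumes f: "f \<in> carrier A" and g: "g \<in> carrier A"
  shows "f \<otimes>\<^bsub>A\<^esub> g \<in> carrier A"
proof -
  let ?S = "{m. f m \<noteq> \<zero>}" and ?T = "{m. g m \<noteq> \<zero>}"
  have eq: "f \<otimes>\<^bsub>A\<^esub> g =
      (\<lambda>m. \<Oplus>p\<in>?S \<times> ?T. if fst p \<otimes>\<^bsub>M\<^esub> snd p = m then f (fst p) \<otimes> g (snd p) else \<zero>)"
    using f g by (intro A_mult A_support) auto
  have zero: "(f \<otimes>\<^bsub>A\<^esub> g) m = \<zero>" if "m \<notin> (\<lambda>p. fst p \<otimes>\<^bsub>M\<^esub> snd p) ` (?S \<times> ?T)" for m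
    unfolding eq using that by (intro add.finprod_one_eqI) auto
  show ?thesis
    unfolding A_carrier
  proof (intro conjI allI impI)
    show "(f \<otimes>\<^bsub>A\<^esub> g) m \<in> carrier K" for m
      unfolding eq using A_coeff[OF f] A_coeff[OF g] by (intro finsum_closed) auto
    show "(f \<otimes>\<^bsub>A\<^esub> g) m = \<zero>" if "m \<notin> carrier M" for m
    proof (rule zero)
      have "fst p \<otimes>\<^bsub>M\<^esub> snd p \<in> carrier M" if "p \<in> ?S \<times> ?T" for p
        using that A_support(2)[OF f] A_support(2)[OF g] by (intro M.m_closed) auto
      then show "m \<notin> (\<lambda>p. fst p \<otimes>\<^bsub>M\<^esub> snd p) ` (?S \<times> ?T)" using \<open>m \<notin> carrier M\<close> by blast
    qed
    have "finite ((\<lambda>p. fst p \<otimes>\<^bsub>M\<^esub> snd p) ` (?S \<times> ?T))"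
      using A_support(1)[OF f] A_support(1)[OF g] by simp
    moreover have "{m. (f \<otimes>\<^bsub>A\<^esub> g) m \<noteq> \<zero>} \<subseteq> (\<lambda>p. fst p \<otimes>\<^bsub>M\<^esub> snd p) ` (?S \<times> ?T)"
      using zero by blast
    ultimately show "finite {m. (f \<otimes>\<^bsub>A\<^esub> g) m \<noteq> \<zero>}" by (rule finite_subset[rotated])
  qed
qed

lemma A_add_closed:
  assumes "f \<in> carrier A" "g \<in> carrier A" shows "f \<oplus>\<^bsub>A\<^esub> g \<in> carrier A"
proof -
  have "{m. f m \<oplus> g m \<noteq> \<zero>} \<subseteq> {m. f m \<noteq> \<zero>} \<union> {m. g m \<noteq> \<zero>}" by auto
  then show ?thesis
    using assms unfolding A_carrier A_add by (auto elim: finite_subset)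
qed

lemma A_abelian_group: "abelian_group A"
proof (rule abelian_groupI)
  show "\<zero>\<^bsub>A\<^esub> \<in> carrier A" by (simp add: A_carrier A_zero)
  fix f assume f: "f \<in> carrier A"
  show "\<zero>\<^bsub>A\<^esub> \<oplus>\<^bsub>A\<^esub> f = f" using A_coeff[OF f] by (simp add: A_add A_zero)
  have "(\<lambda>m. \<ominus> f m) \<in> carrier A"
    using f unfolding A_carrier by (auto elim: rev_finite_subset)
  moreover have "(\<lambda>m. \<ominus> f m) \<oplus>\<^bsub>A\<^esub> f = \<zero>\<^bsub>A\<^esub>"
    using A_coeff[OF f] by (simp add: A_add A_zero l_neg)
  ultimately show "\<exists>g\<in>carrier A. g \<oplus>\<^bsub>A\<^esub> f = \<zero>\<^bsub>A\<^esub>" by blast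
qed (simp_all only: A_add_closed, simp_all add: A_add A_coeff a_ac)

lemma mon_closed: "a \<in> carrier K \<Longrightarrow> m \<in> carrier M \<Longrightarrow> mon a m \<in> carrier A"
  by (auto simp: A_carrier monoid_algebra_term_def)

lemma mon_add: "mon a m \<oplus>\<^bsub>A\<^esub> mon b m = mon (a \<oplus> b) m"
  by (auto simp: A_add monoid_algebra_term_def)

lemma mon_mult:
  assumes "a \<in> carrier K" "b \<in> carrier K" "u \<in> carrier M" "v \<in> carrier M"
  shows "mon a u \<otimes>\<^bsub>A\<^esub> mon b v = mon (a \<otimes> b) (u \<otimes>\<^bsub>M\<^esub> v)"
proof -
  have "mon a u \<otimes>\<^bsub>A\<^esub> mon b v = (\<lambda>m. \<Oplus>p\<in>{u} \<times> {v}. if fst p \<otimes>\<^bsub>M\<^esub> snd p = m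
      then mon a u (fst p) \<otimes> mon b v (snd p) else \<zero>)"
    by (rule A_mult) (use assms in \<open>simp_all add: mon_closed\<close>, auto simp: monoid_algebra_term_def)
  also have "\<dots> = mon (a \<otimes> b) (u \<otimes>\<^bsub>M\<^esub> v)"
    using assms by (auto simp: monoid_algebra_term_def fun_eq_iff finsum_insert[of "{}"])
  finally show ?thesis .
qed

text \<open>
  Every element is a finite sum of terms. Once multiplication is known to be biadditive, identities such
  as associativity therefore reduce to terms.
\<close>

lemma monoid_algebra_induct [consumes 1, case_names zero add]:
  assumes f: "f \<in> carrier A" and zero: "P \<zero>\<^bsub>A\<^esub>"
    and add: "\<And>a m f. a \<in> carrier K \<Longrightarrow> m \<in> carrier M \<Longrightarrow> f \<in> carrier A \<Longrightarrow> P f \<Longrightarrow> P (mon a m \<oplus>\<^bsub>A\<^esub> f)"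
  shows "P f"
proof -
  have "P f" if "finite S" "f \<in> carrier A" "{m. f m \<noteq> \<zero>} \<subseteq> S" "S \<subseteq> carrier M" for S f
    using that
  proof (induction S arbitrary: f rule: finite_induct)
    case empty
    then have "f = \<zero>\<^bsub>A\<^esub>" by (auto simp: A_zero)
    then show ?case using zero by simp
  next
    case (insert u S)
    have c: "f m \<in> carrier K" for m using A_coeff insert.prems by blast
    let ?g = "f(u := \<zero>)"
    have "{m. ?g m \<noteq> \<zero>} \<subseteq> {m. f m \<noteq> \<zero>}" by auto
    then have "finite {m. ?g m \<noteq> \<zero>}" using A_support(1)[OF insert.prems(1)] by (rule finite_subset)
    then have g: "?g \<in> carrier A" using insert.prems(1) unfolding A_carrier by simp
    have "f = mon (f u) u \<oplus>\<^bsub>A\<^esub> ?g"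
      using c by (auto simp: A_add monoid_algebra_term_def fun_eq_iff)
    moreover have "P ?g" using insert.prems by (intro insert.IH g) auto
    ultimately show ?case using add[OF _ _ g, of "f u" u] c insert.prems by simp
  qed
  then show ?thesis using A_support f by blast
qed

lemma A_l_distr:
  assumes f: "f \<in> carrier A" and g: "g \<in> carrier A" and h: "h \<in> carrier A"
  shows "(f \<oplus>\<^bsub>A\<^esub> g) \<otimes>\<^bsub>A\<^esub> h = f \<otimes>\<^bsub>A\<^esub> h \<oplus>\<^bsub>A\<^esub> g \<otimes>\<^bsub>A\<^esub> h"
proof -
  let ?S = "{m. f m \<noteq> \<zero>} \<union> {m. g m \<noteq> \<zero>}" and ?T = "{m. h m \<noteq> \<zero>}"
  have fin: "finite ?S" "finite ?T" using A_support f g h by auto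
  note c = A_coeff[OF f] A_coeff[OF g] A_coeff[OF h]
  have sum: "{m. (f \<oplus>\<^bsub>A\<^esub> g) m \<noteq> \<zero>} \<subseteq> ?S" by (auto simp: A_add)
  have "(f \<oplus>\<^bsub>A\<^esub> g) \<otimes>\<^bsub>A\<^esub> h = (\<lambda>m. \<Oplus>p\<in>?S \<times> ?T. if fst p \<otimes>\<^bsub>M\<^esub> snd p = m
      then (f \<oplus>\<^bsub>A\<^esub> g) (fst p) \<otimes> h (snd p) else \<zero>)"
    by (rule A_mult[OF A_add_closed[OF f g] h fin(1) sum fin(2)]) auto
  also have "\<dots> = (\<lambda>m. \<Oplus>p\<in>?S \<times> ?T.
      (if fst p \<otimes>\<^bsub>M\<^esub> snd p = m then f (fst p) \<otimes> h (snd p) else \<zero>) \<oplus>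
      (if fst p \<otimes>\<^bsub>M\<^esub> snd p = m then g (fst p) \<otimes> h (snd p) else \<zero>))"
    using c by (intro ext finsum_cong) (auto simp: A_add l_distr simp_implies_def)
  also have "\<dots> = f \<otimes>\<^bsub>A\<^esub> h \<oplus>\<^bsub>A\<^esub> g \<otimes>\<^bsub>A\<^esub> h"
    using c unfolding A_mult[OF f h fin(1) _ fin(2), simplified] A_mult[OF g h fin(1) _ fin(2), simplified] A_add
    by (intro ext finsum_addf) auto
  finally show ?thesis .
qed

lemma A_r_distr:
  assumes f: "f \<in> carrier A" and g: "g \<in> carrier A" and h: "h \<in> carrier A"
  shows "h \<otimes>\<^bsub>A\<^esub> (f \<oplus>\<^bsub>A\<^esub> g) = h \<otimes>\<^bsub>A\<^esub> f \<oplus>\<^bsub>A\<^esub> h \<otimes>\<^bsub>A\<^esub> g"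
proof -
  let ?S = "{m. f m \<noteq> \<zero>} \<union> {m. g m \<noteq> \<zero>}" and ?T = "{m. h m \<noteq> \<zero>}"
  have fin: "finite ?S" "finite ?T" using A_support f g h by auto
  note c = A_coeff[OF f] A_coeff[OF g] A_coeff[OF h]
  have sum: "{m. (f \<oplus>\<^bsub>A\<^esub> g) m \<noteq> \<zero>} \<subseteq> ?S" by (auto simp: A_add)
  have "h \<otimes>\<^bsub>A\<^esub> (f \<oplus>\<^bsub>A\<^esub> g) = (\<lambda>m. \<Oplus>p\<in>?T \<times> ?S. if fst p \<otimes>\<^bsub>M\<^esub> snd p = m
      then h (fst p) \<otimes> (f \<oplus>\<^bsub>A\<^esub> g) (snd p) else \<zero>)"
    by (rule A_mult[OF h A_add_closed[OF f g] fin(2) _ fin(1) sum]) auto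
  also have "\<dots> = (\<lambda>m. \<Oplus>p\<in>?T \<times> ?S.
      (if fst p \<otimes>\<^bsub>M\<^esub> snd p = m then h (fst p) \<otimes> f (snd p) else \<zero>) \<oplus>
      (if fst p \<otimes>\<^bsub>M\<^esub> snd p = m then h (fst p) \<otimes> g (snd p) else \<zero>))"
    using c by (intro ext finsum_cong) (auto simp: A_add r_distr simp_implies_def)
  also have "\<dots> = h \<otimes>\<^bsub>A\<^esub> f \<oplus>\<^bsub>A\<^esub> h \<otimes>\<^bsub>A\<^esub> g"
    using c unfolding A_mult[OF h f fin(2) _ fin(1), simplified] A_mult[OF h g fin(2) _ fin(1), simplified] A_add
    by (intro ext finsum_addf) auto
  finally show ?thesis .
qed

lemma A_zero_mult: "f \<in> carrier A \<Longrightarrow> \<zero>\<^bsub>A\<^esub> \<otimes>\<^bsub>A\<^esub> f = \<zero>\<^bsub>A\<^esub>"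
  and A_mult_zero: "f \<in> carrier A \<Longrightarrow> f \<otimes>\<^bsub>A\<^esub> \<zero>\<^bsub>A\<^esub> = \<zero>\<^bsub>A\<^esub>"
  by (simp_all add: monoid_algebra_def)

lemma A_ring: "ring A"
proof (rule ringI)
  note closed = mon_closed A_mult_closed A_add_closed
  note distr = A_l_distr A_r_distr
  note zero = A_zero_mult A_mult_zero
  have zc: "\<zero>\<^bsub>A\<^esub> \<in> carrier A" by (rule abelian_groupE(2)[OF A_abelian_group])
  have assoc1: "(mon a u \<otimes>\<^bsub>A\<^esub> mon b v) \<otimes>\<^bsub>A\<^esub> h = mon a u \<otimes>\<^bsub>A\<^esub> (mon b v \<otimes>\<^bsub>A\<^esub> h)"
    if "h \<in> carrier A" "a \<in> carrier K" "u \<in> carrier M" "b \<in> carrier K" "v \<in> carrier M" for a b u v h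
    using that
    by (induction h rule: monoid_algebra_induct) (simp_all add: closed distr zero mon_mult m_assoc M.m_assoc)
  have assoc2: "(mon a u \<otimes>\<^bsub>A\<^esub> g) \<otimes>\<^bsub>A\<^esub> h = mon a u \<otimes>\<^bsub>A\<^esub> (g \<otimes>\<^bsub>A\<^esub> h)"
    if "g \<in> carrier A" "h \<in> carrier A" "a \<in> carrier K" "u \<in> carrier M" for a u g h
    using that by (induction g rule: monoid_algebra_induct) (simp_all add: closed distr zero assoc1)
  have assoc: "(f \<otimes>\<^bsub>A\<^esub> g) \<otimes>\<^bsub>A\<^esub> h = f \<otimes>\<^bsub>A\<^esub> (g \<otimes>\<^bsub>A\<^esub> h)"
    if "f \<in> carrier A" "g \<in> carrier A" "h \<in> carrier A" for f g h
    using that by (induction f rule: monoid_algebra_induct) (simp_all add: closed distr zero assoc2)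
  have one: "\<one>\<^bsub>A\<^esub> \<otimes>\<^bsub>A\<^esub> f = f" "f \<otimes>\<^bsub>A\<^esub> \<one>\<^bsub>A\<^esub> = f" if "f \<in> carrier A" for f
    using that
    by (induction f rule: monoid_algebra_induct) (simp_all add: closed distr zero mon_mult A_one)
  show "monoid A"
    by (rule monoidI) (simp_all add: closed assoc one, simp add: A_one closed)
qed (simp_all add: A_abelian_group A_l_distr A_r_distr)

lemma embed_hom: "(\<lambda>a. mon a \<one>\<^bsub>M\<^esub>) \<in> ring_hom K A"
  by (rule ring_hom_memI) (simp_all add: mon_closed mon_mult mon_add A_one)

lemma embed_central:
  assumes "cring K" and a: "a \<in> carrier K" and f: "f \<in> carrier A"
  shows "mon a \<one>\<^bsub>M\<^esub> \<otimes>\<^bsub>A\<^esub> f = f \<otimes>\<^bsub>A\<^esub> mon a \<one>\<^bsub>M\<^esub>"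
  using f
proof (induction f rule: monoid_algebra_induct)
  case (add b m f)
  then show ?case
    using a cring.cring_simprules(14)[OF \<open>cring K\<close>, of a b]
    by (simp add: A_l_distr A_r_distr mon_closed mon_mult)
qed (simp add: A_zero_mult A_mult_zero mon_closed a)

lemma stable_eq_carrier:
  assumes N: "stable_subgroup A W N" and W: "(\<lambda>a. mon a \<one>\<^bsub>M\<^esub>) ` carrier K \<subseteq> W"
    and mon: "\<And>m. m \<in> carrier M \<Longrightarrow> mon \<one> m \<in> N"
  shows "N = carrier A"
proof -
  interpret A: ring A by (rule A_ring)
  have "f \<in> N" if "f \<in> carrier A" for f
    using that
  proof (induction f rule: monoid_algebra_induct)
    case zero show ?case by (rule A.stableD(2)[OF N])
  next
    case (add a m f)
    have "mon a m = mon a \<one>\<^bsub>M\<^esub> \<otimes>\<^bsub>A\<^esub> mon \<one> m" using add by (simp add: mon_mult)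
    also have "\<dots> \<in> N" using W add by (intro A.stableD(6)[OF N] mon) auto
    finally show ?case using add by (intro A.stableD(3)[OF N])
  qed
  then show ?thesis using A.stableD(1)[OF N] by blast
qed

end

section \<open>Symmetric Laurent polynomials\<close>

lemma (in ring) noetherian_ring_if_acc:
  assumes "satisfies_acc {I. ideal I R}"
  shows "noetherian_ring R"
proof (unfold_locales)
  fix I assume I: "ideal I R"
  have "\<exists>A\<subseteq>I. finite A \<and> I = \<Inter>{J. ideal J R \<and> A \<subseteq> J}"
    by (rule satisfies_acc_imp_finitely_generated[OF assms]) (auto intro: i_Intersect I)
  moreover have "I \<subseteq> carrier R" using ideal.Icarr[OF I] by blast
  ultimately show "\<exists>A\<subseteq>carrier R. finite A \<and> I = Idl A" unfolding genideal_def by blast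
qed

lemma (in ring_hom_ring) hom_vieta:
  "set xs \<subseteq> carrier R \<Longrightarrow> h (vieta R xs k) = vieta S (map h xs) k"
proof (induction xs arbitrary: k)
  case (Cons x xs)
  then have "set (map h xs) \<subseteq> carrier S" by auto
  with Cons show ?case by (cases k) (simp_all add: R.vieta_closed S.vieta_closed del: set_map)
qed simp

lemma (in cring) vieta_swap:
  assumes "x \<in> carrier R" "y \<in> carrier R" "set zs \<subseteq> carrier R"
  shows "vieta R (x # y # zs) = vieta R (y # x # zs)"
proof
  fix k
  have c: "vieta R zs l \<in> carrier R" for l using assms by auto
  consider "k = 0" | "k = Suc 0" | l where "k = Suc (Suc l)" by (metis old.nat.exhaust)
  then show "vieta R (x # y # zs) k = vieta R (y # x # zs) k"
    using assms(1,2) c by cases (simp_all add: r_distr m_lcomm a_ac)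
qed

lemma vieta_Cons_cong: "vieta R xs = vieta R ys \<Longrightarrow> vieta R (x # xs) = vieta R (x # ys)"
  by (rule ext) (simp split: nat.split)

lemma (in cring) vieta_move_to_front:
  assumes "x \<in> carrier R" "set us \<subseteq> carrier R" "set vs \<subseteq> carrier R"
  shows "vieta R (us @ x # vs) = vieta R (x # us @ vs)"
  using assms(2)
proof (induction us)
  case (Cons u us)
  then have "vieta R ((u # us) @ x # vs) = vieta R (u # x # us @ vs)"
    unfolding append_Cons by (intro vieta_Cons_cong Cons.IH) auto
  also have "\<dots> = vieta R (x # u # us @ vs)" using Cons.prems assms by (intro vieta_swap) auto
  finally show ?case unfolding append_Cons .
qed simp

lemma (in cring) vieta_permute:
  assumes "mset xs = mset ys" "set xs \<subseteq> carrier R"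
  shows "vieta R xs = vieta R ys"
  using assms
proof (induction xs arbitrary: ys)
  case (Cons x xs)
  then have "x \<in> set ys" by (metis list.set_intros(1) set_mset_mset)
  then obtain us vs where ys: "ys = us @ x # vs" by (metis split_list)
  then have eq: "mset xs = mset (us @ vs)" using Cons.prems by simp
  have "set (us @ vs) \<subseteq> carrier R" using Cons.prems eq by (metis list.set_intros(2) set_mset_mset subset_code(1))
  then have "vieta R ys = vieta R (x # us @ vs)"
    unfolding ys using Cons.prems by (intro vieta_move_to_front) auto
  moreover have "vieta R xs = vieta R (us @ vs)" using Cons.prems eq by (intro Cons.IH) auto
  ultimately show ?case using vieta_Cons_cong[of R xs "us @ vs" x] by simp
qed simp

lemma laurent_ring_and_monoid: "ring K \<Longrightarrow> ring_and_monoid K (free_Abelian_group S)"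
  unfolding ring_and_monoid_def using group.is_monoid[OF group_free_Abelian_group] by blast

locale laurent = cring K for K :: "('a, 'c) ring_scheme" (structure) + fixes r :: nat
begin

\<comment> \<open>Keeps the index sets \<open>{1..r}\<close> and the lists \<open>[1..<Suc r]\<close> in the form in which they occur in the definitions.\<close>
declare One_nat_def [simp del] upt_Suc [simp del]

abbreviation G :: "(nat \<Rightarrow>\<^sub>0 int) monoid" where "G \<equiv> free_Abelian_group {1..r}"

sublocale laurent: ring_and_monoid K G
  by (rule laurent_ring_and_monoid) (rule ring_axioms)

abbreviation L :: "((nat \<Rightarrow>\<^sub>0 int) \<Rightarrow> 'a) ring" where "L \<equiv> laurent_poly_ring K r"

lemma L_eq: "L = monoid_algebra K G"
  by (simp add: laurent_poly_ring_def)

abbreviation Xvar :: "nat \<Rightarrow> (nat \<Rightarrow>\<^sub>0 int) \<Rightarrow> 'a" where "Xvar i \<equiv> monoid_algebra_term K \<one> (frag_of i)"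
abbreviation Yvar :: "nat \<Rightarrow> (nat \<Rightarrow>\<^sub>0 int) \<Rightarrow> 'a" where "Yvar i \<equiv> monoid_algebra_term K \<one> (- frag_of i)"
abbreviation embed :: "'a \<Rightarrow> (nat \<Rightarrow>\<^sub>0 int) \<Rightarrow> 'a" where "embed a \<equiv> monoid_algebra_term K a 0"

lemma L_cring: "cring L"
proof -
  interpret L: ring "monoid_algebra K G" by (rule laurent.A_ring)
  have comm1: "monoid_algebra_term K a c \<otimes>\<^bsub>monoid_algebra K G\<^esub> f = f \<otimes>\<^bsub>monoid_algebra K G\<^esub> monoid_algebra_term K a c"
    if "f \<in> carrier (monoid_algebra K G)" "a \<in> carrier K" "c \<in> carrier G" for a c f
    using that
    by (induction f rule: laurent.monoid_algebra_induct)
      (simp_all add: L.l_distr L.r_distr laurent.mon_closed laurent.mon_mult m_comm add.commute)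
  have "f \<otimes>\<^bsub>monoid_algebra K G\<^esub> g = g \<otimes>\<^bsub>monoid_algebra K G\<^esub> f"
    if "f \<in> carrier (monoid_algebra K G)" "g \<in> carrier (monoid_algebra K G)" for f g
    using that
    by (induction f rule: laurent.monoid_algebra_induct)
      (simp_all add: L.l_distr L.r_distr laurent.mon_closed comm1)
  then show ?thesis
    unfolding L_eq by (intro cring.intro L.ring_axioms comm_monoid.intro comm_monoid_axioms.intro L.monoid_axioms)
qed

sublocale L: cring L by (rule L_cring)

lemma L_mon_closed: "a \<in> carrier K \<Longrightarrow> Poly_Mapping.keys c \<subseteq> {1..r} \<Longrightarrow> monoid_algebra_term K a c \<in> carrier L"
  unfolding L_eq by (rule laurent.mon_closed) auto

lemma L_mon_mult:
  assumes "a \<in> carrier K" "b \<in> carrier K" "Poly_Mapping.keys c \<subseteq> {1..r}" "Poly_Mapping.keys d \<subseteq> {1..r}"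
  shows "monoid_algebra_term K a c \<otimes>\<^bsub>L\<^esub> monoid_algebra_term K b d = monoid_algebra_term K (a \<otimes> b) (c + d)"
  using laurent.mon_mult[of a b c d] assms unfolding L_eq by simp

lemma embed_hom: "embed \<in> ring_hom K L"
  using laurent.embed_hom unfolding L_eq by simp

lemma XY_closed: "i \<in> {1..r} \<Longrightarrow> Xvar i \<in> carrier L" "i \<in> {1..r} \<Longrightarrow> Yvar i \<in> carrier L"
  by (auto intro!: L_mon_closed)

text \<open>
  Multiplying \<open>1\<close> by the variables and their inverses produces all monomials: those exponents for which
  both the monomial and its inverse preserve \<open>N\<close> form a subgroup.
\<close>

lemma XY_span: "spans L (embed ` carrier K \<union> Xvar ` {1..r} \<union> Yvar ` {1..r}) {\<one>\<^bsub>L\<^esub>}"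
  unfolding spans_def
proof (intro allI impI, elim conjE)
  fix N assume N: "stable_subgroup L (embed ` carrier K \<union> Xvar ` {1..r} \<union> Yvar ` {1..r}) N" and one: "{\<one>\<^bsub>L\<^esub>} \<subseteq> N"
  note D = L.stableD[OF N]
  let ?m = "monoid_algebra_term K \<one>"
  have *: "Poly_Mapping.keys c \<subseteq> {1..r} \<and> (\<forall>n\<in>N. ?m c \<otimes>\<^bsub>L\<^esub> n \<in> N \<and> ?m (- c) \<otimes>\<^bsub>L\<^esub> n \<in> N)"
    if "Poly_Mapping.keys c \<subseteq> {1..r}" for c
    using that
  proof (induction c rule: frag_induction)
    case zero
    have "?m 0 = \<one>\<^bsub>L\<^esub>" using laurent.A_one unfolding L_eq by simp
    then show ?case using D(1) by auto
  next
    case (one i)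
    then show ?case using D(6) by auto
  next
    case (diff a b)
    have "Poly_Mapping.keys (a - b) \<subseteq> {1..r}" using diff keys_diff[of a b] by blast
    moreover have "?m (a - b) \<otimes>\<^bsub>L\<^esub> n \<in> N \<and> ?m (- (a - b)) \<otimes>\<^bsub>L\<^esub> n \<in> N" if n: "n \<in> N" for n
    proof -
      have nc: "n \<in> carrier L" using n D(1) by blast
      have "?m (a - b) \<otimes>\<^bsub>L\<^esub> n = ?m a \<otimes>\<^bsub>L\<^esub> (?m (- b) \<otimes>\<^bsub>L\<^esub> n)"
        using diff nc by (simp add: L.m_assoc[symmetric] L_mon_closed L_mon_mult)
      moreover have "?m (- (a - b)) \<otimes>\<^bsub>L\<^esub> n = ?m (- a) \<otimes>\<^bsub>L\<^esub> (?m b \<otimes>\<^bsub>L\<^esub> n)"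
        using diff nc by (simp add: L.m_assoc[symmetric] L_mon_closed L_mon_mult)
      ultimately show ?thesis using diff n by auto
    qed
    ultimately show ?case by blast
  qed
  show "N = carrier L"
    unfolding L_eq
  proof (rule laurent.stable_eq_carrier)
    show "stable_subgroup (monoid_algebra K G) (embed ` carrier K \<union> Xvar ` {1..r} \<union> Yvar ` {1..r}) N"
      using N unfolding L_eq .
    fix c assume "c \<in> carrier G"
    then have c: "Poly_Mapping.keys c \<subseteq> {1..r}" by simp
    then have "?m c \<otimes>\<^bsub>L\<^esub> \<one>\<^bsub>L\<^esub> \<in> N" using * one by blast
    then show "?m c \<in> N" using c by (simp add: L_mon_closed)
  qed auto
qed

definition symmetric_coeffs :: "((nat \<Rightarrow>\<^sub>0 int) \<Rightarrow> 'a) set" where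
  "symmetric_coeffs = (\<Union>zs\<in>{map Xvar [1..<Suc r], map Yvar [1..<Suc r]}. vieta L zs ` {..length zs})"

lemma noetherian_over_symmetric_coeffs:
  assumes "noetherian_ring K"
  shows "noetherian_submodule L (embed ` carrier K \<union> symmetric_coeffs) (carrier L)"
proof -
  let ?S = "{map Xvar [1..<Suc r], map Yvar [1..<Suc r]}"
  have Z: "(\<Union>zs\<in>?S. set zs) = Xvar ` {1..r} \<union> Yvar ` {1..r}"
    by (auto simp: atLeastLessThanSuc_atLeastAtMost simp del: upt_Suc)
  have Zc: "(\<Union>zs\<in>?S. set zs) \<subseteq> carrier L" unfolding Z using XY_closed by auto
  show ?thesis
  proof (rule L.noetherian_over_symmetric_functions[OF assms cring_axioms embed_hom, where L = ?S])
    show "embed k \<otimes>\<^bsub>L\<^esub> a = a \<otimes>\<^bsub>L\<^esub> embed k" if "k \<in> carrier K" "a \<in> carrier L" for k a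
      using that by (intro L.m_comm L_mon_closed) auto
    show "symmetric_coeffs = (\<Union>zs\<in>?S. vieta L zs ` {..length zs})"
      by (simp only: symmetric_coeffs_def)
    show "set zs \<subseteq> carrier L" if "zs \<in> ?S" for zs using that Zc by blast
    then show "x \<otimes>\<^bsub>L\<^esub> y = y \<otimes>\<^bsub>L\<^esub> x" if "zs \<in> ?S" "zs' \<in> ?S" "x \<in> set zs" "y \<in> set zs'" for zs zs' x y
      using that by (intro L.m_comm) blast+
    show "spans L (embed ` carrier K \<union> symmetric_coeffs \<union> (\<Union>zs\<in>?S. set zs)) {\<one>\<^bsub>L\<^esub>}"
      unfolding Z
      using XY_span stable_antimono[of L _ _ "embed ` carrier K \<union> Xvar ` {1..r} \<union> Yvar ` {1..r}"]
      unfolding spans_def by (meson Un_mono subset_refl sup.cobounded1 le_supI1 le_supI2 sup_least)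
  qed auto
qed

lemma permutes_map_key:
  fixes c :: "nat \<Rightarrow>\<^sub>0 int"
  assumes w: "w permutes {1..r}"
  shows "inj w" "inj (inv_into UNIV w)" "Poly_Mapping.map_key (inv_into UNIV w) (Poly_Mapping.map_key w c) = c"
    "Poly_Mapping.map_key w (Poly_Mapping.map_key (inv_into UNIV w) c) = c"
proof -
  show i: "inj w" "inj (inv_into UNIV w)" using permutes_inj[OF w] permutes_inj[OF permutes_inv[OF w]] by auto
  show "Poly_Mapping.map_key (inv_into UNIV w) (Poly_Mapping.map_key w c) = c"
    by (simp add: map_key_compose[OF i(2,1)] permutes_inv_o[OF w] map_key_id[folded id_def])
  show "Poly_Mapping.map_key w (Poly_Mapping.map_key (inv_into UNIV w) c) = c"
    by (simp add: map_key_compose[OF i] permutes_inv_o[OF w] map_key_id[folded id_def])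
qed

lemma keys_map_key_permutes:
  fixes c :: "nat \<Rightarrow>\<^sub>0 int"
  assumes "w permutes {1..r}"
  shows "Poly_Mapping.keys (Poly_Mapping.map_key w c) \<subseteq> {1..r} \<longleftrightarrow> Poly_Mapping.keys c \<subseteq> {1..r}"
proof -
  have "w -` B \<subseteq> {1..r} \<longleftrightarrow> B \<subseteq> {1..r}" for B
  proof
    assume sub: "w -` B \<subseteq> {1..r}"
    show "B \<subseteq> {1..r}"
    proof
      fix b assume "b \<in> B"
      moreover obtain a where "b = w a" using permutes_surj[OF assms] by (metis surjD)
      ultimately show "b \<in> {1..r}" using sub permutes_in_image[OF assms, of a] by blast
    qed
  next
    assume "B \<subseteq> {1..r}"
    then show "w -` B \<subseteq> {1..r}" using permutes_in_image[OF assms] by blast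
  qed
  then show ?thesis unfolding keys_map_key[OF permutes_map_key(1)[OF assms]] .
qed

lemma laurent_perm_mon:
  assumes "w permutes {1..r}"
  shows "laurent_perm w (monoid_algebra_term K a c) = monoid_algebra_term K a (Poly_Mapping.map_key (inv_into UNIV w) c)"
proof -
  have "Poly_Mapping.map_key w d = c \<longleftrightarrow> d = Poly_Mapping.map_key (inv_into UNIV w) c" for d
    using permutes_map_key(3,4)[OF assms] by metis
  then show ?thesis unfolding laurent_perm_def monoid_algebra_term_def by simp
qed

text \<open>Permuting variables is additive and acts on monomials by an automorphism of the exponent group.\<close>

lemma laurent_perm_hom:
  assumes w: "w permutes {1..r}"
  shows "laurent_perm w \<in> ring_hom L L"
proof (rule ring_hom_memI)
  note i = permutes_map_key[OF w]
  have perm_add: "laurent_perm w (f \<oplus>\<^bsub>L\<^esub> g) = laurent_perm w f \<oplus>\<^bsub>L\<^esub> laurent_perm w g" for f g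
    unfolding L_eq laurent.A_add by (simp add: laurent_perm_def)
  have perm_zero: "laurent_perm w \<zero>\<^bsub>L\<^esub> = \<zero>\<^bsub>L\<^esub>"
    unfolding L_eq laurent.A_zero by (simp add: laurent_perm_def)
  show closed: "laurent_perm w f \<in> carrier L" if "f \<in> carrier L" for f
  proof -
    have "{c. laurent_perm w f c \<noteq> \<zero>} \<subseteq> Poly_Mapping.map_key (inv_into UNIV w) ` {c. f c \<noteq> \<zero>}"
    proof
      fix c assume "c \<in> {c. laurent_perm w f c \<noteq> \<zero>}"
      then have "Poly_Mapping.map_key w c \<in> {c. f c \<noteq> \<zero>}" by (simp add: laurent_perm_def)
      then show "c \<in> Poly_Mapping.map_key (inv_into UNIV w) ` {c. f c \<noteq> \<zero>}"
        using i(3)[of c] by (intro image_eqI[where x = "Poly_Mapping.map_key w c"]) simp_all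
    qed
    moreover have "finite {c. f c \<noteq> \<zero>}" using that unfolding L_eq laurent.A_carrier by blast
    ultimately have "finite {c. laurent_perm w f c \<noteq> \<zero>}" by (meson finite_imageI finite_subset)
    moreover have "laurent_perm w f c \<in> carrier K" for c
      using that unfolding L_eq laurent.A_carrier laurent_perm_def by blast
    moreover have "laurent_perm w f c = \<zero>" if "c \<notin> carrier G" for c
    proof -
      have "Poly_Mapping.map_key w c \<notin> carrier G"
        using that keys_map_key_permutes[OF w, of c] by (simp only: carrier_free_Abelian_group_iff) simp
      then show ?thesis
        using \<open>f \<in> carrier L\<close> unfolding L_eq laurent.A_carrier laurent_perm_def by blast
    qed
    ultimately show ?thesis unfolding L_eq laurent.A_carrier by blast
  qed
  have mon_keys: "Poly_Mapping.keys (Poly_Mapping.map_key (inv_into UNIV w) c) \<subseteq> {1..r}" if "Poly_Mapping.keys c \<subseteq> {1..r}" for c :: "nat \<Rightarrow>\<^sub>0 int"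
    using keys_map_key_permutes[OF permutes_inv[OF w], of c] that by (rule iffD2)
  have mult1: "laurent_perm w (monoid_algebra_term K a c \<otimes>\<^bsub>L\<^esub> g) =
      laurent_perm w (monoid_algebra_term K a c) \<otimes>\<^bsub>L\<^esub> laurent_perm w g"
    if "g \<in> carrier L" and a: "a \<in> carrier K" "Poly_Mapping.keys c \<subseteq> {1..r}" for a c g
    using that(1) unfolding L_eq
  proof (induction g rule: laurent.monoid_algebra_induct)
    case zero
    then show ?case unfolding L_eq[symmetric] using a by (simp add: perm_zero L_mon_closed closed)
  next
    case (add b d g)
    then have "b \<in> carrier K" "Poly_Mapping.keys d \<subseteq> {1..r}" "g \<in> carrier L" by (simp_all add: L_eq)
    with add.IH show ?case unfolding L_eq[symmetric] using a
      by (simp add: L.r_distr L_mon_closed L_mon_mult perm_add closed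
          laurent_perm_mon[OF w] mon_keys map_key_plus[OF i(2)])
  qed
  show "laurent_perm w (f \<otimes>\<^bsub>L\<^esub> g) = laurent_perm w f \<otimes>\<^bsub>L\<^esub> laurent_perm w g"
    if "f \<in> carrier L" and g: "g \<in> carrier L" for f g
    using that(1) unfolding L_eq
  proof (induction f rule: laurent.monoid_algebra_induct)
    case zero
    then show ?case unfolding L_eq[symmetric] using g by (simp add: perm_zero L_mon_closed closed)
  next
    case (add b d f)
    then have "b \<in> carrier K" "Poly_Mapping.keys d \<subseteq> {1..r}" "f \<in> carrier L" by (simp_all add: L_eq)
    with add.IH show ?case unfolding L_eq[symmetric] using g
      by (simp add: L.l_distr L_mon_closed mult1 perm_add closed)
  qed
  show "laurent_perm w (f \<oplus>\<^bsub>L\<^esub> g) = laurent_perm w f \<oplus>\<^bsub>L\<^esub> laurent_perm w g" for f g by (rule perm_add)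
  have "\<one>\<^bsub>L\<^esub> = embed \<one>" using laurent.A_one unfolding L_eq by simp
  then show "laurent_perm w \<one>\<^bsub>L\<^esub> = \<one>\<^bsub>L\<^esub>" by (simp add: laurent_perm_mon[OF w] i(2))
qed

abbreviation Z :: "((nat \<Rightarrow>\<^sub>0 int) \<Rightarrow> 'a) set" where
  "Z \<equiv> {f \<in> carrier L. \<forall>w. w permutes {1..r} \<longrightarrow> laurent_perm w f = f}"

lemma Z_subring: "subring Z L"
proof (rule L.subringI)
  show "\<one>\<^bsub>L\<^esub> \<in> Z" using laurent_perm_hom by (auto simp: ring_hom_one)
  show "\<ominus>\<^bsub>L\<^esub> f \<in> Z" if "f \<in> Z" for f
  proof -
    have "laurent_perm w (\<ominus>\<^bsub>L\<^esub> f) = \<ominus>\<^bsub>L\<^esub> f" if w: "w permutes {1..r}" for w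
    proof -
      interpret w: ring_hom_ring L L "laurent_perm w"
        by (rule ring_hom_ringI2[OF L.ring_axioms L.ring_axioms laurent_perm_hom[OF w]])
      show ?thesis using w \<open>f \<in> Z\<close> by simp
    qed
    then show ?thesis using that by simp
  qed
  show "f \<otimes>\<^bsub>L\<^esub> g \<in> Z" "f \<oplus>\<^bsub>L\<^esub> g \<in> Z" if "f \<in> Z" "g \<in> Z" for f g
  proof -
    have "laurent_perm w (f \<otimes>\<^bsub>L\<^esub> g) = f \<otimes>\<^bsub>L\<^esub> g \<and> laurent_perm w (f \<oplus>\<^bsub>L\<^esub> g) = f \<oplus>\<^bsub>L\<^esub> g"
      if w: "w permutes {1..r}" for w
      using w \<open>f \<in> Z\<close> \<open>g \<in> Z\<close>
      by (simp add: ring_hom_mult[OF laurent_perm_hom[OF w]] ring_hom_add[OF laurent_perm_hom[OF w]])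
    then show "f \<otimes>\<^bsub>L\<^esub> g \<in> Z" "f \<oplus>\<^bsub>L\<^esub> g \<in> Z" using that by auto
  qed
qed auto

text \<open>
  A permutation of the variables permutes the roots of \<open>\<Prod>(Z - X\<^sub>j)\<close> and of \<open>\<Prod>(Z - X\<^sub>j\<inverse>)\<close>, so
  it fixes the coefficients.
\<close>

lemma symmetric_coeffs_in_Z: "embed ` carrier K \<union> symmetric_coeffs \<subseteq> Z"
proof -
  have vinv: "laurent_perm w (vieta L (map f [1..<Suc r]) k) = vieta L (map f [1..<Suc r]) k"
    if w: "w permutes {1..r}" and f: "\<And>i. i \<in> {1..r} \<Longrightarrow> f i \<in> carrier L"
      and wf: "\<And>i. laurent_perm w (f i) = f (w i)" for w f k
  proof -
    have c: "set (map f [1..<Suc r]) \<subseteq> carrier L" using f by auto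
    have "image_mset w (mset [1..<Suc r]) = mset [1..<Suc r]"
      using permutes_inj_on[OF w] permutes_image[OF w]
      by (simp add: image_mset_mset_set atLeastLessThanSuc_atLeastAtMost del: upt_Suc)
    then have "mset (map (f \<circ> w) [1..<Suc r]) = mset (map f [1..<Suc r])"
      by (metis image_mset.comp mset_map comp_apply)
    then have "vieta L (map f [1..<Suc r]) = vieta L (map (f \<circ> w) [1..<Suc r])"
      using c by (intro L.vieta_permute) auto
    moreover have "laurent_perm w (vieta L (map f [1..<Suc r]) k) = vieta L (map (laurent_perm w) (map f [1..<Suc r])) k"
      using c by (rule ring_hom_ring.hom_vieta[OF ring_hom_ringI2[OF L.ring_axioms L.ring_axioms laurent_perm_hom[OF w]]])
    moreover have "map (laurent_perm w) (map f [1..<Suc r]) = map (f \<circ> w) [1..<Suc r]"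
      using wf by simp
    ultimately show ?thesis by (simp only:)
  qed
  have Xw: "laurent_perm w (Xvar i) = Xvar (w i)" "laurent_perm w (Yvar i) = Yvar (w i)" if w: "w permutes {1..r}" for w i
  proof -
    have eq: "Poly_Mapping.map_key (inv_into UNIV w) (Poly_Mapping.single i v) = Poly_Mapping.single (w i) v" for v :: int
      using map_key_single[OF permutes_map_key(2)[OF w], of "w i" v] permutes_inverses(2)[OF w] by simp
    show "laurent_perm w (Xvar i) = Xvar (w i)" by (simp add: laurent_perm_mon[OF w] eq)
    show "laurent_perm w (Yvar i) = Yvar (w i)"
      using eq[of "-1"] by (simp add: laurent_perm_mon[OF w] single_uminus)
  qed
  have inv: "laurent_perm w (vieta L (map Xvar [1..<Suc r]) k) = vieta L (map Xvar [1..<Suc r]) k"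
    "laurent_perm w (vieta L (map Yvar [1..<Suc r]) k) = vieta L (map Yvar [1..<Suc r]) k"
    if "w permutes {1..r}" for w k
    by (intro vinv that XY_closed Xw; assumption)+
  have "set (map Xvar [1..<Suc r]) \<subseteq> carrier L" "set (map Yvar [1..<Suc r]) \<subseteq> carrier L"
    using XY_closed by auto
  from this[THEN L.vieta_closed] inv have "symmetric_coeffs \<subseteq> Z"
    unfolding symmetric_coeffs_def by blast
  moreover have "embed ` carrier K \<subseteq> Z"
    by (auto simp: L_mon_closed laurent_perm_mon permutes_map_key)
  ultimately show ?thesis by blast
qed

text \<open>
  The ideals of \<open>Z\<close> are among the submodules of the Laurent polynomial ring for the operators above,
  since these belong to \<open>Z\<close>; the chain condition passes to them.
\<close>

theorem noetherian_symmetric_laurent_ring: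
  assumes "noetherian_ring K"
  shows "noetherian_ring (symmetric_laurent_ring K r)"
proof -
  let ?Z = "symmetric_laurent_ring K r" and ?W = "embed ` carrier K \<union> symmetric_coeffs"
  have eq: "?Z = L\<lparr>carrier := Z\<rparr>" by (simp add: symmetric_laurent_ring_def)
  interpret Z: ring ?Z unfolding eq by (rule L.subring_is_ring[OF Z_subring])
  have "stable_subgroup L ?W I" if I: "ideal I ?Z" for I
  proof (rule L.stableI)
    interpret I: ideal I ?Z by fact
    show sub: "I \<subseteq> carrier L" using I.a_subset by (auto simp: eq)
    show "\<zero>\<^bsub>L\<^esub> \<in> I" using I.zero_closed by (simp add: eq)
    show "a \<oplus>\<^bsub>L\<^esub> b \<in> I" if "a \<in> I" "b \<in> I" for a b using I.a_closed[OF that] by (simp add: eq)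
    have mult: "z \<otimes>\<^bsub>L\<^esub> a \<in> I" if "z \<in> Z" "a \<in> I" for z a
      using I.I_l_closed[OF that(2), of z] that(1) by (simp add: eq)
    then show "w \<otimes>\<^bsub>L\<^esub> a \<in> I" if "w \<in> ?W" "a \<in> I" for w a
      using that symmetric_coeffs_in_Z by blast
    show "\<ominus>\<^bsub>L\<^esub> a \<in> I" if "a \<in> I" for a
    proof -
      have "\<ominus>\<^bsub>L\<^esub> \<one>\<^bsub>L\<^esub> \<otimes>\<^bsub>L\<^esub> a \<in> I"
        using subringE(3,5)[OF Z_subring] that by (intro mult) auto
      moreover have "a \<in> carrier L" using sub that by blast
      ultimately show ?thesis by (simp add: L.l_minus)
    qed
  qed
  then have "{I. ideal I ?Z} \<subseteq> {N. stable_subgroup L ?W N \<and> N \<subseteq> carrier L}"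
    using L.stableD(1) by blast
  then have "satisfies_acc {I. ideal I ?Z}"
    using noetherian_over_symmetric_coeffs[OF assms] unfolding noetherian_submodule_def
    by (blast intro: satisfies_acc_subset)
  then show ?thesis by (rule Z.noetherian_ring_if_acc)
qed

end

section \<open>The affine Hecke algebra\<close>

lemma monoid_free_monoid: "monoid (free_monoid S)"
  by (rule monoidI) (auto simp: free_monoid_def)

locale affine_hecke_algebra = cring K for K :: "('a, 'c) ring_scheme" (structure) +
  fixes r :: nat and \<epsilon> :: 'a
  assumes K_noetherian: "noetherian_ring K" and \<epsilon>_unit: "\<epsilon> \<in> Units K"
begin

declare One_nat_def [simp del]

sublocale free: ring_and_monoid K "free_monoid (hecke_gens r)"
  by (intro ring_and_monoid.intro ring_axioms monoid_free_monoid)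

abbreviation F :: "'a hecke_word_poly ring" where "F \<equiv> hecke_free K r"
abbreviation H :: "'a hecke_word_poly set ring" where "H \<equiv> affine_hecke K r \<epsilon>"
abbreviation J :: "'a hecke_word_poly set" where "J \<equiv> hecke_ideal K r \<epsilon>"
abbreviation word :: "'a \<Rightarrow> hecke_gen list \<Rightarrow> 'a hecke_word_poly" where
  "word \<equiv> monoid_algebra_term K"
abbreviation q :: 'a where "q \<equiv> \<epsilon> [^] (2::nat)"

lemma F_eq: "F = monoid_algebra K (free_monoid (hecke_gens r))"
  by (simp add: hecke_free_def free_algebra_def)

sublocale F: ring F
  unfolding F_eq by (rule free.A_ring)

lemma word_closed: "a \<in> carrier K \<Longrightarrow> ws \<in> lists (hecke_gens r) \<Longrightarrow> word a ws \<in> carrier F"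
  unfolding F_eq by (rule free.mon_closed) (auto simp: free_monoid_def)

lemma word_mult:
  assumes "a \<in> carrier K" "b \<in> carrier K" "us \<in> lists (hecke_gens r)" "vs \<in> lists (hecke_gens r)"
  shows "word a us \<otimes>\<^bsub>F\<^esub> word b vs = word (a \<otimes> b) (us @ vs)"
  using free.mon_mult[of a b us vs] assms unfolding F_eq by (simp add: free_monoid_def)

lemma F_one: "\<one>\<^bsub>F\<^esub> = word \<one> []"
  unfolding F_eq free.A_one by (simp add: free_monoid_def)

lemma q_unit: "q \<in> Units K"
  using \<epsilon>_unit by (rule Units_pow_closed)

lemma gens:
  "i \<in> {1..<r} \<Longrightarrow> GenT i \<in> hecke_gens r" "i \<in> {1..r} \<Longrightarrow> GenX i \<in> hecke_gens r"
  "i \<in> {1..r} \<Longrightarrow> GenXinv i \<in> hecke_gens r"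
  by (simp_all add: hecke_gens_def)

lemma gen_closed:
  "i \<in> {1..<r} \<Longrightarrow> word \<one> [GenT i] \<in> carrier F" "i \<in> {1..r} \<Longrightarrow> word \<one> [GenX i] \<in> carrier F"
  "i \<in> {1..r} \<Longrightarrow> word \<one> [GenXinv i] \<in> carrier F" "word q [] \<in> carrier F"
  using gens q_unit by (auto intro!: word_closed)

lemma relations_closed: "hecke_relations K r \<epsilon> \<subseteq> carrier F"
proof -
  have *: "i + 1 \<in> {1..r}" "i \<in> {1..r}" if "i \<in> {1..<r}" for i using that by auto
  show ?thesis
    unfolding hecke_relations_def Let_def
    by (intro Un_least; clarify; intro F.m_closed F.a_closed F.minus_closed F.one_closed gen_closed;
        (assumption | rule *, assumption)?)
qed

sublocale J: ideal J F
  unfolding hecke_ideal_def by (rule F.genideal_ideal[OF relations_closed])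

lemma H_eq: "H = F Quot J"
  by (simp add: affine_hecke_def)

sublocale H: ring H
  unfolding H_eq by (rule J.quotient_is_ring)

abbreviation p :: "'a hecke_word_poly \<Rightarrow> 'a hecke_word_poly set" where
  "p \<equiv> (+>\<^bsub>F\<^esub>) J"

sublocale p: ring_hom_ring F H p
  unfolding H_eq by (rule J.rcos_ring_hom_ring)

lemma H_carrier: "carrier H = p ` carrier F"
  unfolding H_eq FactRing_def A_RCOSETS_def' by auto

lemma p_eq_zero:
  assumes "f \<in> J" shows "p f = \<zero>\<^bsub>H\<^esub>"
proof -
  have "\<zero>\<^bsub>H\<^esub> = J" unfolding H_eq FactRing_def by simp
  moreover have "p f = J"
    by (rule abelian_subgroup.a_rcos_const[OF abelian_subgroupI3[OF J.additive_subgroup_axioms F.is_abelian_group] assms])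
  ultimately show ?thesis by simp
qed

lemma relation_holds:
  assumes "a \<ominus>\<^bsub>F\<^esub> b \<in> hecke_relations K r \<epsilon>" "a \<in> carrier F" "b \<in> carrier F"
  shows "p a = p b"
proof -
  have "a \<ominus>\<^bsub>F\<^esub> b \<in> J"
    unfolding hecke_ideal_def using F.genideal_self[OF relations_closed] assms(1) by blast
  then have "p (a \<ominus>\<^bsub>F\<^esub> b) = \<zero>\<^bsub>H\<^esub>"
    by (rule p_eq_zero)
  then have "p a \<ominus>\<^bsub>H\<^esub> p b = \<zero>\<^bsub>H\<^esub>" using assms by (simp add: a_minus_def)
  then show ?thesis using assms by (simp add: H.r_right_minus_eq)
qed

abbreviation h :: "'a \<Rightarrow> 'a hecke_word_poly set" where "h a \<equiv> p (word a [])"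
abbreviation t :: "nat \<Rightarrow> 'a hecke_word_poly set" where "t i \<equiv> p (word \<one> [GenT i])"
abbreviation x :: "nat \<Rightarrow> 'a hecke_word_poly set" where "x i \<equiv> p (word \<one> [GenX i])"
abbreviation y :: "nat \<Rightarrow> 'a hecke_word_poly set" where "y i \<equiv> p (word \<one> [GenXinv i])"

lemma h_hom: "h \<in> ring_hom K H"
proof -
  have "(\<lambda>a. word a []) \<in> ring_hom K F"
    using free.embed_hom unfolding F_eq by (simp add: free_monoid_def)
  from ring_hom_trans[OF this p.homh] show ?thesis by (simp add: comp_def)
qed

lemma h_central: "a \<in> carrier K \<Longrightarrow> b \<in> carrier H \<Longrightarrow> h a \<otimes>\<^bsub>H\<^esub> b = b \<otimes>\<^bsub>H\<^esub> h a"
proof -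
  assume a: "a \<in> carrier K" and "b \<in> carrier H"
  then obtain f where f: "f \<in> carrier F" "b = p f" unfolding H_carrier by blast
  have "word a [] \<otimes>\<^bsub>F\<^esub> f = f \<otimes>\<^bsub>F\<^esub> word a []"
    using free.embed_central[OF cring_axioms a, of f] f unfolding F_eq by (simp add: free_monoid_def)
  moreover have "word a [] \<in> carrier F" using a by (auto intro: word_closed)
  ultimately show "h a \<otimes>\<^bsub>H\<^esub> b = b \<otimes>\<^bsub>H\<^esub> h a" using f by (metis p.hom_mult)
qed

text \<open>The preimage of \<open>N\<close> in the free algebra contains all words, by induction on their length.\<close>

lemma generated_by_generators:
  assumes N: "stable_subgroup H (h ` carrier K \<union> t ` {1..<r} \<union> x ` {1..r} \<union> y ` {1..r}) N"
    and one: "\<one>\<^bsub>H\<^esub> \<in> N"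
  shows "N = carrier H"
proof -
  note D = H.stableD[OF N]
  let ?N = "{f \<in> carrier F. p f \<in> N}"
  have "?N = carrier F"
  proof (rule free.stable_eq_carrier[folded F_eq])
    show "stable_subgroup F ((\<lambda>a. word a []) ` carrier K) ?N"
    proof (rule stable_preimage[OF _ F.ring_axioms H.ring_axioms N])
      show "additive_map F H p" by (simp add: additive_map_def)
      have c: "word a [] \<in> carrier F" if "a \<in> carrier K" for a using that by (auto intro: word_closed)
      then show "(\<lambda>a. word a []) ` carrier K \<subseteq> carrier F" by blast
      fix v f assume "v \<in> (\<lambda>a. word a []) ` carrier K" "f \<in> carrier F"
      then obtain a where "a \<in> carrier K" "v = word a []" "f \<in> carrier F" by blast
      then show "\<exists>w\<in>h ` carrier K \<union> t ` {1..<r} \<union> x ` {1..r} \<union> y ` {1..r}. p (v \<otimes>\<^bsub>F\<^esub> f) = w \<otimes>\<^bsub>H\<^esub> p f"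
        using c by (intro bexI[of _ "h a"]) simp_all
    qed
    show "(\<lambda>a. word a \<one>\<^bsub>free_monoid (hecke_gens r)\<^esub>) ` carrier K \<subseteq> (\<lambda>a. word a []) ` carrier K"
      by (simp add: free_monoid_def)
    fix ws assume "ws \<in> carrier (free_monoid (hecke_gens r))"
    then have "ws \<in> lists (hecke_gens r)" by (simp add: free_monoid_def)
    then have "word \<one> ws \<in> carrier F \<and> p (word \<one> ws) \<in> N"
    proof (induction ws rule: lists.induct)
      case Nil
      then show ?case using one p.hom_one by (simp add: F_one[symmetric])
    next
      case (Cons g ws)
      have g: "word \<one> [g] \<in> carrier F" using Cons by (intro word_closed) auto
      have eq: "word \<one> (g # ws) = word \<one> [g] \<otimes>\<^bsub>F\<^esub> word \<one> ws"
        using Cons by (subst word_mult) auto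
      have "p (word \<one> [g]) \<in> h ` carrier K \<union> t ` {1..<r} \<union> x ` {1..r} \<union> y ` {1..r}"
        using \<open>g \<in> hecke_gens r\<close> unfolding hecke_gens_def by auto
      then have "p (word \<one> [g]) \<otimes>\<^bsub>H\<^esub> p (word \<one> ws) \<in> N" using Cons by (intro D(6)) auto
      then show ?case using g Cons unfolding eq by simp
    qed
    then show "word \<one> ws \<in> ?N" by blast
  qed
  then have "carrier H \<subseteq> N" unfolding H_carrier by blast
  then show ?thesis using D(1) by blast
qed

lemma bernstein: "bernstein_algebra H K h r q t x y"
proof -
  note rel_def = hecke_relations_def[of K r \<epsilon>, unfolded Let_def]
  have ii: "i \<in> {1..r}" "i + 1 \<in> {1..r}" if "i \<in> {1..<r}" for i using that by auto
  show ?thesis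
  proof (intro bernstein_algebra.intro bernstein_algebra_axioms.intro)
    show "ring H" by (rule H.ring_axioms)
    show "noetherian_ring K" by (rule K_noetherian)
    show "cring K" by (rule cring_axioms)
    show "h \<in> ring_hom K H" by (rule h_hom)
    show "h k \<otimes>\<^bsub>H\<^esub> a = a \<otimes>\<^bsub>H\<^esub> h k" if "k \<in> carrier K" "a \<in> carrier H" for k a
      using that by (rule h_central)
    show "q \<in> Units K" by (rule q_unit)
    show "t i \<in> carrier H" if "i \<in> {1..<r}" for i using gen_closed(1)[OF that] by simp
    show "x i \<in> carrier H" if "i \<in> {1..r}" for i using gen_closed(2)[OF that] by simp
    show "y i \<in> carrier H" if "i \<in> {1..r}" for i using gen_closed(3)[OF that] by simp
    show "(t i \<oplus>\<^bsub>H\<^esub> \<one>\<^bsub>H\<^esub>) \<otimes>\<^bsub>H\<^esub> (t i \<ominus>\<^bsub>H\<^esub> h q) = \<zero>\<^bsub>H\<^esub>" if i: "i \<in> {1..<r}" for i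
    proof -
      let ?e = "(word \<one> [GenT i] \<oplus>\<^bsub>F\<^esub> \<one>\<^bsub>F\<^esub>) \<otimes>\<^bsub>F\<^esub> (word \<one> [GenT i] \<ominus>\<^bsub>F\<^esub> word q [])"
      note c = gen_closed(1)[OF i] gen_closed(4)
      have "?e \<in> hecke_relations K r \<epsilon>" unfolding rel_def using i by blast
      then have "?e \<in> J" unfolding hecke_ideal_def using F.genideal_self[OF relations_closed] by blast
      then have "p ?e = \<zero>\<^bsub>H\<^esub>" by (rule p_eq_zero)
      then show ?thesis using c by (simp add: a_minus_def)
    qed
    show "t i \<otimes>\<^bsub>H\<^esub> t j = t j \<otimes>\<^bsub>H\<^esub> t i"
      if ij: "i \<in> {1..<r}" "j \<in> {1..<r}" "i + 1 < j \<or> j + 1 < i" for i j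
    proof -
      note c = gen_closed(1)[OF ij(1)] gen_closed(1)[OF ij(2)]
      have "p (word \<one> [GenT i] \<otimes>\<^bsub>F\<^esub> word \<one> [GenT j]) = p (word \<one> [GenT j] \<otimes>\<^bsub>F\<^esub> word \<one> [GenT i])"
        by (rule relation_holds) (unfold rel_def, use ij in blast, use c in simp_all)
      then show ?thesis using c by simp
    qed
    show "t i \<otimes>\<^bsub>H\<^esub> t (i + 1) \<otimes>\<^bsub>H\<^esub> t i = t (i + 1) \<otimes>\<^bsub>H\<^esub> t i \<otimes>\<^bsub>H\<^esub> t (i + 1)"
      if i: "i \<in> {1..<r}" "i + 1 \<in> {1..<r}" for i
    proof -
      note c = gen_closed(1)[OF i(1)] gen_closed(1)[OF i(2)]
      have "p (word \<one> [GenT i] \<otimes>\<^bsub>F\<^esub> word \<one> [GenT (i + 1)] \<otimes>\<^bsub>F\<^esub> word \<one> [GenT i]) =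
          p (word \<one> [GenT (i + 1)] \<otimes>\<^bsub>F\<^esub> word \<one> [GenT i] \<otimes>\<^bsub>F\<^esub> word \<one> [GenT (i + 1)])"
        by (rule relation_holds) (unfold rel_def, use i in blast, use c in simp_all)
      then show ?thesis using c by simp
    qed
    show "x i \<otimes>\<^bsub>H\<^esub> y i = \<one>\<^bsub>H\<^esub>" if i: "i \<in> {1..r}" for i
    proof -
      note c = gen_closed(2,3)[OF i]
      have "p (word \<one> [GenX i] \<otimes>\<^bsub>F\<^esub> word \<one> [GenXinv i]) = p \<one>\<^bsub>F\<^esub>"
        by (rule relation_holds) (unfold rel_def, use i in blast, use c in simp_all)
      then show ?thesis using c by simp
    qed
    show "y i \<otimes>\<^bsub>H\<^esub> x i = \<one>\<^bsub>H\<^esub>" if i: "i \<in> {1..r}" for i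
    proof -
      note c = gen_closed(2,3)[OF i]
      have "p (word \<one> [GenXinv i] \<otimes>\<^bsub>F\<^esub> word \<one> [GenX i]) = p \<one>\<^bsub>F\<^esub>"
        by (rule relation_holds) (unfold rel_def, use i in blast, use c in simp_all)
      then show ?thesis using c by simp
    qed
    show "x i \<otimes>\<^bsub>H\<^esub> x j = x j \<otimes>\<^bsub>H\<^esub> x i" if ij: "i \<in> {1..r}" "j \<in> {1..r}" for i j
    proof -
      note c = gen_closed(2)[OF ij(1)] gen_closed(2)[OF ij(2)]
      have "p (word \<one> [GenX i] \<otimes>\<^bsub>F\<^esub> word \<one> [GenX j]) = p (word \<one> [GenX j] \<otimes>\<^bsub>F\<^esub> word \<one> [GenX i])"
        by (rule relation_holds) (unfold rel_def, use ij in blast, use c in simp_all)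
      then show ?thesis using c by simp
    qed
    show "t i \<otimes>\<^bsub>H\<^esub> x i \<otimes>\<^bsub>H\<^esub> t i = h q \<otimes>\<^bsub>H\<^esub> x (i + 1)" if i: "i \<in> {1..<r}" for i
    proof -
      note c = gen_closed(1)[OF i] gen_closed(2)[OF ii(1)[OF i]] gen_closed(2)[OF ii(2)[OF i]] gen_closed(4)
      have "p (word \<one> [GenT i] \<otimes>\<^bsub>F\<^esub> word \<one> [GenX i] \<otimes>\<^bsub>F\<^esub> word \<one> [GenT i]) =
          p (word q [] \<otimes>\<^bsub>F\<^esub> word \<one> [GenX (i + 1)])"
        by (rule relation_holds) (unfold rel_def, use i in blast, use c in simp_all)
      then show ?thesis using c by simp
    qed
    show "x j \<otimes>\<^bsub>H\<^esub> t i = t i \<otimes>\<^bsub>H\<^esub> x j"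
      if ij: "i \<in> {1..<r}" "j \<in> {1..r}" "j \<noteq> i" "j \<noteq> i + 1" for i j
    proof -
      note c = gen_closed(1)[OF ij(1)] gen_closed(2)[OF ij(2)]
      have "p (word \<one> [GenX j] \<otimes>\<^bsub>F\<^esub> word \<one> [GenT i]) = p (word \<one> [GenT i] \<otimes>\<^bsub>F\<^esub> word \<one> [GenX j])"
        by (rule relation_holds) (unfold rel_def, use ij in blast, use c in simp_all)
      then show ?thesis using c by simp
    qed
    show "N = carrier H"
      if "stable_subgroup H (h ` carrier K \<union> t ` {1..<r} \<union> x ` {1..r} \<union> y ` {1..r}) N" "\<one>\<^bsub>H\<^esub> \<in> N" for N
      using that by (rule generated_by_generators)
  qed
qed

lemma hecke_noetherian_over_center:
  "\<exists>W. W \<subseteq> carrier H \<and> (\<forall>w\<in>W. \<forall>a\<in>carrier H. w \<otimes>\<^bsub>H\<^esub> a = a \<otimes>\<^bsub>H\<^esub> w) \<and>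
    noetherian_submodule H W (carrier H)"
  by (rule bernstein_algebra.noetherian_over_center[OF bernstein])

end

section \<open>Reduced expressions\<close>

text \<open>
  The element \<open>T\<^sub>w\<close> is the product along a chosen reduced expression of \<open>w\<close>. It lies in \<open>H\<close> because a
  reduced expression exists, that is, because adjacent transpositions generate the symmetric group.
\<close>

lemma word_perm_append: "word_perm (us @ vs) = word_perm us \<circ> word_perm vs"
  by (induction us) (auto simp: word_perm_def o_assoc)

lemma transpose_is_word:
  assumes "1 \<le> a" "a + d + 1 \<le> r"
  shows "\<exists>ks. set ks \<subseteq> {1..<r} \<and> word_perm ks = transpose a (a + d + 1)"
  using assms(2)
proof (induction d)
  case 0
  then show ?case using assms(1) by (intro exI[of _ "[a]"]) (simp add: word_perm_def)
next
  case (Suc d)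
  then obtain ks where ks: "set ks \<subseteq> {1..<r}" "word_perm ks = transpose a (a + d + 1)" by auto
  let ?b = "a + d + 1"
  have "word_perm ([?b] @ ks @ [?b]) = transpose ?b (?b + 1) \<circ> (transpose a ?b \<circ> transpose ?b (?b + 1))"
    unfolding word_perm_append ks(2) by (simp add: word_perm_def)
  also have "\<dots> = transpose a (?b + 1)"
    by (rule ext) (auto simp: transpose_def)
  finally show ?case using ks(1) Suc.prems assms(1) by (intro exI[of _ "[?b] @ ks @ [?b]"]) auto
qed

lemma permutation_is_word:
  assumes "w permutes {1..r}"
  shows "\<exists>ks. set ks \<subseteq> {1..<r} \<and> word_perm ks = w"
  using assms finite_atLeastAtMost
proof (induction w rule: permutes_induct)
  case id
  show ?case by (intro exI[of _ "[]"]) (simp add: word_perm_def)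
next
  case (swap a b w)
  then obtain ks where ks: "set ks \<subseteq> {1..<r}" "word_perm ks = w" by blast
  have "\<exists>ls. set ls \<subseteq> {1..<r} \<and> word_perm ls = transpose a b"
  proof (cases "a < b")
    case True
    then show ?thesis using transpose_is_word[of a "b - a - 1" r] swap.hyps by auto
  next
    case False
    then show ?thesis using transpose_is_word[of b "a - b - 1" r] swap.hyps by (auto simp: transpose_commute[of a b])
  qed
  then obtain ls where ls: "set ls \<subseteq> {1..<r}" "word_perm ls = transpose a b" by blast
  show ?case using ks ls by (intro exI[of _ "ls @ ks"]) (auto simp: word_perm_append)
qed

lemma reduced_expression_exists:
  assumes "w permutes {1..r}"
  shows "\<exists>ks. reduced_expression r w ks"
proof -
  obtain ks where "set ks \<subseteq> {1..<r} \<and> word_perm ks = w" using permutation_is_word[OF assms] by blast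
  from arg_min_natI[of "\<lambda>ks. set ks \<subseteq> {1..<r} \<and> word_perm ks = w", OF this]
    arg_min_nat_le[of "\<lambda>ks. set ks \<subseteq> {1..<r} \<and> word_perm ks = w"]
  show ?thesis unfolding reduced_expression_def by blast
qed

context affine_hecke_algebra
begin

lemma hecke_Tw_closed:
  assumes "w permutes {1..r}"
  shows "hecke_Tw K r \<epsilon> w \<in> carrier H"
proof -
  have *: "foldr (\<lambda>i a. hecke_T K r \<epsilon> i \<otimes>\<^bsub>H\<^esub> a) ks \<one>\<^bsub>H\<^esub> \<in> carrier H" if "set ks \<subseteq> {1..<r}" for ks
    using that
  proof (induction ks)
    case (Cons i ks)
    then have "hecke_T K r \<epsilon> i \<in> carrier H" using gen_closed(1)[of i] by (simp add: hecke_T_def)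
    then show ?case using Cons by simp
  qed simp
  have "set ks \<subseteq> {1..<r}" if "reduced_expression r w ks" for ks
    using that by (simp add: reduced_expression_def)
  from this[OF someI_ex[OF reduced_expression_exists[OF assms]]] show ?thesis
    unfolding hecke_Tw_def Let_def by (rule *)
qed

lemma hecke_x_closed:
  assumes "\<mu> \<in> compositions n r"
  shows "hecke_x K r \<epsilon> \<mu> \<in> carrier H"
  unfolding hecke_x_def
  using assms by (intro H.finsum_closed) (auto simp: compositions_def young_subgroup_def intro!: hecke_Tw_closed)

end

lemma finite_compositions: "finite (compositions n r)"
proof (rule finite_subset)
  show "compositions n r \<subseteq> {\<mu>. set \<mu> \<subseteq> {..r} \<and> length \<mu> = n}"
    by (auto simp: compositions_def member_le_sum_list)
qed (simp add: finite_lists_length_eq)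

section \<open>Endomorphisms of sums of right ideals\<close>

text \<open>
  Jointly injective maps \<open>\<pi>\<close> embed \<open>E\<close> in a finite power of the Noetherian module \<open>R\<close>, where \<open>w \<in> W\<close> acts on \<open>E\<close> as
  left multiplication by \<open>\<rho> w\<close>. The embedding filters \<open>N\<close> by the vanishing of the first \<open>k\<close> coordinates,
  and \<open>\<Psi> k N\<close> is the \<open>k\<close>-th coordinate of the \<open>k\<close>-th step of this filtration.
\<close>

lemma acc_if_embedded_in_power:
  assumes "ring E" "ring R" and W: "W \<subseteq> carrier R"
    and noeth: "noetherian_submodule R W (carrier R)"
    and maps: "\<And>\<pi>. \<pi> \<in> set \<pi>s \<Longrightarrow> additive_map E R \<pi>"
    and inj: "\<And>a. a \<in> carrier E \<Longrightarrow> (\<And>\<pi>. \<pi> \<in> set \<pi>s \<Longrightarrow> \<pi> a = \<zero>\<^bsub>R\<^esub>) \<Longrightarrow> a = \<zero>\<^bsub>E\<^esub>"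
    and \<rho>: "\<rho> ` W \<subseteq> carrier E"
    and equivariant: "\<And>\<pi> w a. \<pi> \<in> set \<pi>s \<Longrightarrow> w \<in> W \<Longrightarrow> a \<in> carrier E \<Longrightarrow>
      \<pi> (\<rho> w \<otimes>\<^bsub>E\<^esub> a) = w \<otimes>\<^bsub>R\<^esub> \<pi> a"
  shows "satisfies_acc {N. stable_subgroup E (\<rho> ` W) N}"
proof -
  interpret E: ring E by fact
  interpret R: ring R by fact
  note A = additive_mapD[OF maps \<open>ring E\<close> \<open>ring R\<close>]
  define \<Psi> where "\<Psi> k N = (\<pi>s ! k) ` {a \<in> N. \<forall>l<k. (\<pi>s ! l) a = \<zero>\<^bsub>R\<^esub>}" for k N
  have acc: "satisfies_acc (submodules R W (carrier R))"
    using noeth unfolding noetherian_submodule_def by blast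
  show ?thesis
  proof (rule satisfies_acc_jointly[where J = "{..<length \<pi>s}" and \<Psi> = \<Psi>, OF _ acc])
    fix k N assume k: "k \<in> {..<length \<pi>s}" and "N \<in> {N. stable_subgroup E (\<rho> ` W) N}"
    then have "stable_subgroup E (\<rho> ` W) N" by simp
    note D = E.stableD[OF this]
    let ?K = "{a \<in> N. \<forall>l<k. (\<pi>s ! l) a = \<zero>\<^bsub>R\<^esub>}"
    have l: "\<pi>s ! l \<in> set \<pi>s" if "l \<le> k" for l using that k by simp
    have "stable_subgroup E (\<rho> ` W) ?K"
    proof (rule E.stableI)
      show "?K \<subseteq> carrier E" using D(1) by blast
      show "\<zero>\<^bsub>E\<^esub> \<in> ?K" using D(2) A(3)[OF l] by simp
      fix a assume a: "a \<in> ?K"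
      then have c: "a \<in> carrier E" using D(1) by auto
      show "\<ominus>\<^bsub>E\<^esub> a \<in> ?K" using a D(4) A(4)[OF l c] by simp
      show "a \<oplus>\<^bsub>E\<^esub> b \<in> ?K" if b: "b \<in> ?K" for b
      proof -
        have "b \<in> carrier E" using b D(1) by auto
        then show ?thesis using a b D(3) A(2)[OF l c] by simp
      qed
      show "v \<otimes>\<^bsub>E\<^esub> a \<in> ?K" if v: "v \<in> \<rho> ` W" for v
      proof -
        obtain w where w: "w \<in> W" "v = \<rho> w" using v by blast
        then have "w \<in> carrier R" using W by blast
        then show ?thesis using a D(6)[of v a] w equivariant[OF l w(1) c] by simp
      qed
    qed
    then have "stable_subgroup R W ((\<pi>s ! k) ` ?K)"
    proof (rule stable_image[OF maps[OF l[OF order_refl]] \<open>ring E\<close> \<open>ring R\<close>])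
      show "\<exists>v\<in>\<rho> ` W. (\<pi>s ! k) (v \<otimes>\<^bsub>E\<^esub> a) = w \<otimes>\<^bsub>R\<^esub> (\<pi>s ! k) a" if "w \<in> W" "a \<in> ?K" for w a
        using that equivariant[OF l[OF order_refl], of w a] D(1) by blast
    qed
    then show "\<Psi> k N \<in> submodules R W (carrier R)"
      unfolding \<Psi>_def using R.stableD(1) by blast
  next
    show "\<Psi> k N \<subseteq> \<Psi> k N'" if "N \<subseteq> N'" for k N N' using that unfolding \<Psi>_def by blast
  next
    fix N N' assume N: "N \<in> {N. stable_subgroup E (\<rho> ` W) N}" "N' \<in> {N. stable_subgroup E (\<rho> ` W) N}"
      and "N \<subseteq> N'" and eq: "\<And>k. k \<in> {..<length \<pi>s} \<Longrightarrow> \<Psi> k N = \<Psi> k N'"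
    have st: "stable_subgroup E (\<rho> ` W) N" "stable_subgroup E (\<rho> ` W) N'" using N by simp_all
    note D = E.stableD[OF st(1)] and D' = E.stableD[OF st(2)]
    have "N' \<subseteq> N"
    proof
      fix a assume a: "a \<in> N'"
      then have ac: "a \<in> carrier E" using D'(1) by blast
      have "\<exists>b\<in>N. \<forall>l<k. (\<pi>s ! l) (a \<ominus>\<^bsub>E\<^esub> b) = \<zero>\<^bsub>R\<^esub>" if "k \<le> length \<pi>s" for k
        using that
      proof (induction k)
        case 0 show ?case using D(2) by blast
      next
        case (Suc k)
        then obtain b where b: "b \<in> N" "\<forall>l<k. (\<pi>s ! l) (a \<ominus>\<^bsub>E\<^esub> b) = \<zero>\<^bsub>R\<^esub>" by auto
        have bc: "b \<in> carrier E" using b D(1) by blast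
        have "a \<ominus>\<^bsub>E\<^esub> b \<in> N'" using D'(5) a b \<open>N \<subseteq> N'\<close> by blast
        then have "(\<pi>s ! k) (a \<ominus>\<^bsub>E\<^esub> b) \<in> \<Psi> k N'" using b(2) unfolding \<Psi>_def by blast
        then have "(\<pi>s ! k) (a \<ominus>\<^bsub>E\<^esub> b) \<in> \<Psi> k N" using eq[of k] Suc.prems by simp
        then obtain c where c: "c \<in> N" "\<forall>l<k. (\<pi>s ! l) c = \<zero>\<^bsub>R\<^esub>" "(\<pi>s ! k) c = (\<pi>s ! k) (a \<ominus>\<^bsub>E\<^esub> b)"
          unfolding \<Psi>_def by auto
        have cc: "c \<in> carrier E" using c D(1) by blast
        have abc: "a \<ominus>\<^bsub>E\<^esub> (b \<oplus>\<^bsub>E\<^esub> c) = (a \<ominus>\<^bsub>E\<^esub> b) \<ominus>\<^bsub>E\<^esub> c"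
          using ac bc cc by (simp add: a_minus_def E.minus_add E.a_assoc)
        have "(\<pi>s ! l) (a \<ominus>\<^bsub>E\<^esub> (b \<oplus>\<^bsub>E\<^esub> c)) = \<zero>\<^bsub>R\<^esub>" if "l < Suc k" for l
        proof -
          have l: "\<pi>s ! l \<in> set \<pi>s" using that Suc.prems by simp
          have "(\<pi>s ! l) c = (\<pi>s ! l) (a \<ominus>\<^bsub>E\<^esub> b)" using that b(2) c(2,3) by (cases "l = k") auto
          then show ?thesis
            unfolding abc using A(5)[OF l, of "a \<ominus>\<^bsub>E\<^esub> b" c] A(1)[OF l cc] ac bc cc
            by (simp add: a_minus_def R.r_neg)
        qed
        moreover have "b \<oplus>\<^bsub>E\<^esub> c \<in> N" using D(3) b c by blast
        ultimately show ?case by blast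
      qed
      from this[of "length \<pi>s"] obtain b where b: "b \<in> N" "\<forall>l<length \<pi>s. (\<pi>s ! l) (a \<ominus>\<^bsub>E\<^esub> b) = \<zero>\<^bsub>R\<^esub>"
        by blast
      have bc: "b \<in> carrier E" using b D(1) by blast
      have "a \<ominus>\<^bsub>E\<^esub> b = \<zero>\<^bsub>E\<^esub>"
        using b(2) ac bc by (intro inj) (auto simp: in_set_conv_nth)
      then have "a = b" using ac bc by (simp add: E.r_right_minus_eq)
      then show "a \<in> N" using b by simp
    qed
    then show "N = N'" using \<open>N \<subseteq> N'\<close> by blast
  qed simp
qed

text \<open>
  As \<open>C\<close> is central, a right ideal is closed under left multiplication by \<open>C\<close> too, and one chain
  condition serves both sides.
\<close>

lemma (in ring) one_sided_noetherian_if_central_acc: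
  assumes C: "C \<subseteq> carrier R" and central: "\<And>c a. c \<in> C \<Longrightarrow> a \<in> carrier R \<Longrightarrow> c \<otimes> a = a \<otimes> c"
    and acc: "satisfies_acc {N. stable_subgroup R C N}"
  shows "left_noetherian_ring R" "right_noetherian_ring R"
proof -
  have left: "stable_subgroup R C I" if "left_ideal I R" for I
    using that C unfolding left_ideal_def stable_subgroup_def by blast
  have right: "stable_subgroup R C I" if "right_ideal I R" for I
  proof -
    have "additive_subgroup I R" "\<And>a x. a \<in> I \<Longrightarrow> x \<in> carrier R \<Longrightarrow> a \<otimes> x \<in> I"
      using that unfolding right_ideal_def by auto
    moreover have "c \<otimes> a \<in> I" if "c \<in> C" "a \<in> I" for c a
    proof -
      have "a \<in> carrier R" using additive_subgroupD(1)[OF \<open>additive_subgroup I R\<close>] that by blast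
      then have "c \<otimes> a = a \<otimes> c" using central that by blast
      then show ?thesis using calculation(2) that C by auto
    qed
    ultimately show ?thesis unfolding stable_subgroup_def by blast
  qed
  have additive_Inter: "additive_subgroup (\<Inter>S) R"
    if "S \<noteq> {}" "\<And>I. I \<in> S \<Longrightarrow> additive_subgroup I R" for S
    using stable_Inter[of S "{}"] that unfolding stable_subgroup_def by auto
  show "left_noetherian_ring R"
  proof (unfold_locales)
    fix I assume I: "left_ideal I R"
    have "satisfies_acc {I. left_ideal I R}" using acc by (rule satisfies_acc_subset) (use left in auto)
    then have "\<exists>A\<subseteq>I. finite A \<and> I = \<Inter>{J. left_ideal J R \<and> A \<subseteq> J}"
      by (rule satisfies_acc_imp_finitely_generated[where P = "\<lambda>I. left_ideal I R", OF _ _ I])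
        (auto simp: left_ideal_def intro!: additive_Inter)
    moreover have "I \<subseteq> carrier R" using I additive_subgroupD(1) unfolding left_ideal_def by blast
    ultimately show "\<exists>A\<subseteq>carrier R. finite A \<and> I = \<Inter>{J. left_ideal J R \<and> A \<subseteq> J}" by blast
  qed
  show "right_noetherian_ring R"
  proof (unfold_locales)
    fix I assume I: "right_ideal I R"
    have "satisfies_acc {I. right_ideal I R}" using acc by (rule satisfies_acc_subset) (use right in auto)
    then have "\<exists>A\<subseteq>I. finite A \<and> I = \<Inter>{J. right_ideal J R \<and> A \<subseteq> J}"
      by (rule satisfies_acc_imp_finitely_generated[where P = "\<lambda>I. right_ideal I R", OF _ _ I])
        (auto simp: right_ideal_def intro!: additive_Inter)
    moreover have "I \<subseteq> carrier R" using I additive_subgroupD(1) unfolding right_ideal_def by blast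
    ultimately show "\<exists>A\<subseteq>carrier R. finite A \<and> I = \<Inter>{J. right_ideal J R \<and> A \<subseteq> J}" by blast
  qed
qed

text \<open>What makes \<open>right_module_End\<close> a ring is that the operators act additively on an abelian group.\<close>

locale right_action =
  fixes H :: "('h, 'c) ring_scheme" and M :: "('h, 'm, 'd) module_scheme"
  assumes M_group: "abelian_group M"
    and smult_closed: "\<And>h m. h \<in> carrier H \<Longrightarrow> m \<in> carrier M \<Longrightarrow> h \<odot>\<^bsub>M\<^esub> m \<in> carrier M"
    and smult_add: "\<And>h m m'. h \<in> carrier H \<Longrightarrow> m \<in> carrier M \<Longrightarrow> m' \<in> carrier M \<Longrightarrow>
      h \<odot>\<^bsub>M\<^esub> (m \<oplus>\<^bsub>M\<^esub> m') = h \<odot>\<^bsub>M\<^esub> m \<oplus>\<^bsub>M\<^esub> h \<odot>\<^bsub>M\<^esub> m'"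
begin

sublocale M: abelian_group M by (rule M_group)

abbreviation E :: "('m \<Rightarrow> 'm) ring" where "E \<equiv> right_module_End H M"

lemma End_iff: "\<phi> \<in> carrier E \<longleftrightarrow> \<phi> \<in> carrier M \<rightarrow>\<^sub>E carrier M \<and>
    (\<forall>m\<in>carrier M. \<forall>m'\<in>carrier M. \<phi> (m \<oplus>\<^bsub>M\<^esub> m') = \<phi> m \<oplus>\<^bsub>M\<^esub> \<phi> m') \<and>
    (\<forall>h\<in>carrier H. \<forall>m\<in>carrier M. \<phi> (h \<odot>\<^bsub>M\<^esub> m) = h \<odot>\<^bsub>M\<^esub> \<phi> m)"
  by (simp add: right_module_End_def)

lemma End_closed: "\<phi> \<in> carrier E \<Longrightarrow> m \<in> carrier M \<Longrightarrow> \<phi> m \<in> carrier M"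
  and End_add: "\<phi> \<in> carrier E \<Longrightarrow> m \<in> carrier M \<Longrightarrow> m' \<in> carrier M \<Longrightarrow> \<phi> (m \<oplus>\<^bsub>M\<^esub> m') = \<phi> m \<oplus>\<^bsub>M\<^esub> \<phi> m'"
  and End_smult: "\<phi> \<in> carrier E \<Longrightarrow> h \<in> carrier H \<Longrightarrow> m \<in> carrier M \<Longrightarrow> \<phi> (h \<odot>\<^bsub>M\<^esub> m) = h \<odot>\<^bsub>M\<^esub> \<phi> m"
  by (auto simp: End_iff)

lemma End_eqI:
  assumes "\<phi> \<in> carrier E" "\<psi> \<in> carrier E" "\<And>m. m \<in> carrier M \<Longrightarrow> \<phi> m = \<psi> m"
  shows "\<phi> = \<psi>"
proof (rule PiE_ext)
  show "\<phi> \<in> carrier M \<rightarrow>\<^sub>E carrier M" "\<psi> \<in> carrier M \<rightarrow>\<^sub>E carrier M"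
    using assms(1,2) unfolding End_iff by blast+
qed (rule assms(3))

lemma E_add: "\<phi> \<oplus>\<^bsub>E\<^esub> \<psi> = (\<lambda>m\<in>carrier M. \<phi> m \<oplus>\<^bsub>M\<^esub> \<psi> m)"
  and E_zero: "\<zero>\<^bsub>E\<^esub> = (\<lambda>m\<in>carrier M. \<zero>\<^bsub>M\<^esub>)"
  and E_mult: "\<phi> \<otimes>\<^bsub>E\<^esub> \<psi> = (\<lambda>m\<in>carrier M. \<phi> (\<psi> m))"
  and E_one: "\<one>\<^bsub>E\<^esub> = (\<lambda>m\<in>carrier M. m)"
  by (simp_all add: right_module_End_def compose_def)

lemma End_zero: "\<phi> \<in> carrier E \<Longrightarrow> \<phi> \<zero>\<^bsub>M\<^esub> = \<zero>\<^bsub>M\<^esub>"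
  using End_add[of \<phi> "\<zero>\<^bsub>M\<^esub>" "\<zero>\<^bsub>M\<^esub>"] End_closed[of \<phi> "\<zero>\<^bsub>M\<^esub>"] by (simp add: M.add.r_cancel_one')

lemma smult_zero: "h \<in> carrier H \<Longrightarrow> h \<odot>\<^bsub>M\<^esub> \<zero>\<^bsub>M\<^esub> = \<zero>\<^bsub>M\<^esub>"
  using smult_add[of h "\<zero>\<^bsub>M\<^esub>" "\<zero>\<^bsub>M\<^esub>"] smult_closed[of h "\<zero>\<^bsub>M\<^esub>"] by (simp add: M.add.r_cancel_one')

lemma smult_minus: "h \<in> carrier H \<Longrightarrow> m \<in> carrier M \<Longrightarrow> h \<odot>\<^bsub>M\<^esub> (\<ominus>\<^bsub>M\<^esub> m) = \<ominus>\<^bsub>M\<^esub> (h \<odot>\<^bsub>M\<^esub> m)"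
  using smult_add[of h "\<ominus>\<^bsub>M\<^esub> m" m] smult_zero[of h]
  by (intro M.minus_equality[symmetric]) (simp_all add: M.l_neg smult_closed)

lemma E_add_closed: "\<phi> \<in> carrier E \<Longrightarrow> \<psi> \<in> carrier E \<Longrightarrow> \<phi> \<oplus>\<^bsub>E\<^esub> \<psi> \<in> carrier E"
  unfolding E_add
  by (subst End_iff) (simp add: End_closed End_add End_smult smult_closed smult_add M.a_ac)

lemma E_zero_closed: "\<zero>\<^bsub>E\<^esub> \<in> carrier E"
  unfolding E_zero by (subst End_iff) (simp add: smult_closed smult_zero)

lemma E_mult_closed: "\<phi> \<in> carrier E \<Longrightarrow> \<psi> \<in> carrier E \<Longrightarrow> \<phi> \<otimes>\<^bsub>E\<^esub> \<psi> \<in> carrier E"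
  unfolding E_mult by (subst End_iff) (simp add: End_closed End_add End_smult smult_closed)

lemma E_one_closed: "\<one>\<^bsub>E\<^esub> \<in> carrier E"
  unfolding E_one by (subst End_iff) (simp add: smult_closed)

lemma E_uminus_closed: "\<phi> \<in> carrier E \<Longrightarrow> (\<lambda>m\<in>carrier M. \<ominus>\<^bsub>M\<^esub> \<phi> m) \<in> carrier E"
  by (subst End_iff) (simp add: End_closed End_add End_smult smult_closed smult_minus M.minus_add)

lemma ring_End: "ring E"
proof (rule ringI)
  show "abelian_group E"
  proof (rule abelian_groupI)
    fix \<phi> assume \<phi>: "\<phi> \<in> carrier E"
    show "\<exists>\<psi>\<in>carrier E. \<psi> \<oplus>\<^bsub>E\<^esub> \<phi> = \<zero>\<^bsub>E\<^esub>"
    proof (rule bexI[OF _ E_uminus_closed[OF \<phi>]])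
      show "(\<lambda>m\<in>carrier M. \<ominus>\<^bsub>M\<^esub> \<phi> m) \<oplus>\<^bsub>E\<^esub> \<phi> = \<zero>\<^bsub>E\<^esub>"
        using \<phi> by (intro End_eqI E_add_closed E_zero_closed E_uminus_closed)
          (simp_all add: E_add E_zero End_closed M.l_neg)
    qed
    show "\<zero>\<^bsub>E\<^esub> \<oplus>\<^bsub>E\<^esub> \<phi> = \<phi>"
      using \<phi> by (intro End_eqI E_add_closed E_zero_closed) (simp_all add: E_add E_zero End_closed)
    fix \<psi> assume \<psi>: "\<psi> \<in> carrier E"
    show "\<phi> \<oplus>\<^bsub>E\<^esub> \<psi> = \<psi> \<oplus>\<^bsub>E\<^esub> \<phi>"
      using \<phi> \<psi> by (intro End_eqI E_add_closed) (simp_all add: E_add End_closed M.a_comm)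
    fix \<chi> assume \<chi>: "\<chi> \<in> carrier E"
    show "\<phi> \<oplus>\<^bsub>E\<^esub> \<psi> \<oplus>\<^bsub>E\<^esub> \<chi> = \<phi> \<oplus>\<^bsub>E\<^esub> (\<psi> \<oplus>\<^bsub>E\<^esub> \<chi>)"
      using \<phi> \<psi> \<chi> by (intro End_eqI E_add_closed) (simp_all add: E_add End_closed M.a_assoc)
  qed (simp_all only: E_add_closed E_zero_closed)
  show "monoid E"
  proof (rule monoidI)
    fix \<phi> assume \<phi>: "\<phi> \<in> carrier E"
    show "\<one>\<^bsub>E\<^esub> \<otimes>\<^bsub>E\<^esub> \<phi> = \<phi>" "\<phi> \<otimes>\<^bsub>E\<^esub> \<one>\<^bsub>E\<^esub> = \<phi>"
      using \<phi> by (intro End_eqI E_mult_closed E_one_closed; simp add: E_mult E_one End_closed)+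
    fix \<psi> \<chi> assume "\<psi> \<in> carrier E" "\<chi> \<in> carrier E"
    then show "\<phi> \<otimes>\<^bsub>E\<^esub> \<psi> \<otimes>\<^bsub>E\<^esub> \<chi> = \<phi> \<otimes>\<^bsub>E\<^esub> (\<psi> \<otimes>\<^bsub>E\<^esub> \<chi>)"
      using \<phi> by (intro End_eqI E_mult_closed) (simp_all add: E_mult End_closed)
  qed (simp_all only: E_mult_closed E_one_closed)
  fix \<phi> \<psi> \<chi> assume c: "\<phi> \<in> carrier E" "\<psi> \<in> carrier E" "\<chi> \<in> carrier E"
  then show "(\<phi> \<oplus>\<^bsub>E\<^esub> \<psi>) \<otimes>\<^bsub>E\<^esub> \<chi> = \<phi> \<otimes>\<^bsub>E\<^esub> \<chi> \<oplus>\<^bsub>E\<^esub> \<psi> \<otimes>\<^bsub>E\<^esub> \<chi>"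
    by (intro End_eqI E_mult_closed E_add_closed) (simp_all add: E_mult E_add End_closed)
  show "\<chi> \<otimes>\<^bsub>E\<^esub> (\<phi> \<oplus>\<^bsub>E\<^esub> \<psi>) = \<chi> \<otimes>\<^bsub>E\<^esub> \<phi> \<oplus>\<^bsub>E\<^esub> \<chi> \<otimes>\<^bsub>E\<^esub> \<psi>"
    using c by (intro End_eqI E_mult_closed E_add_closed) (simp_all add: E_mult E_add End_closed End_add)
qed

end

locale finite_right_ideal_sum = ring H for H :: "('h, 'c) ring_scheme" (structure) +
  fixes I :: "'i set" and x :: "'i \<Rightarrow> 'h"
  assumes finite_I: "finite I" and x_closed: "\<And>i. i \<in> I \<Longrightarrow> x i \<in> carrier H"
begin

abbreviation M :: "('h, 'i \<Rightarrow> 'h) module" where "M \<equiv> right_ideal_sum H I x"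

lemma M_carrier: "m \<in> carrier M \<longleftrightarrow> m \<in> extensional I \<and> (\<forall>i\<in>I. \<exists>h\<in>carrier H. m i = x i \<otimes> h)"
  by (auto simp: right_ideal_sum_def l_coset_def PiE_def Pi_def)

lemma M_add: "m \<oplus>\<^bsub>M\<^esub> m' = (\<lambda>i\<in>I. m i \<oplus> m' i)"
  and M_zero: "\<zero>\<^bsub>M\<^esub> = (\<lambda>i\<in>I. \<zero>)"
  and M_smult: "h \<odot>\<^bsub>M\<^esub> m = (\<lambda>i\<in>I. m i \<otimes> h)"
  by (simp_all add: right_ideal_sum_def)

lemma M_coord: "m \<in> carrier M \<Longrightarrow> i \<in> I \<Longrightarrow> m i \<in> carrier H"
  using x_closed unfolding M_carrier by (metis m_closed)

lemma M_eqI: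
  "m \<in> extensional I \<Longrightarrow> m' \<in> extensional I \<Longrightarrow> (\<And>i. i \<in> I \<Longrightarrow> m i = m' i) \<Longrightarrow> m = m'"
  by (rule extensionalityI)

lemma M_ext: "m \<in> carrier M \<Longrightarrow> m \<in> extensional I"
  unfolding M_carrier by blast

lemma M_I:
  assumes "\<And>i. i \<in> I \<Longrightarrow> \<exists>h\<in>carrier H. f i = x i \<otimes> h"
  shows "(\<lambda>i\<in>I. f i) \<in> carrier M"
  unfolding M_carrier using assms by simp

lemma M_coord_multiple: "m \<in> carrier M \<Longrightarrow> i \<in> I \<Longrightarrow> \<exists>h\<in>carrier H. m i = x i \<otimes> h"
  unfolding M_carrier by blast

lemma M_right_action: "right_action H M"
proof (rule right_action.intro)
  have add: "m \<oplus>\<^bsub>M\<^esub> m' \<in> carrier M" if mm': "m \<in> carrier M" "m' \<in> carrier M" for m m'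
    unfolding M_add
  proof (rule M_I)
    fix i assume i: "i \<in> I"
    obtain h h' where "h \<in> carrier H" "h' \<in> carrier H" "m i = x i \<otimes> h" "m' i = x i \<otimes> h'"
      using M_coord_multiple[OF mm'(1) i] M_coord_multiple[OF mm'(2) i] by blast
    then show "\<exists>h\<in>carrier H. m i \<oplus> m' i = x i \<otimes> h"
      using x_closed[OF i] by (intro bexI[of _ "h \<oplus> h'"]) (simp_all add: r_distr)
  qed
  have zero: "\<zero>\<^bsub>M\<^esub> \<in> carrier M"
    unfolding M_zero using x_closed by (intro M_I bexI[of _ \<zero>]) auto
  show "abelian_group M"
  proof (rule abelian_groupI)
    fix m assume m: "m \<in> carrier M"
    show "\<zero>\<^bsub>M\<^esub> \<oplus>\<^bsub>M\<^esub> m = m"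
      using m by (intro M_eqI) (auto simp: M_add M_zero M_coord M_ext)
    have "(\<lambda>i\<in>I. \<ominus> m i) \<in> carrier M"
    proof (rule M_I)
      fix i assume i: "i \<in> I"
      obtain h where "h \<in> carrier H" "m i = x i \<otimes> h" using M_coord_multiple[OF m i] by blast
      then show "\<exists>h\<in>carrier H. \<ominus> m i = x i \<otimes> h"
        using x_closed[OF i] by (intro bexI[of _ "\<ominus> h"]) (simp_all add: r_minus)
    qed
    moreover have "(\<lambda>i\<in>I. \<ominus> m i) \<oplus>\<^bsub>M\<^esub> m = \<zero>\<^bsub>M\<^esub>"
      using m by (intro M_eqI) (auto simp: M_add M_zero M_coord l_neg)
    ultimately show "\<exists>m'\<in>carrier M. m' \<oplus>\<^bsub>M\<^esub> m = \<zero>\<^bsub>M\<^esub>" by blast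
    fix m' assume m': "m' \<in> carrier M"
    show "m \<oplus>\<^bsub>M\<^esub> m' = m' \<oplus>\<^bsub>M\<^esub> m"
      using m m' by (intro M_eqI) (auto simp: M_add M_coord a_comm)
    fix m'' assume m'': "m'' \<in> carrier M"
    show "m \<oplus>\<^bsub>M\<^esub> m' \<oplus>\<^bsub>M\<^esub> m'' = m \<oplus>\<^bsub>M\<^esub> (m' \<oplus>\<^bsub>M\<^esub> m'')"
      using m m' m'' by (intro M_eqI) (auto simp: M_add M_coord a_assoc)
  qed (simp_all only: add zero)
  show "h \<odot>\<^bsub>M\<^esub> m \<in> carrier M" if h: "h \<in> carrier H" and m: "m \<in> carrier M" for h m
    unfolding M_smult
  proof (rule M_I)
    fix i assume i: "i \<in> I"
    obtain g where "g \<in> carrier H" "m i = x i \<otimes> g" using M_coord_multiple[OF m i] by blast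
    then show "\<exists>g\<in>carrier H. m i \<otimes> h = x i \<otimes> g"
      using x_closed[OF i] h by (intro bexI[of _ "g \<otimes> h"]) (simp_all add: m_assoc)
  qed
  show "h \<odot>\<^bsub>M\<^esub> (m \<oplus>\<^bsub>M\<^esub> m') = h \<odot>\<^bsub>M\<^esub> m \<oplus>\<^bsub>M\<^esub> h \<odot>\<^bsub>M\<^esub> m'"
    if "h \<in> carrier H" "m \<in> carrier M" "m' \<in> carrier M" for h m m'
    using that by (intro M_eqI) (auto simp: M_smult M_add M_coord l_distr)
qed

sublocale act: right_action H M by (rule M_right_action)

definition gen :: "'i \<Rightarrow> 'i \<Rightarrow> 'h" where
  "gen j = (\<lambda>i\<in>I. if i = j then x j else \<zero>)"

lemma gen_closed: "gen j \<in> carrier M"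
  unfolding gen_def
proof (rule M_I)
  fix i assume i: "i \<in> I"
  then show "\<exists>h\<in>carrier H. (if i = j then x j else \<zero>) = x i \<otimes> h"
    using x_closed[OF i] by (intro bexI[of _ "if i = j then \<one> else \<zero>"]) auto
qed

text \<open>
  The elements \<open>gen j\<close> generate the module: split off one coordinate \<open>m j = x j h\<close> after the other.
\<close>

lemma End_eq_zero:
  assumes \<phi>: "\<phi> \<in> carrier act.E" and gen: "\<And>j. j \<in> I \<Longrightarrow> \<phi> (gen j) = \<zero>\<^bsub>M\<^esub>"
  shows "\<phi> = \<zero>\<^bsub>act.E\<^esub>"
proof (rule act.End_eqI[OF \<phi> act.E_zero_closed])
  have vanish: "\<phi> m = \<zero>\<^bsub>M\<^esub>" if "finite J" "J \<subseteq> I" "m \<in> carrier M" "\<And>i. i \<in> I - J \<Longrightarrow> m i = \<zero>" for m J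
    using that
  proof (induction J arbitrary: m rule: finite_induct)
    case empty
    then have "m = \<zero>\<^bsub>M\<^esub>" by (intro M_eqI) (auto simp: M_zero M_ext)
    then show ?case using act.End_zero[OF \<phi>] by simp
  next
    case (insert j J)
    then have j: "j \<in> I" by simp
    obtain h where h: "h \<in> carrier H" "m j = x j \<otimes> h"
      using M_coord_multiple[OF insert.prems(2) j] by blast
    define m' where "m' = (\<lambda>i\<in>I. if i = j then \<zero> else m i)"
    have m': "m' \<in> carrier M"
      unfolding m'_def
    proof (rule M_I)
      fix i assume i: "i \<in> I"
      show "\<exists>h\<in>carrier H. (if i = j then \<zero> else m i) = x i \<otimes> h"
        using M_coord_multiple[OF insert.prems(2) i] x_closed[OF i] by (cases "i = j") (auto intro!: bexI[of _ \<zero>])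
    qed
    have "m = h \<odot>\<^bsub>M\<^esub> gen j \<oplus>\<^bsub>M\<^esub> m'"
      using insert.prems(2) h x_closed[OF j]
      by (intro M_eqI) (auto simp: M_smult M_add gen_def m'_def M_coord M_ext)
    then have "\<phi> m = \<phi> (h \<odot>\<^bsub>M\<^esub> gen j) \<oplus>\<^bsub>M\<^esub> \<phi> m'"
      using act.End_add[OF \<phi> act.smult_closed[OF h(1) gen_closed] m'] by simp
    moreover have "\<phi> (h \<odot>\<^bsub>M\<^esub> gen j) = \<zero>\<^bsub>M\<^esub>"
      using act.End_smult[OF \<phi> h(1) gen_closed] gen[OF j] act.smult_zero[OF h(1)] by simp
    moreover have "\<phi> m' = \<zero>\<^bsub>M\<^esub>"
      using insert.prems by (intro insert.IH m') (auto simp: m'_def)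
    ultimately show ?case by simp
  qed
  show "\<phi> m = \<zero>\<^bsub>act.E\<^esub> m" if m: "m \<in> carrier M" for m
    using vanish[OF finite_I subset_refl m] m by (simp add: act.E_zero)
qed

text \<open>
  A central element \<open>w\<close> acts on the module by the endomorphism \<open>\<rho> w\<close>, which commutes with all others.
  The coordinates of the embedding are the matrix entries \<open>\<phi> \<mapsto> \<phi> (gen j) i\<close>.
\<close>

theorem End_noetherian:
  assumes W: "W \<subseteq> carrier H" and central: "\<And>w a. w \<in> W \<Longrightarrow> a \<in> carrier H \<Longrightarrow> w \<otimes> a = a \<otimes> w"
    and noeth: "noetherian_submodule H W (carrier H)"
  shows "left_noetherian_ring act.E" "right_noetherian_ring act.E"
proof -
  interpret E: ring act.E by (rule act.ring_End)
  define \<rho> where "\<rho> w = (\<lambda>m\<in>carrier M. w \<odot>\<^bsub>M\<^esub> m)" for w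
  have wc: "w \<in> carrier H" if "w \<in> W" for w using W that by blast
  have smult_comm: "w \<odot>\<^bsub>M\<^esub> (h \<odot>\<^bsub>M\<^esub> m) = h \<odot>\<^bsub>M\<^esub> (w \<odot>\<^bsub>M\<^esub> m)"
    if "w \<in> W" "h \<in> carrier H" "m \<in> carrier M" for w h m
    using that central wc by (intro M_eqI) (auto simp: M_smult M_coord m_assoc)
  have \<rho>_closed: "\<rho> w \<in> carrier act.E" if "w \<in> W" for w
    unfolding \<rho>_def
    by (subst act.End_iff) (use that wc in \<open>simp add: act.smult_closed act.smult_add smult_comm\<close>)
  have \<rho>_central: "\<rho> w \<otimes>\<^bsub>act.E\<^esub> \<phi> = \<phi> \<otimes>\<^bsub>act.E\<^esub> \<rho> w" if "w \<in> W" "\<phi> \<in> carrier act.E" for w \<phi>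
  proof (rule act.End_eqI)
    show "\<rho> w \<otimes>\<^bsub>act.E\<^esub> \<phi> \<in> carrier act.E" "\<phi> \<otimes>\<^bsub>act.E\<^esub> \<rho> w \<in> carrier act.E"
      using that \<rho>_closed by auto
    show "(\<rho> w \<otimes>\<^bsub>act.E\<^esub> \<phi>) m = (\<phi> \<otimes>\<^bsub>act.E\<^esub> \<rho> w) m" if "m \<in> carrier M" for m
      using that \<open>w \<in> W\<close> \<open>\<phi> \<in> carrier act.E\<close> wc
      by (simp add: act.E_mult \<rho>_def act.End_closed act.End_smult act.smult_closed)
  qed
  obtain ps where ps: "set ps = I \<times> I" using finite_list[of "I \<times> I"] finite_I by auto
  define \<pi>s :: "((('i \<Rightarrow> 'h) \<Rightarrow> 'i \<Rightarrow> 'h) \<Rightarrow> 'h) list" where "\<pi>s = map (\<lambda>(j, i) \<phi>. \<phi> (gen j) i) ps"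
  have \<pi>s: "\<pi> \<in> set \<pi>s \<longleftrightarrow> (\<exists>j\<in>I. \<exists>i\<in>I. \<pi> = (\<lambda>\<phi>. \<phi> (gen j) i))" for \<pi>
    using ps by (auto simp: \<pi>s_def)
  have acc: "satisfies_acc {N. stable_subgroup act.E (\<rho> ` W) N}"
  proof (rule acc_if_embedded_in_power[OF E.ring_axioms ring_axioms W noeth])
    fix \<pi> assume "\<pi> \<in> set \<pi>s"
    then obtain j i where ji: "j \<in> I" "i \<in> I" and \<pi>: "\<pi> = (\<lambda>\<phi>. \<phi> (gen j) i)" by (auto simp: \<pi>s)
    show "additive_map act.E H \<pi>"
      unfolding additive_map_def \<pi>
    proof (intro conjI ballI funcsetI)
      show "\<phi> (gen j) i \<in> carrier H" if "\<phi> \<in> carrier act.E" for \<phi>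
        by (rule M_coord[OF act.End_closed[OF that gen_closed] ji(2)])
      show "(\<phi> \<oplus>\<^bsub>act.E\<^esub> \<psi>) (gen j) i = \<phi> (gen j) i \<oplus> \<psi> (gen j) i" for \<phi> \<psi>
        using ji by (simp add: act.E_add gen_closed M_add)
    qed
    show "\<pi> (\<rho> w \<otimes>\<^bsub>act.E\<^esub> \<phi>) = w \<otimes> \<pi> \<phi>" if w: "w \<in> W" and \<phi>: "\<phi> \<in> carrier act.E" for w \<phi>
    proof -
      have "\<phi> (gen j) \<in> carrier M" by (rule act.End_closed[OF \<phi> gen_closed])
      then show ?thesis
        using ji w central[OF w] by (simp add: \<pi> act.E_mult \<rho>_def gen_closed M_smult M_coord)
    qed
  next
    fix \<phi> assume \<phi>: "\<phi> \<in> carrier act.E" and zero: "\<And>\<pi>. \<pi> \<in> set \<pi>s \<Longrightarrow> \<pi> \<phi> = \<zero>"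
    show "\<phi> = \<zero>\<^bsub>act.E\<^esub>"
    proof (rule End_eq_zero[OF \<phi>])
      fix j assume j: "j \<in> I"
      have "\<phi> (gen j) i = \<zero>" if "i \<in> I" for i
        using zero[of "\<lambda>\<phi>. \<phi> (gen j) i"] j that unfolding \<pi>s by blast
      then show "\<phi> (gen j) = \<zero>\<^bsub>M\<^esub>"
        using act.End_closed[OF \<phi> gen_closed] by (intro M_eqI) (auto simp: M_zero M_ext)
    qed
  qed (use \<rho>_closed in auto)
  have C: "\<rho> ` W \<subseteq> carrier act.E" using \<rho>_closed by blast
  have comm: "c \<otimes>\<^bsub>act.E\<^esub> \<phi> = \<phi> \<otimes>\<^bsub>act.E\<^esub> c" if "c \<in> \<rho> ` W" "\<phi> \<in> carrier act.E" for c \<phi>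
    using that \<rho>_central by blast
  show "left_noetherian_ring act.E" "right_noetherian_ring act.E"
    by (rule E.one_sided_noetherian_if_central_acc[OF C comm acc]; assumption)+
qed

end

theorem proposition5p3:
  fixes K :: "('a, 'b) ring_scheme" and n r :: nat and \<epsilon> :: 'a
  assumes "n \<ge> 1" and "r \<ge> 1"
    and "cring K" and "noetherian_ring K"
    and "\<epsilon> \<in> Units K"
  shows "noetherian_ring (symmetric_laurent_ring K r)
    \<and> left_noetherian_ring (affine_schur K n r \<epsilon>)
    \<and> right_noetherian_ring (affine_schur K n r \<epsilon>)"
proof -
  interpret Z: laurent K r using \<open>cring K\<close> by (rule laurent.intro)
  interpret H: affine_hecke_algebra K r \<epsilon>
    using assms by (intro affine_hecke_algebra.intro affine_hecke_algebra_axioms.intro)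
  interpret S: finite_right_ideal_sum "affine_hecke K r \<epsilon>" "compositions n r" "hecke_x K r \<epsilon>"
    by (intro finite_right_ideal_sum.intro finite_right_ideal_sum_axioms.intro
        H.H.ring_axioms finite_compositions H.hecke_x_closed)
  obtain W where W: "W \<subseteq> carrier (affine_hecke K r \<epsilon>)"
      "noetherian_submodule (affine_hecke K r \<epsilon>) W (carrier (affine_hecke K r \<epsilon>))"
    and central: "\<And>w a. w \<in> W \<Longrightarrow> a \<in> carrier (affine_hecke K r \<epsilon>) \<Longrightarrow>
      w \<otimes>\<^bsub>affine_hecke K r \<epsilon>\<^esub> a = a \<otimes>\<^bsub>affine_hecke K r \<epsilon>\<^esub> w"
    using H.hecke_noetherian_over_center by blast
  show ?thesis
    using Z.noetherian_symmetric_laurent_ring[OF \<open>noetherian_ring K\<close>]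
      S.End_noetherian[OF W(1) central W(2)]
    unfolding affine_schur_def Let_def by blast
qed

end
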